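(* Let $N\ge2$ be given and let the parameters of the stochastic APD algorithm described in the context, with $V_X(x,x_t)=\|x-x_t\|^2/2$ and $V_Y(y,y_t)=\|y-y_t\|^2/2$, be set to $$\beta_t=\frac{t+1}2,\quad\theta_t=\frac{t-1}t,\quad\eta_t=\frac{3t}{4\eta},\quad\tau_t=\frac t\eta,$$ where $$\eta=2L_G+2L_K(N-1)+N\sqrt{N-1}\,\sigma/\tilde D\ \text{ for some }\tilde D>0,\qquad\sigma=\sqrt{\tfrac94\sigma_x^2+\sigma_y^2}.$$ Suppose assumption A1 (bounded variance, see context) holds, let $(\hat x,\hat y)$ be a pair of solutions (saddle point) of the saddle point problem, and let $D:=\sqrt{\|\hat x-x_1\|^2+\frac{\eta_1}{\tau_1}\|\hat y-y_1\|^2}$. Then there exists a (random) perturbation vector $v_N$ with $\mathbb E[\tilde g(z_N^{ag},v_N)]\le\varepsilon_N$ for some $\varepsilon_N$ satisfying $$\varepsilon_N\le\frac{36L_GD^2}{N(N-1)}+\frac{36L_KD^2}{N}+\frac{\sigma D\left(18D/\tilde D+3\tilde D/D\right)}{\sqrt{N-1}},$$ and with $$\mathbb E[\|v_N\|]\le\frac{50L_GD}{N(N-1)}+\frac{L_KD(55+3\tilde D/D)}{N}+\frac{\sigma(6+25D/\tilde D)}{\sqrt{N-1}}.$$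
   Context: Setting. $\mathcal X,\mathcal Y$ are finite-dimensional real vector spaces, each with an inner product $\langle\cdot,\cdot\rangle$ and, here (Euclidean setting), $\|\cdot\|$ the associated norm; $\|\cdot\|_*$ denotes the dual norm; $X\subseteq\mathcal X$, $Y\subseteq\mathcal Y$ are closed convex sets (possibly unbounded), $Z=X\times Y$, with $\langle(x,y),(x',y')\rangle=\langle x,x'\rangle+\langle y,y'\rangle$ and $\|(x,y)\|^2=\|x\|^2+\|y\|^2$. $G$ is a smooth convex function with $G(y)-G(x)-\langle\nabla G(x),y-x\rangle\le\frac{L_G}{2}\|y-x\|^2$ for all $x,y\in X$, for some $L_G\ge0$. $K:\mathcal X\to\mathcal Y$ is linear with transpose $K^T$ and operator norm $L_K=\|K\|$. $J:Y\to\mathbb R$ is proper, convex and lower semicontinuous. The saddle point problem is $\min_{x\in X}\max_{y\in Y}G(x)+\langle Kx,y\rangle-J(y)$, which is assumed to have a saddle point. Quantities in denominators ($\eta$, $D$) are understood to be positive. Stochastic oracle. A stochastic oracle returns unbiased estimators $\hat{\mathcal G}(x)=\mathcal G(x,\xi)$, $\hat{\mathcal K}_x(x)=\mathcal K_x(x,\xi)$, $\hat{\mathcal K}_y(y)=\mathcal K_y(y,\xi)$, with i.i.d. random vectors $\xi$: $\mathbb E[\hat{\mathcal G}(x)]=\nabla G(x)$, $\mathbb E[\hat{\mathcal K}_x(x)]=Kx$, $\mathbb E[\hat{\mathcal K}_y(y)]=K^Ty$. The samples used for the three evaluations in each iteration are independent of each other and of all previous iterations. A1: for constants $\sigma_{x,G},\sigma_y,\sigma_{x,K}\ge0$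 and all query points, $\mathbb E\|\hat{\mathcal G}(x)-\nabla G(x)\|_*^2\le\sigma_{x,G}^2$, $\mathbb E\|\hat{\mathcal K}_x(x)-Kx\|_*^2\le\sigma_y^2$, $\mathbb E\|\hat{\mathcal K}_y(y)-K^Ty\|_*^2\le\sigma_{x,K}^2$. Notation: $\sigma_x:=\sqrt{\sigma_{x,G}^2+\sigma_{x,K}^2}$. Stochastic APD algorithm. Choose $x_1\in X$, $y_1\in Y$; set $x_1^{ag}=x_1$, $y_1^{ag}=y_1$, $\bar x_1=x_1$. For $t=1,2,\dots,N-1$: $x_t^{md}=(1-\beta_t^{-1})x_t^{ag}+\beta_t^{-1}x_t$; $y_{t+1}=\operatorname{argmin}_{y\in Y}\langle-\hat{\mathcal K}_x(\bar x_t),y\rangle+J(y)+\frac1{\tau_t}V_Y(y,y_t)$; $x_{t+1}=\operatorname{argmin}_{x\in X}\langle\hat{\mathcal G}(x_t^{md}),x\rangle+\langle x,\hat{\mathcal K}_y(y_{t+1})\rangle+\frac1{\eta_t}V_X(x,x_t)$; $x_{t+1}^{ag}=(1-\beta_t^{-1})x_t^{ag}+\beta_t^{-1}x_{t+1}$; $y_{t+1}^{ag}=(1-\beta_t^{-1})y_t^{ag}+\beta_t^{-1}y_{t+1}$; $\bar x_{t+1}=\theta_{t+1}(x_{t+1}-x_t)+x_{t+1}$. Output $z_N^{ag}=(x_N^{ag},y_N^{ag})$. Gap functions. For $\tilde z=(\tilde x,\tilde y)$, $z=(x,y)\in Z$: $Q(\tilde z,z)=[G(\tilde x)+\langle K\tilde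 x,y\rangle-J(y)]-[G(x)+\langle Kx,\tilde y\rangle-J(\tilde y)]$. A point $\hat z\in Z$ is a solution (saddle point) iff $Q(\hat z,z)\le0$ for all $z\in Z$. For $v\in\mathcal X\times\mathcal Y$, $\tilde g(\tilde z,v)=\max_{z\in Z}\{Q(\tilde z,z)-\langle v,\tilde z-z\rangle\}$ (understood as a supremum). *)

theory Defs
  imports "HOL-Probability.Probability"
begin

definition lsc_on :: "'a::topological_space set \<Rightarrow> ('a \<Rightarrow> real) \<Rightarrow> bool" where
  "lsc_on S f \<longleftrightarrow> (\<forall>x\<in>S. \<forall>c<f x. \<forall>\<^sub>F y in at x within S. c < f y)"

definition dual_norm :: "'a::real_inner \<Rightarrow> real" where
  "dual_norm v = (SUP x\<in>cball 0 1. v \<bullet> x)"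

lemma dual_norm_eq_norm: "dual_norm v = norm v"
  unfolding dual_norm_def
proof (rule cSup_eq_maximum)
  show "norm v \<in> (\<lambda>x. v \<bullet> x) ` cball 0 1"
  proof (rule image_eqI)
    show "norm v = v \<bullet> sgn v"
      by (cases "v = 0") (simp_all add: sgn_div_norm dot_square_norm power2_eq_square)
    show "sgn v \<in> cball 0 1" by (simp add: norm_sgn)
  qed
next
  fix a assume "a \<in> (\<lambda>x. v \<bullet> x) ` cball 0 1"
  then obtain x where x: "a = v \<bullet> x" "norm x \<le> 1" by auto
  have "v \<bullet> x \<le> norm v * norm x" by (rule norm_cauchy_schwarz)
  also have "\<dots> \<le> norm v" using x(2) by (simp add: mult_left_le)
  finally show "a \<le> norm v" using x(1) by simp
qed

fun saddle_gap ::
  "('a::euclidean_space \<Rightarrow> real) \<Rightarrow> ('a \<Rightarrow> 'b::euclidean_space) \<Rightarrow> ('b \<Rightarrow> real) \<Rightarrow>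
   'a \<times> 'b \<Rightarrow> 'a \<times> 'b \<Rightarrow> real"
where
  "saddle_gap G K J (x', y') (x, y) =
     (G x' + K x' \<bullet> y - J y) - (G x + K x \<bullet> y' - J y')"

definition saddle_point ::
  "'a::euclidean_space set \<Rightarrow> 'b::euclidean_space set \<Rightarrow>
   ('a \<Rightarrow> real) \<Rightarrow> ('a \<Rightarrow> 'b) \<Rightarrow> ('b \<Rightarrow> real) \<Rightarrow> 'a \<times> 'b \<Rightarrow> bool"
where
  "saddle_point X Y G K J z' \<longleftrightarrow> z' \<in> X \<times> Y \<and> (\<forall>z\<in>X \<times> Y. saddle_gap G K J z' z \<le> 0)"

text \<open>Since \<open>X\<close> and \<open>Y\<close> may be unbounded, the supremum can be infinite. It is nonnegative for
  every \<open>z' \<in> X \<times> Y\<close>, as \<open>z = z'\<close> contributes the value 0.\<close>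

definition perturbed_gap ::
  "'a::euclidean_space set \<Rightarrow> 'b::euclidean_space set \<Rightarrow>
   ('a \<Rightarrow> real) \<Rightarrow> ('a \<Rightarrow> 'b) \<Rightarrow> ('b \<Rightarrow> real) \<Rightarrow> 'a \<times> 'b \<Rightarrow> 'a \<times> 'b \<Rightarrow> ereal"
where
  "perturbed_gap X Y G K J z' v =
     (SUP z\<in>X \<times> Y. ereal (saddle_gap G K J z' z - v \<bullet> (z' - z)))"

text \<open>\<open>f u s\<close> is the oracle's answer to the query \<open>u\<close> on the sample \<open>s\<close>, \<open>P\<close> is the law of a
  sample, \<open>S\<close> is the set of admissible queries and \<open>F\<close> is the map to be estimated.  Joint
  measurability is what makes the answer to a random query a random variable.\<close>

definition unbiased_oracle ::
  "'s measure \<Rightarrow> 'u::euclidean_space set \<Rightarrow> ('u \<Rightarrow> 's \<Rightarrow> 'v::euclidean_space) \<Rightarrow> ('u \<Rightarrow> 'v) \<Rightarrow> bool"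
where
  "unbiased_oracle P S f F \<longleftrightarrow>
     (\<lambda>(u, s). f u s) \<in> borel_measurable (restrict_space borel S \<Otimes>\<^sub>M P) \<and>
     (\<forall>u\<in>S. integrable P (f u) \<and> (\<integral>s. f u s \<partial>P) = F u)"

definition variance_bounded ::
  "'s measure \<Rightarrow> 'u::euclidean_space set \<Rightarrow> ('u \<Rightarrow> 's \<Rightarrow> 'v::euclidean_space) \<Rightarrow> ('u \<Rightarrow> 'v) \<Rightarrow>
   real \<Rightarrow> bool"
where
  "variance_bounded P S f F \<sigma> \<longleftrightarrow>
     (\<forall>u\<in>S. integrable P (\<lambda>s. (dual_norm (f u s - F u))\<^sup>2) \<and>
            (\<integral>s. (dual_norm (f u s - F u))\<^sup>2 \<partial>P) \<le> \<sigma>\<^sup>2)"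

text \<open>The three oracle evaluations of an iteration: gradient of \<open>G\<close>, \<open>K\<close>, and transpose of \<open>K\<close>.\<close>

datatype evaluation = EvalG | EvalKx | EvalKy

text \<open>One realisation of the stochastic APD algorithm; \<open>g t\<close>, \<open>kx t\<close>, \<open>ky t\<close> are the oracle answers
  in iteration \<open>t\<close>, as functions of the query.  Iterations are numbered from 1 to \<open>N - 1\<close>.
  Both minimisation problems are strongly convex, so \<open>is_arg_min\<close> determines the iterates.\<close>

definition APD_run ::
  "'a::euclidean_space set \<Rightarrow> 'b::euclidean_space set \<Rightarrow> ('b \<Rightarrow> real) \<Rightarrow> nat \<Rightarrow>
   (nat \<Rightarrow> real) \<Rightarrow> (nat \<Rightarrow> real) \<Rightarrow> (nat \<Rightarrow> real) \<Rightarrow> (nat \<Rightarrow> real) \<Rightarrow>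
   (nat \<Rightarrow> 'a \<Rightarrow> 'a) \<Rightarrow> (nat \<Rightarrow> 'a \<Rightarrow> 'b) \<Rightarrow> (nat \<Rightarrow> 'b \<Rightarrow> 'a) \<Rightarrow> 'a \<Rightarrow> 'b \<Rightarrow>
   (nat \<Rightarrow> 'a) \<Rightarrow> (nat \<Rightarrow> 'b) \<Rightarrow> (nat \<Rightarrow> 'a) \<Rightarrow> (nat \<Rightarrow> 'a) \<Rightarrow> (nat \<Rightarrow> 'b) \<Rightarrow> (nat \<Rightarrow> 'a) \<Rightarrow> bool"
where
  "APD_run X Y J N \<beta> \<theta> \<eta> \<tau> g kx ky x1 y1 x y xmd xag yag xbar \<longleftrightarrow>
     x 1 = x1 \<and> y 1 = y1 \<and> xag 1 = x1 \<and> yag 1 = y1 \<and> xbar 1 = x1 \<and>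
     (\<forall>t\<in>{1..N - 1}.
        xmd t = (1 - inverse (\<beta> t)) *\<^sub>R xag t + inverse (\<beta> t) *\<^sub>R x t \<and>
        is_arg_min (\<lambda>v. (- kx t (xbar t)) \<bullet> v + J v + 1 / \<tau> t * ((norm (v - y t))\<^sup>2 / 2))
          (\<lambda>v. v \<in> Y) (y (t + 1)) \<and>
        is_arg_min (\<lambda>u. g t (xmd t) \<bullet> u + u \<bullet> ky t (y (t + 1)) + 1 / \<eta> t * ((norm (u - x t))\<^sup>2 / 2))
          (\<lambda>u. u \<in> X) (x (t + 1)) \<and>
        xag (t + 1) = (1 - inverse (\<beta> t)) *\<^sub>R xag t + inverse (\<beta> t) *\<^sub>R x (t + 1) \<and>
        yag (t + 1) = (1 - inverse (\<beta> t)) *\<^sub>R yag t + inverse (\<beta> t) *\<^sub>R y (t + 1) \<and>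
        xbar (t + 1) = \<theta> (t + 1) *\<^sub>R (x (t + 1) - x t) + x (t + 1))"

end

theory Submission
  imports Defs
begin

text \<open>
  Let \<open>Q\<close> be the saddle gap and fix a comparison point \<open>z = (u, v)\<close>. Multiply the inequalities of
  iteration \<open>t\<close> by \<open>t\<close> and add them up. All parameters are chosen so that everything telescopes:
  the averaging weights \<open>\<beta>\<^sub>t = (t + 1) / 2\<close> turn the gaps into \<open>t (t + 1) / 2 * Q(z\<^sup>a\<^sup>g, z)\<close>, the
  extrapolation \<open>\<theta>\<^sub>t = (t - 1) / t\<close> cancels the bilinear terms of consecutive iterations, and the
  squared distances to \<open>z\<close> get the constant coefficients \<open>t / (2 \<eta>\<^sub>t) = 2 \<eta> / 3\<close> and
  \<open>t / (2 \<tau>\<^sub>t) = \<eta> / 2\<close>. Since \<open>\<eta> \<ge> 2 LG + 2 LK (N - 1)\<close>, the negative terms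
  \<open>-norm (x\<^sub>t\<^sub>+\<^sub>1 - x\<^sub>t)\<^sup>2\<close> and \<open>-norm (y\<^sub>t\<^sub>+\<^sub>1 - y\<^sub>t)\<^sup>2\<close> absorb the smoothness term, the coupling
  through \<open>K\<close> and, by Young's inequality, the part of the noise that is correlated with the step.
  The result is \<open>gap_energy\<close>; the rest of the noise enters through \<open>err_y \<bullet> (y\<^sub>t - v) - err_x \<bullet> (x\<^sub>t - u)\<close>.

  \<^item> The right-hand side of \<open>gap_energy\<close> is affine in \<open>z\<close>: the squares \<open>norm u\<^sup>2\<close> and \<open>norm v\<^sup>2\<close> cancel.
    Its linear part, taken around the output \<open>z\<^sup>a\<^sup>g\<close>, is the perturbation vector
    (\<open>apd_perturbation\<close>). What remains does not depend on \<open>z\<close>, so it bounds the perturbed gap even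
    when \<open>X\<close> and \<open>Y\<close> are unbounded (\<open>perturbed_gap_le\<close>).

  \<^item> At a saddle point the gap is nonnegative, so the same inequality bounds the distance of the
    iterates from the saddle point (\<open>distance_energy\<close>). In expectation the linear noise terms
    vanish, because each sample is independent of the history that determines its query and its
    multiplier (\<open>fresh_oracle_error\<close>). This gives
    \<open>E (norm (x\<^sub>t - xh)\<^sup>2 + 9/16 norm (y\<^sub>t - yh)\<^sup>2) \<le> D\<^sup>2 + (\<Sum>t\<^sup>2) \<sigma>\<^sup>2 / \<eta>\<^sup>2\<close>; the ratio of the two
    Young constants \<open>3/2\<close> and \<open>2/3\<close> is the \<open>9/4\<close> in the definition of \<open>\<sigma>\<close>.

  \<^item> The perturbation consists of \<open>x\<^sub>1 - x\<^sub>N\<close>, \<open>y\<^sub>1 - y\<^sub>N\<close>, \<open>K (x\<^sub>N - x\<^sub>N\<^sub>-\<^sub>1)\<close> and the accumulated noise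
    \<open>\<Sum>t err\<^sub>t\<close>. The first three are controlled by the distance bound, the last by orthogonality of
    martingale differences. The same quantities bound the expected perturbed gap.

  \<^item> Finally \<open>\<eta> \<ge> N sqrt (N - 1) \<sigma> / Dt\<close> yields \<open>(\<Sum>t\<^sup>2) \<sigma>\<^sup>2 / \<eta>\<^sup>2 \<le> Dt\<^sup>2 / 3\<close>, and the stated rates
    follow by arithmetic (\<open>rate_arithmetic\<close>).

  Measurability of the iterates rests on the proximal point being a 1-Lipschitz function of the
  data; that of the perturbed gap on a supremum of continuous functions being lower semicontinuous.
\<close>

section \<open>Proximal and accelerated gradient steps\<close>

lemma norm_convex_comb_sq:
  fixes a b :: "'v::real_inner"
  shows "(norm ((1 - l) *\<^sub>R a + l *\<^sub>R b))\<^sup>2 =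
         (1 - l) * (norm a)\<^sup>2 + l * (norm b)\<^sup>2 - l * (1 - l) * (norm (a - b))\<^sup>2"
  unfolding power2_norm_eq_inner
  by (simp add: inner_simps inner_commute algebra_simps power2_eq_square)

text \<open>Strong convexity at the minimizer, obtained without subgradients: compare the minimizer
  \<open>p\<close> with the points \<open>(1 - l) p + l v\<close> of the segment to
  \<open>v\<close>, divide by \<open>l\<close> and let \<open>l\<close> tend to 0.\<close>

lemma prox_three_point:
  fixes S :: "'v::real_inner set" and h :: "'v \<Rightarrow> real"
  assumes h: "convex_on S h" and \<tau>: "\<tau> > 0"
    and p: "is_arg_min (\<lambda>v. k \<bullet> v + h v + 1 / \<tau> * ((norm (v - c))\<^sup>2 / 2)) (\<lambda>v. v \<in> S) p"
    and v: "v \<in> S"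
  shows "k \<bullet> (p - v) + h p - h v
         \<le> 1 / (2 * \<tau>) * ((norm (v - c))\<^sup>2 - (norm (p - c))\<^sup>2 - (norm (v - p))\<^sup>2)"
proof -
  have pS: "p \<in> S"
    and min: "\<And>w. w \<in> S \<Longrightarrow> k \<bullet> p + h p + 1 / \<tau> * ((norm (p - c))\<^sup>2 / 2)
                           \<le> k \<bullet> w + h w + 1 / \<tau> * ((norm (w - c))\<^sup>2 / 2)"
    using p by (auto simp: is_arg_min_linorder)
  define d where "d = k \<bullet> (v - p) + h v - h p + 1 / (2 * \<tau>) * ((norm (v - c))\<^sup>2 - (norm (p - c))\<^sup>2)"
  define e where "e = 1 / (2 * \<tau>) * (norm (v - p))\<^sup>2"
  have ineq: "(1 - l) * e \<le> d" if l: "0 < l" "l < 1" for l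
  proof -
    define w where "w = (1 - l) *\<^sub>R p + l *\<^sub>R v"
    have "w \<in> S"
      unfolding w_def using convex_on_imp_convex[OF h] pS v l by (intro convexD) auto
    moreover have "h w \<le> (1 - l) * h p + l * h v"
      unfolding w_def using h pS v l by (simp add: convex_on_def)
    moreover have "(norm (w - c))\<^sup>2 = (1 - l) * (norm (p - c))\<^sup>2 + l * (norm (v - c))\<^sup>2 - l * (1 - l) * (norm (v - p))\<^sup>2"
    proof -
      have "w - c = (1 - l) *\<^sub>R (p - c) + l *\<^sub>R (v - c)"
        by (simp add: w_def algebra_simps)
      then show ?thesis
        by (simp add: norm_convex_comb_sq norm_minus_commute)
    qed
    moreover have "k \<bullet> w = (1 - l) * (k \<bullet> p) + l * (k \<bullet> v)"
      by (simp add: w_def inner_simps)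
    ultimately have "k \<bullet> p + h p + 1 / \<tau> * ((norm (p - c))\<^sup>2 / 2) \<le>
       (1 - l) * (k \<bullet> p) + l * (k \<bullet> v) + ((1 - l) * h p + l * h v) +
       1 / \<tau> * (((1 - l) * (norm (p - c))\<^sup>2 + l * (norm (v - c))\<^sup>2 - l * (1 - l) * (norm (v - p))\<^sup>2) / 2)"
      using min[of w] by simp
    then have "l * ((1 - l) * e) \<le> l * d"
      using \<tau> by (simp add: d_def e_def inner_simps field_simps)
    then show ?thesis using l by simp
  qed
  have "e \<le> d"
  proof (rule tendsto_le[where F = "at_right 0"])
    show "((\<lambda>l::real. (1 - l) * e) \<longlongrightarrow> e) (at_right 0)"
      by (auto intro!: tendsto_eq_intros)
    show "((\<lambda>l::real. d) \<longlongrightarrow> d) (at_right 0)" by simp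
    show "\<forall>\<^sub>F l in at_right (0::real). (1 - l) * e \<le> d"
      using ineq eventually_at_right[of 0 "1::real"] by (auto intro: exI[of _ 1])
  qed simp
  then show ?thesis
    by (simp add: d_def e_def inner_simps algebra_simps)
qed

text \<open>The three-point inequality of each minimizer tested against the other one. Linear cost and
  centre matter only through the combination \<open>c - \<tau> k\<close>.\<close>

lemma prox_nonexpansive:
  fixes S :: "'v::real_inner set" and h :: "'v \<Rightarrow> real"
  assumes h: "convex_on S h" and \<tau>: "\<tau> > 0"
    and p: "is_arg_min (\<lambda>v. k \<bullet> v + h v + 1 / \<tau> * ((norm (v - c))\<^sup>2 / 2)) (\<lambda>v. v \<in> S) p"
    and p': "is_arg_min (\<lambda>v. k' \<bullet> v + h v + 1 / \<tau> * ((norm (v - c'))\<^sup>2 / 2)) (\<lambda>v. v \<in> S) p'"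
  shows "norm (p - p') \<le> norm ((c - \<tau> *\<^sub>R k) - (c' - \<tau> *\<^sub>R k'))"
proof -
  have "p \<in> S" "p' \<in> S"
    using p p' by (auto simp: is_arg_min_linorder)
  then have "k \<bullet> (p - p') + k' \<bullet> (p' - p) \<le>
       1 / (2 * \<tau>) * ((norm (p' - c))\<^sup>2 - (norm (p - c))\<^sup>2 - (norm (p' - p))\<^sup>2) +
       1 / (2 * \<tau>) * ((norm (p - c'))\<^sup>2 - (norm (p' - c'))\<^sup>2 - (norm (p - p'))\<^sup>2)"
    using prox_three_point[OF h \<tau> p, of p'] prox_three_point[OF h \<tau> p', of p] by simp
  also have "\<dots> = 1 / \<tau> * ((p - p') \<bullet> (c - c') - (norm (p - p'))\<^sup>2)"
    unfolding power2_norm_eq_inner using \<tau> by (simp add: inner_simps inner_commute field_simps)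
  finally have "\<tau> * (k \<bullet> (p - p') + k' \<bullet> (p' - p)) \<le> (p - p') \<bullet> (c - c') - (norm (p - p'))\<^sup>2"
    using \<tau> by (simp add: field_simps)
  then have "(norm (p - p'))\<^sup>2 \<le> (p - p') \<bullet> ((c - \<tau> *\<^sub>R k) - (c' - \<tau> *\<^sub>R k'))"
    by (simp add: inner_simps inner_commute algebra_simps)
  also have "\<dots> \<le> norm (p - p') * norm ((c - \<tau> *\<^sub>R k) - (c' - \<tau> *\<^sub>R k'))"
    by (rule norm_cauchy_schwarz)
  finally show ?thesis
    by (cases "norm (p - p') = 0") (simp_all add: power2_eq_square)
qed

text \<open>The argmin factors through a 1-Lipschitz function of \<open>c - \<tau> k\<close>. That
  function is constructed on the set of attained values only, where a minimizer is given.\<close>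

lemma prox_measurable:
  fixes S :: "'v::euclidean_space set" and h :: "'v \<Rightarrow> real"
  assumes h: "convex_on S h" and \<tau>: "\<tau> > 0"
    and [measurable]: "k \<in> borel_measurable F" "c \<in> borel_measurable F"
    and p: "\<And>\<omega>. \<omega> \<in> space F \<Longrightarrow>
      is_arg_min (\<lambda>v. k \<omega> \<bullet> v + h v + 1 / \<tau> * ((norm (v - c \<omega>))\<^sup>2 / 2)) (\<lambda>v. v \<in> S) (p \<omega>)"
  shows "p \<in> borel_measurable F"
proof -
  define w where "w \<omega> = c \<omega> - \<tau> *\<^sub>R k \<omega>" for \<omega>
  have [measurable]: "w \<in> borel_measurable F"
    unfolding w_def by measurable
  \<comment> \<open>A fibre of \<open>w\<close> may contain many points, but \<open>p\<close> is constant on it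
    by nonexpansiveness.\<close>
  define q where "q a = p (SOME \<omega>. \<omega> \<in> space F \<and> w \<omega> = a)" for a
  have lip: "norm (p \<omega> - p \<omega>') \<le> norm (w \<omega> - w \<omega>')" if "\<omega> \<in> space F" "\<omega>' \<in> space F" for \<omega> \<omega>'
    unfolding w_def by (rule prox_nonexpansive[OF h \<tau> p[OF that(1)] p[OF that(2)]])
  have q: "q (w \<omega>) = p \<omega>" if "\<omega> \<in> space F" for \<omega>
  proof -
    have "(SOME \<omega>'. \<omega>' \<in> space F \<and> w \<omega>' = w \<omega>) \<in> space F \<and> w (SOME \<omega>'. \<omega>' \<in> space F \<and> w \<omega>' = w \<omega>) = w \<omega>"
      by (rule someI[of _ \<omega>]) (use that in auto)
    then show ?thesis
      using lip[of "SOME \<omega>'. \<omega>' \<in> space F \<and> w \<omega>' = w \<omega>" \<omega>] that by (simp add: q_def)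
  qed
  have "1-lipschitz_on (w ` space F) q"
    by (rule lipschitz_onI) (auto simp: dist_norm q lip)
  then have "q \<in> borel_measurable (restrict_space borel (w ` space F))"
    by (intro borel_measurable_continuous_on_restrict lipschitz_on_continuous_on)
  moreover have "w \<in> measurable F (restrict_space borel (w ` space F))"
    by (rule measurable_restrict_space2) auto
  ultimately have "(\<lambda>\<omega>. q (w \<omega>)) \<in> borel_measurable F"
    by (rule measurable_compose[rotated])
  then show ?thesis
    by (subst measurable_cong[of _ _ "\<lambda>\<omega>. q (w \<omega>)"]) (auto simp: q)
qed

text \<open>The derivative is taken within \<open>X\<close>, which may have empty interior; restricting
  \<open>G\<close> to the segment from \<open>u\<close> to \<open>v\<close> reduces the claim
  to a one-sided difference quotient.\<close>

lemma convex_on_above_tangent: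
  fixes G :: "'v::real_inner \<Rightarrow> real"
  assumes G: "convex_on X G" and u: "u \<in> X" and v: "v \<in> X"
    and der: "(G has_derivative (\<lambda>h. g \<bullet> h)) (at u within X)"
  shows "G u + g \<bullet> (v - u) \<le> G v"
proof -
  define \<phi> where "\<phi> l = G (u + l *\<^sub>R (v - u))" for l
  have sub: "(\<lambda>l. u + l *\<^sub>R (v - u)) ` {0..1} \<subseteq> X"
  proof safe
    fix l :: real assume "l \<in> {0..1}"
    then have "(1 - l) *\<^sub>R u + l *\<^sub>R v \<in> X"
      using convex_on_imp_convex[OF G] u v by (intro convexD) auto
    then show "u + l *\<^sub>R (v - u) \<in> X" by (simp add: algebra_simps)
  qed
  have "((\<lambda>l. u + l *\<^sub>R (v - u)) has_derivative (\<lambda>h. h *\<^sub>R (v - u))) (at 0 within {0..1})"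
    by (auto intro!: derivative_eq_intros)
  moreover have "(G has_derivative (\<lambda>h. g \<bullet> h)) (at (u + 0 *\<^sub>R (v - u)) within (\<lambda>l. u + l *\<^sub>R (v - u)) ` {0..1})"
    using has_derivative_subset[OF der sub] by simp
  ultimately have "((\<lambda>l. G (u + l *\<^sub>R (v - u))) has_derivative (\<lambda>h. g \<bullet> (h *\<^sub>R (v - u)))) (at 0 within {0..1})"
    by (rule has_derivative_in_compose)
  moreover have "(\<lambda>h. g \<bullet> (h *\<^sub>R (v - u))) = (*) (g \<bullet> (v - u))"
    by (simp add: fun_eq_iff)
  ultimately have "(\<phi> has_real_derivative (g \<bullet> (v - u))) (at 0 within {0..1})"
    unfolding has_field_derivative_def \<phi>_def by simp
  then have lim: "((\<lambda>l. (\<phi> l - \<phi> 0) / (l - 0)) \<longlongrightarrow> g \<bullet> (v - u)) (at 0 within {0..1})"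
    by (simp add: has_field_derivative_iff)
  have "g \<bullet> (v - u) \<le> G v - G u"
  proof (rule tendsto_upperbound[OF lim])
    show "\<forall>\<^sub>F l in at 0 within {0..1}. (\<phi> l - \<phi> 0) / (l - 0) \<le> G v - G u"
      unfolding eventually_at_filter
    proof (intro always_eventually allI impI)
      fix l :: real assume l: "l \<noteq> 0" "l \<in> {0..1}"
      have "G ((1 - l) *\<^sub>R u + l *\<^sub>R v) \<le> (1 - l) * G u + l * G v"
        using G u v l by (simp add: convex_on_def)
      then have "\<phi> l - \<phi> 0 \<le> l * (G v - G u)"
        by (simp add: \<phi>_def algebra_simps)
      then show "(\<phi> l - \<phi> 0) / (l - 0) \<le> G v - G u"
        using l by (simp add: field_simps)
    qed
    show "at (0::real) within {0..1} \<noteq> bot"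
      by (simp add: trivial_limit_within islimpt_Icc)
  qed
  then show ?thesis by simp
qed

text \<open>Smoothness at the middle point \<open>md\<close> is used for the new average, and the tangent
  inequality at \<open>md\<close> for the old average and for \<open>u\<close>. The averages
  are coupled so that \<open>ag' - md = (p' - p) / b\<close>, which divides the smoothness
  error by \<open>b\<close>, and the gradient terms combine to \<open>gradG md \<bullet> (p' -
  u)\<close>.\<close>

lemma accelerated_gradient_step:
  fixes G :: "'v::real_inner \<Rightarrow> real"
  assumes G: "convex_on X G"
    and der: "\<And>u. u \<in> X \<Longrightarrow> (G has_derivative (\<lambda>h. gradG u \<bullet> h)) (at u within X)"
    and smooth: "\<And>u v. u \<in> X \<Longrightarrow> v \<in> X \<Longrightarrow> G v - G u - gradG u \<bullet> (v - u) \<le> L / 2 * (norm (v - u))\<^sup>2"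
    and b: "b \<ge> 1" and mem: "md \<in> X" "ag \<in> X" "ag' \<in> X" "u \<in> X"
    and md: "md = (1 - inverse b) *\<^sub>R ag + inverse b *\<^sub>R p"
    and ag': "ag' = (1 - inverse b) *\<^sub>R ag + inverse b *\<^sub>R p'"
  shows "b * G ag' \<le> (b - 1) * G ag + G u + gradG md \<bullet> (p' - u) + L / (2 * b) * (norm (p' - p))\<^sup>2"
proof -
  have b0: "b > 0" using b by simp
  have diff: "ag' - md = inverse b *\<^sub>R (p' - p)"
    by (simp add: md ag' algebra_simps)
  have t1: "G ag' \<le> G md + gradG md \<bullet> (ag' - md) + L / 2 * (norm (ag' - md))\<^sup>2"
    using smooth[of md ag'] mem by simp
  have "b * G ag' \<le> b * (G md + gradG md \<bullet> (ag' - md) + L / 2 * (norm (ag' - md))\<^sup>2)"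
    by (rule mult_left_mono[OF t1]) (use b0 in simp)
  also have "\<dots> = b * G md + gradG md \<bullet> (p' - p) + L / (2 * b) * (norm (p' - p))\<^sup>2"
  proof -
    have "b * (gradG md \<bullet> (ag' - md)) = gradG md \<bullet> (p' - p)"
      using b0 by (simp add: diff)
    moreover have "b * (norm (ag' - md))\<^sup>2 = (norm (p' - p))\<^sup>2 / b"
    proof -
      have "norm (ag' - md) = norm (p' - p) / b"
        using b0 by (simp add: diff divide_inverse mult.commute del: inverse_eq_divide)
      then show ?thesis
        using b0 by (simp add: power2_eq_square)
    qed
    ultimately show ?thesis by (simp add: algebra_simps)
  qed
  finally have 1: "b * G ag' \<le> b * G md + gradG md \<bullet> (p' - p) + L / (2 * b) * (norm (p' - p))\<^sup>2" .
  have 2: "(b - 1) * (G md + gradG md \<bullet> (ag - md)) \<le> (b - 1) * G ag"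
    by (rule mult_left_mono) (use convex_on_above_tangent[OF G _ _ der] mem b in auto)
  have 3: "G md + gradG md \<bullet> (u - md) \<le> G u"
    using convex_on_above_tangent[OF G _ _ der] mem by auto
  have "b *\<^sub>R md = (b - 1) *\<^sub>R ag + p"
    using b0 by (simp add: md algebra_simps)
  then have "gradG md \<bullet> (b *\<^sub>R md) = gradG md \<bullet> ((b - 1) *\<^sub>R ag + p)" by simp
  then have "(b - 1) * (gradG md \<bullet> (ag - md)) + gradG md \<bullet> (u - md) = gradG md \<bullet> (u - p)"
    by (simp add: inner_simps algebra_simps)
  then show ?thesis
    using 1 2 3 by (simp add: inner_simps algebra_simps)
qed

section \<open>Energy estimates along one trajectory\<close>

lemma inner_le_young:
  fixes a b :: "'v::real_inner"
  assumes "c > 0"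
  shows "a \<bullet> b \<le> c * (norm a)\<^sup>2 + (norm b)\<^sup>2 / (4 * c)"
proof -
  have "0 \<le> (norm ((2 * c) *\<^sub>R a - b))\<^sup>2" by simp
  also have "\<dots> = 4 * c * (c * (norm a)\<^sup>2 + (norm b)\<^sup>2 / (4 * c) - a \<bullet> b)"
    unfolding power2_norm_eq_inner using assms
    by (simp add: inner_simps inner_commute field_simps power2_eq_square)
  finally show ?thesis using assms by (simp add: zero_le_mult_iff)
qed

lemma averaging_weight:
  assumes "t \<ge> 1"
  shows "0 \<le> 1 - inverse ((real t + 1) / 2)" "0 \<le> inverse ((real t + 1) / 2)"
  using assms by (simp_all add: field_simps)

definition weighted_noise :: "nat \<Rightarrow> (nat \<Rightarrow> 'v) \<Rightarrow> 'v::real_vector" where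
  "weighted_noise k e = (\<Sum>t=1..k. real t *\<^sub>R e t)"

text \<open>The linear part in the comparison point of the right-hand side of the energy inequality after
  \<open>N - 1\<close> iterations, divided by the weight \<open>N (N - 1) / 2\<close> of the
  final gap.\<close>

definition apd_perturbation ::
  "('a::euclidean_space \<Rightarrow> 'b::euclidean_space) \<Rightarrow> real \<Rightarrow> nat \<Rightarrow> (nat \<Rightarrow> 'a) \<Rightarrow> (nat \<Rightarrow> 'b) \<Rightarrow>
   (nat \<Rightarrow> 'a) \<Rightarrow> (nat \<Rightarrow> 'b) \<Rightarrow> 'a \<times> 'b" where
  "apd_perturbation K \<eta> N x y err_x err_y = (2 / (real N * (real N - 1))) *\<^sub>R
     ((4 * \<eta> / 3) *\<^sub>R (x 1 - x N) - weighted_noise (N - 1) err_x,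
      \<eta> *\<^sub>R (y 1 - y N) - (real N - 1) *\<^sub>R K (x N - x (N - 1)) + weighted_noise (N - 1) err_y)"

text \<open>One realization with deterministic data: \<open>err_x\<close> is the total error of the two
  oracle answers used in the primal step, \<open>err_y\<close> that of the answer used in the
  dual step.\<close>

locale apd_trajectory =
  fixes X :: "'a::euclidean_space set" and Y :: "'b::euclidean_space set"
    and G :: "'a \<Rightarrow> real" and gradG :: "'a \<Rightarrow> 'a" and K :: "'a \<Rightarrow> 'b" and J :: "'b \<Rightarrow> real"
    and LG LK \<eta> :: real and N :: nat
    and g :: "nat \<Rightarrow> 'a \<Rightarrow> 'a" and kx :: "nat \<Rightarrow> 'a \<Rightarrow> 'b" and ky :: "nat \<Rightarrow> 'b \<Rightarrow> 'a"
    and x1 :: 'a and y1 :: 'b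
    and x xmd xag xbar :: "nat \<Rightarrow> 'a" and y yag :: "nat \<Rightarrow> 'b"
    and err_x :: "nat \<Rightarrow> 'a" and err_y :: "nat \<Rightarrow> 'b"
  assumes G_convex: "convex_on X G"
    and G_gradient: "\<And>u. u \<in> X \<Longrightarrow> (G has_derivative (\<lambda>h. gradG u \<bullet> h)) (at u within X)"
    and G_smooth: "\<And>u v. u \<in> X \<Longrightarrow> v \<in> X \<Longrightarrow>
                     G v - G u - gradG u \<bullet> (v - u) \<le> LG / 2 * (norm (v - u))\<^sup>2"
    and LG_nonneg: "LG \<ge> 0"
    and K_linear: "linear K" and K_bound: "\<And>h. norm (K h) \<le> LK * norm h"
    and LK_nonneg: "LK \<ge> 0"
    and J_convex: "convex_on Y J"
    and N_ge_2: "N \<ge> 2" and \<eta>_pos: "\<eta> > 0" and stepsize: "2 * LG + 2 * LK * (real N - 1) \<le> \<eta>"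
    and start: "x1 \<in> X" "y1 \<in> Y"
    and run: "APD_run X Y J N (\<lambda>t. (real t + 1) / 2) (\<lambda>t. (real t - 1) / real t)
                (\<lambda>t. 3 * real t / (4 * \<eta>)) (\<lambda>t. real t / \<eta>) g kx ky x1 y1 x y xmd xag yag xbar"
    and err_x: "\<And>t. t \<in> {1..N - 1} \<Longrightarrow>
               g t (xmd t) + ky t (y (t + 1)) = gradG (xmd t) + adjoint K (y (t + 1)) + err_x t"
    and err_y: "\<And>t. t \<in> {1..N - 1} \<Longrightarrow> kx t (xbar t) = K (xbar t) + err_y t"
begin

lemma initial: "x 1 = x1" "y 1 = y1" "xag 1 = x1" "yag 1 = y1" "xbar 1 = x1"
  using run by (auto simp: APD_run_def)

lemma
  assumes "t \<in> {1..N - 1}"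
  shows xmd_eq: "xmd t = (1 - inverse ((real t + 1) / 2)) *\<^sub>R xag t + inverse ((real t + 1) / 2) *\<^sub>R x t"
    and y_argmin: "is_arg_min (\<lambda>v. (- kx t (xbar t)) \<bullet> v + J v + 1 / (real t / \<eta>) * ((norm (v - y t))\<^sup>2 / 2))
          (\<lambda>v. v \<in> Y) (y (t + 1))"
    and x_argmin: "is_arg_min (\<lambda>u. (g t (xmd t) + ky t (y (t + 1))) \<bullet> u + 0 + 1 / (3 * real t / (4 * \<eta>)) * ((norm (u - x t))\<^sup>2 / 2))
          (\<lambda>u. u \<in> X) (x (t + 1))"
    and xag_eq: "xag (t + 1) = (1 - inverse ((real t + 1) / 2)) *\<^sub>R xag t + inverse ((real t + 1) / 2) *\<^sub>R x (t + 1)"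
    and yag_eq: "yag (t + 1) = (1 - inverse ((real t + 1) / 2)) *\<^sub>R yag t + inverse ((real t + 1) / 2) *\<^sub>R y (t + 1)"
    and xbar_Suc: "xbar (t + 1) = ((real (t + 1) - 1) / real (t + 1)) *\<^sub>R (x (t + 1) - x t) + x (t + 1)"
proof -
  note r = bspec[OF run[unfolded APD_run_def, THEN conjunct2, THEN conjunct2, THEN conjunct2,
                        THEN conjunct2, THEN conjunct2] assms]
  show "xmd t = (1 - inverse ((real t + 1) / 2)) *\<^sub>R xag t + inverse ((real t + 1) / 2) *\<^sub>R x t"
    using r by (elim conjE)
  show "is_arg_min (\<lambda>v. (- kx t (xbar t)) \<bullet> v + J v + 1 / (real t / \<eta>) * ((norm (v - y t))\<^sup>2 / 2))
          (\<lambda>v. v \<in> Y) (y (t + 1))"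
    using r by (elim conjE)
  show "is_arg_min (\<lambda>u. (g t (xmd t) + ky t (y (t + 1))) \<bullet> u + 0 + 1 / (3 * real t / (4 * \<eta>)) * ((norm (u - x t))\<^sup>2 / 2))
          (\<lambda>u. u \<in> X) (x (t + 1))"
    using r unfolding inner_add_left inner_commute[of "ky t (y (t + 1))"] add_0_right by (elim conjE)
  show "xag (t + 1) = (1 - inverse ((real t + 1) / 2)) *\<^sub>R xag t + inverse ((real t + 1) / 2) *\<^sub>R x (t + 1)"
    using r by (elim conjE)
  show "yag (t + 1) = (1 - inverse ((real t + 1) / 2)) *\<^sub>R yag t + inverse ((real t + 1) / 2) *\<^sub>R y (t + 1)"
    using r by (elim conjE)
  show "xbar (t + 1) = ((real (t + 1) - 1) / real (t + 1)) *\<^sub>R (x (t + 1) - x t) + x (t + 1)"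
    using r by (elim conjE)
qed

lemma
  assumes "t \<in> {1..N}"
  shows x_mem: "x t \<in> X" and y_mem: "y t \<in> Y" and xag_mem: "xag t \<in> X" and yag_mem: "yag t \<in> Y"
proof -
  have "x t \<in> X \<and> y t \<in> Y \<and> xag t \<in> X \<and> yag t \<in> Y"
    using assms
  proof (induction t)
    case (Suc t)
    show ?case
    proof (cases "t = 0")
      case True
      then show ?thesis using initial start by simp
    next
      case False
      then have t: "t \<in> {1..N - 1}" using Suc.prems by auto
      have IH: "xag t \<in> X" "yag t \<in> Y" using Suc.IH t by auto
      have x': "x (t + 1) \<in> X" and y': "y (t + 1) \<in> Y"
        using x_argmin[OF t] y_argmin[OF t] by (auto simp: is_arg_min_linorder)
      have b: "0 \<le> 1 - inverse ((real t + 1) / 2)" "0 \<le> inverse ((real t + 1) / 2)"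
        using averaging_weight[of t] t by auto
      have "xag (t + 1) \<in> X"
        unfolding xag_eq[OF t]
        by (rule convexD[OF convex_on_imp_convex[OF G_convex] IH(1) x' b]) simp
      moreover have "yag (t + 1) \<in> Y"
        unfolding yag_eq[OF t]
        by (rule convexD[OF convex_on_imp_convex[OF J_convex] IH(2) y' b]) simp
      ultimately show ?thesis using x' y' by simp
    qed
  qed simp
  then show "x t \<in> X" "y t \<in> Y" "xag t \<in> X" "yag t \<in> Y" by auto
qed

lemma xmd_mem:
  assumes t: "t \<in> {1..N - 1}"
  shows "xmd t \<in> X"
proof -
  have t': "t \<in> {1..N}" using t by auto
  show ?thesis
    unfolding xmd_eq[OF t]
    by (rule convexD[OF convex_on_imp_convex[OF G_convex] xag_mem[OF t'] x_mem[OF t']])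
       (use averaging_weight[of t] t in auto)
qed

text \<open>The extrapolation formula multiplied by \<open>t\<close>. For \<open>t = 1\<close> the factor
  \<open>t - 1\<close> removes the unspecified previous iterate.\<close>

lemma xbar_eq:
  assumes "t \<in> {1..N - 1}"
  shows "real t *\<^sub>R xbar t = real t *\<^sub>R x t + (real t - 1) *\<^sub>R (x t - x (t - 1))"
proof (cases "t = 1")
  case True
  then show ?thesis using initial by simp
next
  case False
  then obtain m where m: "t = m + 1" "m \<in> {1..N - 1}"
    using assms by (intro that[of "t - 1"]) auto
  show ?thesis
    unfolding m(1) xbar_Suc[OF m(2)] by (simp add: scaleR_add_right)
qed

lemma adjoint_inner: "adjoint K w \<bullet> h = w \<bullet> K h"
  using adjoint_works[OF K_linear, of h w] by (simp add: inner_commute)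

text \<open>The extrapolated point in the dual step makes the bilinear term equal to \<open>-t K
  (x\<^sub>t\<^sub>+\<^sub>1 - x\<^sub>t) \<bullet> (y\<^sub>t\<^sub>+\<^sub>1 - v)\<close>
  minus the corresponding term of iteration \<open>t - 1\<close>, plus a remainder \<open>(t -
  1) K (x\<^sub>t - x\<^sub>t\<^sub>-\<^sub>1) \<bullet> (y\<^sub>t\<^sub>+\<^sub>1 -
  y\<^sub>t)\<close>. The term \<open>-LK t norm (x\<^sub>t\<^sub>+\<^sub>1 -
  x\<^sub>t)\<^sup>2\<close> is kept in the potential because it pays for this remainder in the
  next iteration.\<close>

lemma gap_step:
  assumes t: "t \<in> {1..N - 1}" and u: "u \<in> X" and v: "v \<in> Y"
  defines "Q \<equiv> \<lambda>t. saddle_gap G K J (xag t, yag t) (u, v)"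
  shows "real t * (real t + 1) / 2 * Q (t + 1) \<le> real t * (real t - 1) / 2 * Q t
     + 2 * \<eta> / 3 * ((norm (u - x t))\<^sup>2 - (norm (u - x (t + 1)))\<^sup>2)
     + \<eta> / 2 * ((norm (v - y t))\<^sup>2 - (norm (v - y (t + 1)))\<^sup>2)
     - real t * (K (x (t + 1) - x t) \<bullet> (y (t + 1) - v)) - LK * real t * (norm (x (t + 1) - x t))\<^sup>2
     + (real t - 1) * (K (x t - x (t - 1)) \<bullet> (y t - v)) + LK * (real t - 1) * (norm (x t - x (t - 1)))\<^sup>2
     + (real t)\<^sup>2 * (3 / 2 * (norm (err_x t))\<^sup>2 + 2 / 3 * (norm (err_y t))\<^sup>2) / \<eta>
     + real t * (err_y t \<bullet> (y t - v) - err_x t \<bullet> (x t - u))"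
proof -
  have t1: "real t \<ge> 1" and tN: "real t \<le> real N - 1" using t by auto
  have tm: "t \<in> {1..N}" "t + 1 \<in> {1..N}" using t by auto
  define b where "b = (real t + 1) / 2"
  have b: "b \<ge> 1" "b > 0" using t1 by (auto simp: b_def)
  define dx where "dx = x (t + 1) - x t"
  define dy where "dy = y (t + 1) - y t"
  define dp where "dp = x t - x (t - 1)"
  note Klin = linear_add[OF K_linear] linear_diff[OF K_linear] linear_scale[OF K_linear]
  have G1: "b * G (xag (t + 1)) \<le> (b - 1) * G (xag t) + G u + gradG (xmd t) \<bullet> (x (t + 1) - u)
              + LG / (2 * b) * (norm dx)\<^sup>2"
    unfolding dx_def
    by (rule accelerated_gradient_step[OF G_convex G_gradient G_smooth b(1) xmd_mem[OF t]
          xag_mem[OF tm(1)] xag_mem[OF tm(2)] u])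
       (use xmd_eq[OF t] xag_eq[OF t] in \<open>simp_all add: b_def\<close>)
  have J1: "b * J (yag (t + 1)) \<le> (b - 1) * J (yag t) + J (y (t + 1))"
  proof -
    have "J (yag (t + 1)) \<le> (1 - inverse b) * J (yag t) + inverse b * J (y (t + 1))"
      unfolding yag_eq[OF t] b_def[symmetric]
      by (rule convex_onD[OF J_convex _ _ yag_mem[OF tm(1)] y_mem[OF tm(2)]])
         (use b in \<open>auto simp: field_simps\<close>)
    from mult_left_mono[OF this less_imp_le[OF b(2)]]
    have "b * J (yag (t + 1)) \<le> (b * (1 - inverse b)) * J (yag t) + (b * inverse b) * J (y (t + 1))"
      by (simp only: distrib_left mult.assoc)
    moreover have "b * (1 - inverse b) = b - 1" "b * inverse b = 1"
      using b by (simp_all add: right_diff_distrib)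
    ultimately show ?thesis by simp
  qed
  have B1: "b * (K (xag (t + 1)) \<bullet> v) = (b - 1) * (K (xag t) \<bullet> v) + K (x (t + 1)) \<bullet> v"
    unfolding xag_eq[OF t] b_def[symmetric] using b
    by (simp add: Klin inner_simps field_simps)
  have B2: "b * (K u \<bullet> yag (t + 1)) = (b - 1) * (K u \<bullet> yag t) + K u \<bullet> y (t + 1)"
    unfolding yag_eq[OF t] b_def[symmetric] using b
    by (simp add: inner_simps field_simps)
  have "b * Q (t + 1) \<le> (b - 1) * Q t + gradG (xmd t) \<bullet> (x (t + 1) - u)
      + LG / (2 * b) * (norm dx)\<^sup>2 + J (y (t + 1)) - J v + K (x (t + 1)) \<bullet> v - K u \<bullet> y (t + 1)"
    using G1 J1 B1 B2 unfolding Q_def by (simp add: algebra_simps)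
  from mult_left_mono[OF this, of "real t"] t1
  have main: "real t * (real t + 1) / 2 * Q (t + 1) \<le> real t * (real t - 1) / 2 * Q t
      + real t * (gradG (xmd t) \<bullet> (x (t + 1) - u)) + real t * (LG / (2 * b) * (norm dx)\<^sup>2)
      + real t * (J (y (t + 1)) - J v) + real t * (K (x (t + 1)) \<bullet> v) - real t * (K u \<bullet> y (t + 1))"
    by (simp add: b_def algebra_simps)
  have PY: "real t * (- kx t (xbar t) \<bullet> (y (t + 1) - v)) + real t * (J (y (t + 1)) - J v) \<le>
      \<eta> / 2 * ((norm (v - y t))\<^sup>2 - (norm (v - y (t + 1)))\<^sup>2) - \<eta> / 2 * (norm dy)\<^sup>2"
  proof -
    have "real t * (- kx t (xbar t) \<bullet> (y (t + 1) - v) + J (y (t + 1)) - J v) \<le>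
      real t * (1 / (2 * (real t / \<eta>)) * ((norm (v - y t))\<^sup>2 - (norm (y (t + 1) - y t))\<^sup>2 - (norm (v - y (t + 1)))\<^sup>2))"
      by (intro mult_left_mono prox_three_point[OF J_convex _ y_argmin[OF t] v])
         (use t1 \<eta>_pos in auto)
    then show ?thesis using t1 \<eta>_pos by (simp add: dy_def algebra_simps)
  qed
  have PX: "real t * ((g t (xmd t) + ky t (y (t + 1))) \<bullet> (x (t + 1) - u)) \<le>
      2 * \<eta> / 3 * ((norm (u - x t))\<^sup>2 - (norm (u - x (t + 1)))\<^sup>2) - 2 * \<eta> / 3 * (norm dx)\<^sup>2"
  proof -
    have "real t * ((g t (xmd t) + ky t (y (t + 1))) \<bullet> (x (t + 1) - u) + 0 - 0) \<le>
      real t * (1 / (2 * (3 * real t / (4 * \<eta>))) * ((norm (u - x t))\<^sup>2 - (norm (x (t + 1) - x t))\<^sup>2 - (norm (u - x (t + 1)))\<^sup>2))"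
      by (intro mult_left_mono prox_three_point[OF _ _ x_argmin[OF t] u])
         (use t1 \<eta>_pos in \<open>auto simp: convex_on_const convex_on_imp_convex[OF G_convex]\<close>)
    then show ?thesis using t1 \<eta>_pos by (simp add: dx_def algebra_simps)
  qed
  have PX': "real t * ((g t (xmd t) + ky t (y (t + 1))) \<bullet> (x (t + 1) - u)) =
      real t * (gradG (xmd t) \<bullet> (x (t + 1) - u)) + real t * (K (x (t + 1)) \<bullet> y (t + 1)) - real t * (K u \<bullet> y (t + 1))
      + real t * (err_x t \<bullet> (x t - u)) + real t * (err_x t \<bullet> dx)"
    unfolding err_x[OF t] dx_def
    by (simp add: inner_add_left inner_diff_right adjoint_inner inner_commute[of "y (Suc t)"] Klin algebra_simps)
  have PY': "real t * (- kx t (xbar t) \<bullet> (y (t + 1) - v)) =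
      - (real t * (K (x t) \<bullet> (y (t + 1) - v))) - (real t - 1) * (K dp \<bullet> (y t - v)) - (real t - 1) * (K dp \<bullet> dy)
      - real t * (err_y t \<bullet> (y t - v)) - real t * (err_y t \<bullet> dy)"
  proof -
    have "real t *\<^sub>R K (xbar t) = real t *\<^sub>R K (x t) + (real t - 1) *\<^sub>R K dp"
      using arg_cong[OF xbar_eq[OF t], of K] by (simp add: Klin dp_def)
    then have "real t * (K (xbar t) \<bullet> (y (t + 1) - v)) = (real t *\<^sub>R K (x t) + (real t - 1) *\<^sub>R K dp) \<bullet> (y (t + 1) - v)"
      by (metis inner_scaleR_left)
    then show ?thesis
      unfolding err_y[OF t] dy_def by (simp add: inner_simps algebra_simps)
  qed
  \<comment> \<open>The budget: \<open>2 \<eta> / 3 = \<eta> / 2 + \<eta> / 6\<close> for the primal step, where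
    \<open>\<eta> / 2 \<ge> LG + LK t\<close> and \<open>\<eta> / 6\<close> is left for the
    noise; \<open>\<eta> / 2 = \<eta> / 8 + 3 \<eta> / 8\<close> for the dual step, where
    \<open>\<eta> / 8\<close> pays for the coupling. Young's inequality with these shares
    produces the constants \<open>3/2\<close> and \<open>2/3\<close>.\<close>
  have D1: "real t * (LG / (2 * b) * (norm dx)\<^sup>2) \<le> LG * (norm dx)\<^sup>2"
  proof -
    have "real t * (LG / (2 * b)) \<le> LG"
      using t1 LG_nonneg by (simp add: b_def field_simps mult_left_mono)
    from mult_right_mono[OF this, of "(norm dx)\<^sup>2"] show ?thesis by simp
  qed
  have D2: "LK * real t \<le> \<eta> / 2 - LG"
    using stepsize mult_left_mono[OF tN LK_nonneg] by simp
  have D2': "LK * real t * (norm dx)\<^sup>2 \<le> (\<eta> / 2 - LG) * (norm dx)\<^sup>2"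
    using D2 by (rule mult_right_mono) simp
  have D3: "- (real t * (err_x t \<bullet> dx)) \<le> \<eta> / 6 * (norm dx)\<^sup>2 + (real t)\<^sup>2 * (3 / 2 * (norm (err_x t))\<^sup>2) / \<eta>"
    using inner_le_young[of "\<eta> / 6" dx "- (real t *\<^sub>R err_x t)"] \<eta>_pos t1
    by (simp add: inner_commute power_mult_distrib field_simps)
  have D4: "real t * (err_y t \<bullet> dy) \<le> 3 * \<eta> / 8 * (norm dy)\<^sup>2 + (real t)\<^sup>2 * (2 / 3 * (norm (err_y t))\<^sup>2) / \<eta>"
    using inner_le_young[of "3 * \<eta> / 8" dy "real t *\<^sub>R err_y t"] \<eta>_pos t1
    by (simp add: inner_commute power_mult_distrib field_simps)
  have D5: "(real t - 1) * (K dp \<bullet> dy) \<le> LK * (real t - 1) * (norm dp)\<^sup>2 + \<eta> / 8 * (norm dy)\<^sup>2"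
  proof -
    have "K dp \<bullet> dy \<le> norm (K dp) * norm dy" by (rule norm_cauchy_schwarz)
    also have "\<dots> \<le> LK * norm dp * norm dy" by (intro mult_right_mono K_bound) simp
    also have "\<dots> \<le> LK * ((norm dp)\<^sup>2 + (norm dy)\<^sup>2 / 4)"
      using mult_left_mono[OF inner_le_young[of 1 "norm dp" "norm dy"] LK_nonneg] by (simp add: mult.assoc)
    finally have "(real t - 1) * (K dp \<bullet> dy) \<le> (real t - 1) * (LK * ((norm dp)\<^sup>2 + (norm dy)\<^sup>2 / 4))"
      by (rule mult_left_mono) (use t1 in simp)
    also have "\<dots> = LK * (real t - 1) * (norm dp)\<^sup>2 + LK * (real t - 1) / 4 * (norm dy)\<^sup>2"
      by (simp add: algebra_simps)
    also have "\<dots> \<le> LK * (real t - 1) * (norm dp)\<^sup>2 + \<eta> / 8 * (norm dy)\<^sup>2"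
      by (intro add_left_mono mult_right_mono) (use D2 LG_nonneg LK_nonneg in \<open>simp_all add: algebra_simps\<close>)
    finally show ?thesis .
  qed
  have D6: "real t * (K (x (t + 1)) \<bullet> v) - real t * (K (x (t + 1)) \<bullet> y (t + 1)) + real t * (K (x t) \<bullet> (y (t + 1) - v))
      = - (real t * (K dx \<bullet> (y (t + 1) - v)))"
    unfolding dx_def by (simp add: Klin inner_simps algebra_simps)
  have D7: "(real t)\<^sup>2 * (3 / 2 * (norm (err_x t))\<^sup>2 + 2 / 3 * (norm (err_y t))\<^sup>2) / \<eta> =
     (real t)\<^sup>2 * (3 / 2 * (norm (err_x t))\<^sup>2) / \<eta> + (real t)\<^sup>2 * (2 / 3 * (norm (err_y t))\<^sup>2) / \<eta>"
    by (simp add: distrib_left add_divide_distrib)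
  have D8: "2 * \<eta> / 3 * (norm dx)\<^sup>2 = LG * (norm dx)\<^sup>2 + (\<eta> / 2 - LG) * (norm dx)\<^sup>2 + \<eta> / 6 * (norm dx)\<^sup>2"
    by (simp add: algebra_simps)
  have D9: "\<eta> / 2 * (norm dy)\<^sup>2 = 3 * \<eta> / 8 * (norm dy)\<^sup>2 + \<eta> / 8 * (norm dy)\<^sup>2"
    by (simp add: algebra_simps)
  show ?thesis
    unfolding D7 dx_def[symmetric] dp_def[symmetric] right_diff_distrib[of "real t" "err_y t \<bullet> _"]
    using main PX PX' PY PY' D1 D2' D3 D4 D5 D6 D8 D9
    by linarith
qed

text \<open>The sum of the one-step inequalities. The two boundary terms carry the factor
  \<open>k\<close>: at \<open>k = 0\<close>, where \<open>x 0\<close> is unspecified, the bound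
  reads \<open>0 \<le> 0\<close>.\<close>

lemma gap_energy:
  assumes k: "k \<le> N - 1" and u: "u \<in> X" and v: "v \<in> Y"
  shows "real k * (real k + 1) / 2 * saddle_gap G K J (xag (k + 1), yag (k + 1)) (u, v) \<le>
     2 * \<eta> / 3 * ((norm (u - x1))\<^sup>2 - (norm (u - x (k + 1)))\<^sup>2)
     + \<eta> / 2 * ((norm (v - y1))\<^sup>2 - (norm (v - y (k + 1)))\<^sup>2)
     - real k * (K (x (k + 1) - x k) \<bullet> (y (k + 1) - v)) - LK * real k * (norm (x (k + 1) - x k))\<^sup>2
     + (\<Sum>t=1..k. (real t)\<^sup>2 * (3 / 2 * (norm (err_x t))\<^sup>2 + 2 / 3 * (norm (err_y t))\<^sup>2) / \<eta>)
     + (\<Sum>t=1..k. real t * (err_y t \<bullet> (y t - v) - err_x t \<bullet> (x t - u)))"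
  using k
proof (induction k)
  case 0
  then show ?case using initial by simp
next
  case (Suc k)
  have t: "Suc k \<in> {1..N - 1}" using Suc.prems by auto
  show ?case
    using gap_step[OF t u v] Suc.IH Suc.prems by (simp add: algebra_simps)
qed

text \<open>The bilinear boundary term costs only a quarter of the available \<open>\<eta> / 2 * (norm
  w)\<^sup>2\<close>, because \<open>LK k \<le> \<eta> / 2\<close>.\<close>

lemma final_coupling_le:
  assumes "k \<le> N - 1"
  shows "- (real k * (K (x (k + 1) - x k) \<bullet> w)) - LK * real k * (norm (x (k + 1) - x k))\<^sup>2
         \<le> \<eta> / 8 * (norm w)\<^sup>2"
proof -
  define d where "d = x (k + 1) - x k"
  have "real (k + 1) \<le> real N"
    using assms N_ge_2 by (intro of_nat_mono) linarith
  then have "LK * real k \<le> LK * (real N - 1)"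
    using LK_nonneg by (intro mult_left_mono) auto
  then have k: "LK * real k \<le> \<eta> / 2"
    using stepsize LG_nonneg by simp
  have "- (K d \<bullet> w) \<le> norm (K d) * norm w"
    using norm_cauchy_schwarz[of "- K d" w] by simp
  also have "\<dots> \<le> LK * norm d * norm w" by (intro mult_right_mono K_bound) simp
  also have "\<dots> \<le> LK * ((norm d)\<^sup>2 + (norm w)\<^sup>2 / 4)"
    using mult_left_mono[OF inner_le_young[of 1 "norm d" "norm w"] LK_nonneg] by (simp add: mult.assoc)
  finally have "real k * - (K d \<bullet> w) \<le> real k * (LK * ((norm d)\<^sup>2 + (norm w)\<^sup>2 / 4))"
    by (rule mult_left_mono) simp
  moreover have "LK * real k * ((norm w)\<^sup>2 / 4) \<le> \<eta> / 2 * ((norm w)\<^sup>2 / 4)"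
    using k by (rule mult_right_mono) simp
  ultimately show ?thesis
    unfolding d_def[symmetric] by (simp add: algebra_simps)
qed

text \<open>The gap of any feasible point relative to a saddle point is nonnegative, so the energy
  inequality, rescaled by \<open>3 / (2 \<eta>)\<close>, bounds the distance to the saddle
  point. The coefficient \<open>9 / 16\<close> is what the coupling leaves of \<open>3 /
  4\<close>.\<close>

lemma distance_energy:
  assumes k: "k \<le> N - 1" and solution: "saddle_point X Y G K J (xh, yh)"
  shows "(norm (x (k + 1) - xh))\<^sup>2 + 9 / 16 * (norm (y (k + 1) - yh))\<^sup>2 \<le>
     (norm (xh - x1))\<^sup>2 + 3 / 4 * (norm (yh - y1))\<^sup>2
     + (\<Sum>t=1..k. (real t)\<^sup>2 * (9 / 4 * (norm (err_x t))\<^sup>2 + (norm (err_y t))\<^sup>2)) / \<eta>\<^sup>2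
     + 3 / (2 * \<eta>) * (\<Sum>t=1..k. real t * (err_y t \<bullet> (y t - yh) - err_x t \<bullet> (x t - xh)))"
proof -
  have k': "k + 1 \<in> {1..N}" using k N_ge_2 by auto
  have sol: "xh \<in> X" "yh \<in> Y" "saddle_gap G K J (xh, yh) (xag (k + 1), yag (k + 1)) \<le> 0"
    using solution xag_mem[OF k'] yag_mem[OF k'] by (auto simp: saddle_point_def)
  then have "0 \<le> real k * (real k + 1) / 2 * saddle_gap G K J (xag (k + 1), yag (k + 1)) (xh, yh)"
    by simp
  also note gap_energy[OF k sol(1,2)]
  finally have "\<eta> * (2 / 3 * (norm (xh - x (k + 1)))\<^sup>2 + 3 / 8 * (norm (yh - y (k + 1)))\<^sup>2) \<le>
     \<eta> * (2 / 3 * (norm (xh - x1))\<^sup>2 + 1 / 2 * (norm (yh - y1))\<^sup>2)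
     + (\<Sum>t=1..k. (real t)\<^sup>2 * (3 / 2 * (norm (err_x t))\<^sup>2 + 2 / 3 * (norm (err_y t))\<^sup>2) / \<eta>)
     + (\<Sum>t=1..k. real t * (err_y t \<bullet> (y t - yh) - err_x t \<bullet> (x t - xh)))"
    using final_coupling_le[OF k, of "y (k + 1) - yh"]
    by (simp add: norm_minus_commute[of _ yh] algebra_simps)
  also have "(\<Sum>t=1..k. (real t)\<^sup>2 * (3 / 2 * (norm (err_x t))\<^sup>2 + 2 / 3 * (norm (err_y t))\<^sup>2) / \<eta>)
      = 2 / (3 * \<eta>) * (\<Sum>t=1..k. (real t)\<^sup>2 * (9 / 4 * (norm (err_x t))\<^sup>2 + (norm (err_y t))\<^sup>2))"
    unfolding sum_distrib_left using \<eta>_pos by (intro sum.cong) (simp_all add: field_simps)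
  finally have "3 / (2 * \<eta>) * (\<eta> * (2 / 3 * (norm (xh - x (k + 1)))\<^sup>2 + 3 / 8 * (norm (yh - y (k + 1)))\<^sup>2)) \<le>
     3 / (2 * \<eta>) * (\<eta> * (2 / 3 * (norm (xh - x1))\<^sup>2 + 1 / 2 * (norm (yh - y1))\<^sup>2)
     + 2 / (3 * \<eta>) * (\<Sum>t=1..k. (real t)\<^sup>2 * (9 / 4 * (norm (err_x t))\<^sup>2 + (norm (err_y t))\<^sup>2))
     + (\<Sum>t=1..k. real t * (err_y t \<bullet> (y t - yh) - err_x t \<bullet> (x t - xh))))"
    by (rule mult_left_mono) (use \<eta>_pos in simp)
  then show ?thesis
    using \<eta>_pos by (simp add: norm_minus_commute[of xh] norm_minus_commute[of yh] distrib_left power2_eq_square)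
qed

abbreviation "noise_x \<equiv> weighted_noise (N - 1) err_x"
abbreviation "noise_y \<equiv> weighted_noise (N - 1) err_y"
abbreviation "perturbation \<equiv> apd_perturbation K \<eta> N x y err_x err_y"

text \<open>Up to the weight of the gap, the energy bound at \<open>(u, v)\<close> exceeds the energy
  bound at the output exactly by the inner product of the perturbation with the output minus
  \<open>(u, v)\<close>. So the supremum over \<open>(u, v)\<close> is bounded by the energy
  bound at the output itself. The accumulated noise is correlated with the output and is
  therefore separated from it by Young's inequality.\<close>

lemma perturbed_gap_le:
  "perturbed_gap X Y G K J (xag N, yag N) perturbation \<le> ereal (2 / (real N * (real N - 1)) *
     (\<eta> * ((norm (xag N - x1))\<^sup>2 + 3 / 4 * (norm (yag N - y1))\<^sup>2)
      + 2 / (3 * \<eta>) * (\<Sum>t=1..N - 1. (real t)\<^sup>2 * (9 / 4 * (norm (err_x t))\<^sup>2 + (norm (err_y t))\<^sup>2))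
      + (3 / 4 * (norm noise_x)\<^sup>2 + (norm noise_y)\<^sup>2) / \<eta>
      + (\<Sum>t=1..N - 1. real t * (err_y t \<bullet> (y t - y1) - err_x t \<bullet> (x t - x1)))))"
  (is "_ \<le> ereal (_ * (?A + ?S + ?T + ?U))")
  unfolding perturbed_gap_def
proof (rule SUP_least, clarify)
  fix u v assume u: "u \<in> X" and v: "v \<in> Y"
  define c where "c = 2 / (real N * (real N - 1))"
  have c: "c > 0" using N_ge_2 by (simp add: c_def)
  define a where "a = xag N"
  define b where "b = yag N"
  define d where "d = K (x N - x (N - 1))"
  define q where "q = norm (x N - x (N - 1))"
  have N1: "real (N - 1) = real N - 1" "N - 1 + 1 = N"
    using N_ge_2 by auto
  have S: "(\<Sum>t=1..N - 1. (real t)\<^sup>2 * (3 / 2 * (norm (err_x t))\<^sup>2 + 2 / 3 * (norm (err_y t))\<^sup>2) / \<eta>) = ?S"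
    unfolding sum_distrib_left using \<eta>_pos by (intro sum.cong) (simp_all add: field_simps)
  \<comment> \<open>The noise is recentred at the starting point, which is deterministic, so that the sum in
    \<open>?U\<close> has mean zero.\<close>
  have U: "(\<Sum>t=1..N - 1. real t * (err_y t \<bullet> (y t - v) - err_x t \<bullet> (x t - u)))
           = ?U + noise_y \<bullet> (y1 - v) - noise_x \<bullet> (x1 - u)"
    unfolding weighted_noise_def inner_sum_left sum.distrib[symmetric] sum_subtractf[symmetric]
    by (rule sum.cong) (simp_all add: inner_simps algebra_simps)
  have E: "saddle_gap G K J (a, b) (u, v) / c \<le>
       2 * \<eta> / 3 * ((norm (u - x1))\<^sup>2 - (norm (u - x N))\<^sup>2)
     + \<eta> / 2 * ((norm (v - y1))\<^sup>2 - (norm (v - y N))\<^sup>2)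
     - (real N - 1) * (d \<bullet> (y N - v)) - LK * (real N - 1) * q\<^sup>2
     + ?S + (?U + noise_y \<bullet> (y1 - v) - noise_x \<bullet> (x1 - u))"
    using gap_energy[OF order_refl u v]
    unfolding N1 U S a_def[symmetric] b_def[symmetric] d_def[symmetric] q_def[symmetric]
    by (simp add: c_def mult.commute)
  have Px: "(norm (u - x1))\<^sup>2 - (norm (u - x N))\<^sup>2
      = (norm (a - x1))\<^sup>2 - (norm (a - x N))\<^sup>2 + 2 * ((x1 - x N) \<bullet> (a - u))"
    unfolding power2_norm_eq_inner by (simp add: inner_simps inner_commute algebra_simps)
  have Py: "(norm (v - y1))\<^sup>2 - (norm (v - y N))\<^sup>2
      = (norm (b - y1))\<^sup>2 - (norm (b - y N))\<^sup>2 + 2 * ((y1 - y N) \<bullet> (b - v))"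
    unfolding power2_norm_eq_inner by (simp add: inner_simps inner_commute algebra_simps)
  have Z: "perturbation \<bullet> ((a, b) - (u, v)) / c =
       4 * \<eta> / 3 * ((x1 - x N) \<bullet> (a - u)) - noise_x \<bullet> (a - u)
       + \<eta> * ((y1 - y N) \<bullet> (b - v)) - (real N - 1) * (d \<bullet> (b - v)) + noise_y \<bullet> (b - v)"
  proof -
    have "c * r / c = r" for r using c by simp
    then show ?thesis
      unfolding apd_perturbation_def initial c_def[symmetric] d_def[symmetric] inner_scaleR_left
      by (simp add: inner_add_left inner_diff_left)
  qed
  have C: "- ((real N - 1) * (d \<bullet> (y N - b))) - LK * (real N - 1) * q\<^sup>2 \<le> \<eta> / 8 * (norm (y N - b))\<^sup>2"
    using final_coupling_le[OF order_refl, of "y N - b"] unfolding N1 d_def q_def .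
  have Yx: "noise_x \<bullet> (a - x1) \<le> \<eta> / 3 * (norm (a - x1))\<^sup>2 + 3 / 4 * (norm noise_x)\<^sup>2 / \<eta>"
    using inner_le_young[of "\<eta> / 3" "a - x1" noise_x] \<eta>_pos by (simp add: inner_commute field_simps)
  have Yy: "noise_y \<bullet> (y1 - b) \<le> \<eta> / 4 * (norm (b - y1))\<^sup>2 + (norm noise_y)\<^sup>2 / \<eta>"
    using inner_le_young[of "\<eta> / 4" "y1 - b" noise_y] \<eta>_pos
    by (simp add: inner_commute norm_minus_commute field_simps)
  have nonneg: "0 \<le> \<eta> * (norm (a - x N))\<^sup>2" "0 \<le> \<eta> * (norm (b - y N))\<^sup>2"
    using \<eta>_pos by auto
  have I: "noise_x \<bullet> (x1 - u) = noise_x \<bullet> (a - u) - noise_x \<bullet> (a - x1)"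
          "noise_y \<bullet> (y1 - v) = noise_y \<bullet> (b - v) + noise_y \<bullet> (y1 - b)"
          "d \<bullet> (y N - v) = d \<bullet> (b - v) + d \<bullet> (y N - b)"
    by (simp_all add: inner_simps)
  have A: "?A = \<eta> * (norm (a - x1))\<^sup>2 + \<eta> * (3 / 4 * (norm (b - y1))\<^sup>2)"
    by (simp add: a_def b_def algebra_simps)
  have T: "?T = 3 / 4 * (norm noise_x)\<^sup>2 / \<eta> + (norm noise_y)\<^sup>2 / \<eta>"
    by (simp add: add_divide_distrib)
  have "(saddle_gap G K J (a, b) (u, v) - perturbation \<bullet> ((a, b) - (u, v))) / c \<le> ?A + ?S + ?T + ?U"
    using E C Yx Yy nonneg
    unfolding A T diff_divide_distrib Z Px Py I
    by (simp add: norm_minus_commute[of "y N" b] distrib_left right_diff_distrib)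
  then show "ereal (saddle_gap G K J (xag N, yag N) (u, v) - perturbation \<bullet> ((xag N, yag N) - (u, v)))
      \<le> ereal (2 / (real N * (real N - 1)) * (?A + ?S + ?T + ?U))"
    unfolding a_def[symmetric] b_def[symmetric] c_def[symmetric]
    using c by (simp add: field_simps)
qed

text \<open>The factor \<open>3 / 4\<close> on the dual component equals the ratio of
  \<open>\<eta>\<close> and \<open>4 \<eta> / 3\<close>. With it the first term is a distance
  in the norm whose square is bounded by \<open>distance_energy\<close>.\<close>

lemma norm_perturbation_le:
  "norm perturbation \<le> 2 / (real N * (real N - 1)) *
     (4 * \<eta> / 3 * norm (x N - x1, (3 / 4) *\<^sub>R (y N - y1)) + norm (noise_x, noise_y)
      + (real N - 1) * LK * norm (x N - x (N - 1)))"
proof -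
  have "((4 * \<eta> / 3) *\<^sub>R (x1 - x N) - noise_x,
      \<eta> *\<^sub>R (y1 - y N) - (real N - 1) *\<^sub>R K (x N - x (N - 1)) + noise_y)
     = (- (4 * \<eta> / 3)) *\<^sub>R (x N - x1, (3 / 4) *\<^sub>R (y N - y1)) + (- noise_x, noise_y)
       + (0, - ((real N - 1) *\<^sub>R K (x N - x (N - 1))))"
    by (simp add: scaleR_diff_right)
  also have "norm \<dots> \<le> norm ((- (4 * \<eta> / 3)) *\<^sub>R (x N - x1, (3 / 4) *\<^sub>R (y N - y1)))
       + norm (- noise_x, noise_y) + norm ((0::'a), - ((real N - 1) *\<^sub>R K (x N - x (N - 1))))"
    by (intro order_trans[OF norm_triangle_ineq] add_mono) auto
  also have "norm (- noise_x, noise_y) = norm (noise_x, noise_y)"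
    by (simp add: norm_Pair)
  also have "norm ((0::'a), - ((real N - 1) *\<^sub>R K (x N - x (N - 1)))) = (real N - 1) * norm (K (x N - x (N - 1)))"
    using N_ge_2 by (simp add: norm_Pair)
  also have "\<dots> \<le> (real N - 1) * (LK * norm (x N - x (N - 1)))"
    by (intro mult_left_mono K_bound) (use N_ge_2 in simp)
  finally show ?thesis
    unfolding apd_perturbation_def initial norm_scaleR using N_ge_2 \<eta>_pos
    by (intro mult_mono) (simp_all add: mult.assoc)
qed

end

section \<open>Square-integrable variables, histories and fresh samples\<close>

definition square_integrable :: "'w measure \<Rightarrow> ('w \<Rightarrow> 'v::euclidean_space) \<Rightarrow> bool" where
  "square_integrable M f \<longleftrightarrow> f \<in> borel_measurable M \<and> integrable M (\<lambda>\<omega>. (norm (f \<omega>))\<^sup>2)"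

lemma square_integrable_bound:
  assumes "f \<in> borel_measurable M" "integrable M B" "\<And>\<omega>. \<omega> \<in> space M \<Longrightarrow> (norm (f \<omega>))\<^sup>2 \<le> B \<omega>"
  shows "square_integrable M f"
  unfolding square_integrable_def
proof
  note [measurable] = assms(1)
  show "integrable M (\<lambda>\<omega>. (norm (f \<omega>))\<^sup>2)"
  proof (rule Bochner_Integration.integrable_bound[OF assms(2)])
    show "AE \<omega> in M. norm ((norm (f \<omega>))\<^sup>2) \<le> norm (B \<omega>)"
      using assms(3) by (intro AE_I2) (auto intro: order_trans[OF _ abs_ge_self])
  qed measurable
qed (fact assms(1))

lemma square_integrable_scaleR:
  assumes "square_integrable M f"
  shows "square_integrable M (\<lambda>\<omega>. c *\<^sub>R f \<omega>)"
  using assms by (auto simp: square_integrable_def power_mult_distrib)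

lemma norm_add_sq_le:
  fixes a b :: "'v::real_inner"
  shows "(norm (a + b))\<^sup>2 \<le> 2 * (norm a)\<^sup>2 + 2 * (norm b)\<^sup>2"
proof -
  have "0 \<le> (norm (a - b))\<^sup>2" by simp
  then show ?thesis
    unfolding power2_norm_eq_inner by (simp add: inner_simps inner_commute)
qed

lemma square_integrable_add:
  assumes "square_integrable M f" "square_integrable M g"
  shows "square_integrable M (\<lambda>\<omega>. f \<omega> + g \<omega>)"
  using assms norm_add_sq_le
  by (intro square_integrable_bound[where B = "\<lambda>\<omega>. 2 * (norm (f \<omega>))\<^sup>2 + 2 * (norm (g \<omega>))\<^sup>2"])
     (auto simp: square_integrable_def)

lemma square_integrable_diff:
  assumes "square_integrable M f" "square_integrable M g"
  shows "square_integrable M (\<lambda>\<omega>. f \<omega> - g \<omega>)"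
  using square_integrable_add[OF assms(1) square_integrable_scaleR[OF assms(2), of "-1"]] by simp

lemma square_integrable_sum:
  assumes "\<And>i. i \<in> I \<Longrightarrow> square_integrable M (f i)"
  shows "square_integrable M (\<lambda>\<omega>. \<Sum>i\<in>I. f i \<omega>)"
  using assms
proof (induction I rule: infinite_finite_induct)
  case (insert i I)
  then show ?case by (simp add: square_integrable_add)
qed (simp_all add: square_integrable_def)

lemma integrable_inner:
  assumes "square_integrable M f" "square_integrable M g"
  shows "integrable M (\<lambda>\<omega>. f \<omega> \<bullet> g \<omega>)"
proof (rule Bochner_Integration.integrable_bound)
  show "integrable M (\<lambda>\<omega>. (norm (f \<omega>))\<^sup>2 + (norm (g \<omega>))\<^sup>2)"
    using assms by (auto simp: square_integrable_def)
  show "(\<lambda>\<omega>. f \<omega> \<bullet> g \<omega>) \<in> borel_measurable M"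
    using assms by (auto simp: square_integrable_def)
  show "AE \<omega> in M. norm (f \<omega> \<bullet> g \<omega>) \<le> norm ((norm (f \<omega>))\<^sup>2 + (norm (g \<omega>))\<^sup>2)"
  proof (rule AE_I2)
    fix \<omega>
    have "\<bar>f \<omega> \<bullet> g \<omega>\<bar> \<le> norm (f \<omega>) * norm (g \<omega>)" by (rule Cauchy_Schwarz_ineq2)
    also have "\<dots> \<le> (norm (f \<omega>))\<^sup>2 + (norm (g \<omega>))\<^sup>2 / 4"
      using inner_le_young[of 1 "norm (f \<omega>)" "norm (g \<omega>)"] by simp
    also have "\<dots> \<le> (norm (f \<omega>))\<^sup>2 + (norm (g \<omega>))\<^sup>2" by simp
    finally show "norm (f \<omega> \<bullet> g \<omega>) \<le> norm ((norm (f \<omega>))\<^sup>2 + (norm (g \<omega>))\<^sup>2)" by simp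
  qed
qed

context prob_space
begin

lemma square_integrable_const: "square_integrable M (\<lambda>_. c)"
  by (simp add: square_integrable_def)

text \<open>The bound is Jensen's inequality, here in the form that the variance of the norm is
  nonnegative.\<close>

lemma square_integrable_norm_integrable:
  assumes "square_integrable M f"
  shows "integrable M (\<lambda>\<omega>. norm (f \<omega>))"
    and "(\<integral>\<omega>. norm (f \<omega>) \<partial>M) \<le> sqrt (\<integral>\<omega>. (norm (f \<omega>))\<^sup>2 \<partial>M)"
proof -
  have "square_integrable M (\<lambda>\<omega>. norm (f \<omega>))"
    using assms by (auto simp: square_integrable_def)
  from integrable_inner[OF this square_integrable_const[of 1]]
  show I: "integrable M (\<lambda>\<omega>. norm (f \<omega>))" by simp
  have "0 \<le> variance (\<lambda>\<omega>. norm (f \<omega>))" by (rule variance_positive)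
  also have "\<dots> = expectation (\<lambda>\<omega>. (norm (f \<omega>))\<^sup>2) - (expectation (\<lambda>\<omega>. norm (f \<omega>)))\<^sup>2"
    using assms I by (intro variance_eq) (auto simp: square_integrable_def)
  finally show "(\<integral>\<omega>. norm (f \<omega>) \<partial>M) \<le> sqrt (\<integral>\<omega>. (norm (f \<omega>))\<^sup>2 \<partial>M)"
    by (intro real_le_rsqrt) simp
qed

text \<open>The sigma-algebra on the sample space that is generated by the samples with index in
  \<open>A\<close>.\<close>

definition history :: "'s measure \<Rightarrow> ('i \<Rightarrow> 'a \<Rightarrow> 's) \<Rightarrow> 'i set \<Rightarrow> 'a measure" where
  "history P Z A = vimage_algebra (space M) (\<lambda>\<omega>. \<lambda>i\<in>A. Z i \<omega>) (PiM A (\<lambda>_. P))"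

lemma space_history [simp]: "space (history P Z A) = space M"
  by (simp add: history_def)

lemma measurable_history:
  assumes "\<And>i. i \<in> A \<Longrightarrow> Z i \<in> measurable M P"
  shows "(\<lambda>\<omega>. \<lambda>i\<in>A. Z i \<omega>) \<in> measurable M (PiM A (\<lambda>_. P))"
  using assms by (intro measurable_restrict) auto

lemma sample_measurable_history:
  assumes "\<And>i. i \<in> A \<Longrightarrow> Z i \<in> measurable M P" "i \<in> A"
  shows "Z i \<in> measurable (history P Z A) P"
proof -
  have "(\<lambda>\<omega>. \<lambda>i\<in>A. Z i \<omega>) \<in> measurable (history P Z A) (PiM A (\<lambda>_. P))"
    unfolding history_def using measurable_space[OF measurable_history, of A Z P] assms
    by (intro measurable_vimage_algebra1) auto
  from measurable_compose[OF this measurable_component_singleton[OF assms(2)]]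
  show ?thesis using assms(2) by simp
qed

lemma history_mono:
  assumes "\<And>i. i \<in> B \<Longrightarrow> Z i \<in> measurable M P" "A \<subseteq> B" "f \<in> measurable (history P Z A) L"
  shows "f \<in> measurable (history P Z B) L"
proof -
  have "(\<lambda>\<omega>. \<omega>) \<in> measurable (history P Z B) (history P Z A)"
    unfolding history_def[of P Z A]
  proof (rule measurable_vimage_algebra2)
    show "(\<lambda>\<omega>. \<lambda>i\<in>A. Z i \<omega>) \<in> measurable (history P Z B) (PiM A (\<lambda>_. P))"
      by (intro measurable_restrict sample_measurable_history[OF assms(1)]) (use assms(2) in auto)
  qed simp
  from measurable_compose[OF this assms(3)] show ?thesis .
qed

lemma history_measurable_imp:
  assumes "\<And>i. i \<in> A \<Longrightarrow> Z i \<in> measurable M P" "f \<in> measurable (history P Z A) L"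
  shows "f \<in> measurable M L"
proof -
  have "(\<lambda>\<omega>. \<omega>) \<in> measurable M (history P Z A)"
    unfolding history_def by (rule measurable_vimage_algebra2) (use measurable_history assms in auto)
  from measurable_compose[OF this assms(2)] show ?thesis .
qed

text \<open>Whatever is determined by the samples in \<open>A\<close> is independent of a sample outside
  \<open>A\<close>. Independence is expressed through the joint distribution because the two
  variables take values in different types.\<close>

lemma distr_history_sample:
  assumes ind: "indep_vars (\<lambda>_. P) Z I" and A: "A \<subseteq> I" and i: "i \<in> I" "i \<notin> A"
    and U: "U \<in> measurable (history P Z A) L"
  shows "distr M (L \<Otimes>\<^sub>M P) (\<lambda>\<omega>. (U \<omega>, Z i \<omega>)) = distr M L U \<Otimes>\<^sub>M distr M P (Z i)"
proof -
  have Z: "Z j \<in> measurable M P" if "j \<in> I" for j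
    using ind that by (auto simp: indep_vars_def2)
  note [measurable] = Z[OF i(1)]
  have U'[measurable]: "U \<in> measurable M L"
    using A Z by (intro history_measurable_imp[OF _ U]) auto
  define H where "H = (\<lambda>\<omega>. \<lambda>j\<in>A. Z j \<omega>)"
  define H' where "H' = (\<lambda>\<omega>. \<lambda>j\<in>{i}. Z j \<omega>)"
  have "indep_var (PiM A (\<lambda>_. P)) H (PiM {i} (\<lambda>_. P)) H'"
    unfolding H_def H'_def using A i by (intro indep_var_restrict[OF ind]) auto
  then have indep: "indep_set (sigma_sets (space M) {H -` B \<inter> space M | B. B \<in> sets (PiM A (\<lambda>_. P))})
      (sigma_sets (space M) {H' -` B \<inter> space M | B. B \<in> sets (PiM {i} (\<lambda>_. P))})"
    by (simp add: indep_var_eq)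
  interpret DU: prob_space "distr M L U" by (rule prob_space_distr) fact
  interpret DZ: prob_space "distr M P (Z i)" by (rule prob_space_distr) fact
  have "distr M L U \<Otimes>\<^sub>M distr M P (Z i) = distr M (L \<Otimes>\<^sub>M P) (\<lambda>\<omega>. (U \<omega>, Z i \<omega>))"
  proof (rule pair_measure_eqI)
    fix B C assume "B \<in> sets (distr M L U)" "C \<in> sets (distr M P (Z i))"
    then have B[measurable]: "B \<in> sets L" and C[measurable]: "C \<in> sets P" by auto
    have 1: "U -` B \<inter> space M \<in> sigma_sets (space M) {H -` B \<inter> space M | B. B \<in> sets (PiM A (\<lambda>_. P))}"
      using measurable_sets[OF U B] unfolding space_history
      by (simp add: history_def H_def sets_vimage_algebra)
    have 2: "Z i -` C \<inter> space M \<in> sigma_sets (space M) {H' -` B \<inter> space M | B. B \<in> sets (PiM {i} (\<lambda>_. P))}"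
    proof (rule sigma_sets.Basic, clarify, intro exI conjI)
      show "(\<lambda>h. h i) -` C \<inter> space (PiM {i} (\<lambda>_. P)) \<in> sets (PiM {i} (\<lambda>_. P))"
        using C by (intro measurable_sets[OF measurable_component_singleton]) auto
      show "Z i -` C \<inter> space M = H' -` ((\<lambda>h. h i) -` C \<inter> space (PiM {i} (\<lambda>_. P))) \<inter> space M"
        using measurable_space[OF Z[OF i(1)]] by (auto simp: H'_def space_PiM)
    qed
    have "prob ((U -` B \<inter> space M) \<inter> (Z i -` C \<inter> space M)) = prob (U -` B \<inter> space M) * prob (Z i -` C \<inter> space M)"
      by (rule indep_setD[OF indep 1 2])
    moreover have "(\<lambda>\<omega>. (U \<omega>, Z i \<omega>)) -` (B \<times> C) \<inter> space M = (U -` B \<inter> space M) \<inter> (Z i -` C \<inter> space M)"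
      by auto
    ultimately show "emeasure (distr M L U) B * emeasure (distr M P (Z i)) C
          = emeasure (distr M (L \<Otimes>\<^sub>M P) (\<lambda>\<omega>. (U \<omega>, Z i \<omega>))) (B \<times> C)"
      by (simp add: emeasure_distr emeasure_eq_measure ennreal_mult')
  qed (auto intro: DU.sigma_finite_measure_axioms DZ.sigma_finite_measure_axioms sets_pair_measure_cong)
  then show ?thesis ..
qed

lemma unbiased_oracle_measurable:
  assumes P: "prob_space P" and f: "unbiased_oracle P S f F"
  shows "F \<in> borel_measurable (restrict_space borel S)"
proof -
  interpret P: prob_space P by fact
  have [measurable]: "(\<lambda>(u, s). f u s) \<in> borel_measurable (restrict_space borel S \<Otimes>\<^sub>M P)"
    using f by (simp add: unbiased_oracle_def)
  have "(\<lambda>u. \<integral>s. f u s \<partial>P) \<in> borel_measurable (restrict_space borel S)"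
    by measurable
  then show ?thesis
    by (rule measurable_cong[THEN iffD1, rotated]) (use f in \<open>auto simp: unbiased_oracle_def space_restrict_space\<close>)
qed

text \<open>Conditionally on the query \<open>U\<close> and the multiplier \<open>W\<close>, the sample
  \<open>Z\<close> still has law \<open>P\<close>. By Fubini the moment claims reduce to the
  hypotheses on the oracle at a fixed query.\<close>

lemma fresh_sample:
  fixes f :: "'u::euclidean_space \<Rightarrow> 's \<Rightarrow> 'v::euclidean_space" and W :: "'a \<Rightarrow> 'v"
    and S :: "'u set"
  defines "A \<equiv> restrict_space borel S \<Otimes>\<^sub>M borel"
  assumes UW[measurable]: "(\<lambda>\<omega>. (U \<omega>, W \<omega>)) \<in> measurable M A" and Z[measurable]: "Z \<in> measurable M P"
    and ind: "distr M (A \<Otimes>\<^sub>M P) (\<lambda>\<omega>. ((U \<omega>, W \<omega>), Z \<omega>)) = distr M A (\<lambda>\<omega>. (U \<omega>, W \<omega>)) \<Otimes>\<^sub>M distr M P Z"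
    and law: "distr M P Z = P"
    and f: "unbiased_oracle P S f F" "variance_bounded P S f F s"
    and W: "square_integrable M W"
  defines "err \<equiv> \<lambda>\<omega>. f (U \<omega>) (Z \<omega>) - F (U \<omega>)"
  shows "square_integrable M err" "(\<integral>\<omega>. (norm (err \<omega>))\<^sup>2 \<partial>M) \<le> s\<^sup>2" "(\<integral>\<omega>. err \<omega> \<bullet> W \<omega> \<partial>M) = 0"
proof -
  have [measurable]: "(\<lambda>\<omega>. ((U \<omega>, W \<omega>), Z \<omega>)) \<in> measurable M (A \<Otimes>\<^sub>M P)"
    by measurable
  interpret P: prob_space P
    using prob_space_distr[OF Z] law by simp
  define \<mu> where "\<mu> = distr M A (\<lambda>\<omega>. (U \<omega>, W \<omega>))"
  interpret \<mu>: prob_space \<mu> unfolding \<mu>_def by (rule prob_space_distr) fact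
  interpret \<mu>P: pair_prob_space \<mu> P ..
  have sets_\<mu>[measurable_cong]: "sets \<mu> = sets A" by (simp add: \<mu>_def)
  have joint: "distr M (A \<Otimes>\<^sub>M P) (\<lambda>\<omega>. ((U \<omega>, W \<omega>), Z \<omega>)) = \<mu> \<Otimes>\<^sub>M P"
    using ind by (simp add: \<mu>_def law)
  have [measurable]: "(\<lambda>(u, s). f u s) \<in> borel_measurable (restrict_space borel S \<Otimes>\<^sub>M P)"
    using f by (simp add: unbiased_oracle_def)
  have [measurable]: "F \<in> borel_measurable (restrict_space borel S)"
    by (rule unbiased_oracle_measurable[OF _ f(1)]) (rule P.prob_space_axioms)
  define e where "e = (\<lambda>((u, w :: 'v), s). f u s - F u)"
  have e[measurable]: "e \<in> borel_measurable (A \<Otimes>\<^sub>M P)"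
  proof -
    have "(\<lambda>p. (\<lambda>(u, s). f u s) (fst (fst p), snd p) - F (fst (fst p))) \<in> borel_measurable (A \<Otimes>\<^sub>M P)"
      unfolding A_def by measurable
    then show ?thesis by (simp add: e_def case_prod_unfold)
  qed
  have err: "err = (\<lambda>\<omega>. e ((U \<omega>, W \<omega>), Z \<omega>))" by (simp add: err_def e_def)
  have err_meas[measurable]: "err \<in> borel_measurable M" unfolding err by measurable
  have spA: "fst a \<in> S" if "a \<in> space A" for a
    using that by (auto simp: A_def space_pair_measure space_restrict_space)
  have "(\<integral>\<^sup>+\<omega>. ennreal ((norm (err \<omega>))\<^sup>2) \<partial>M)
      = (\<integral>\<^sup>+p. ennreal ((norm (e p))\<^sup>2) \<partial>distr M (A \<Otimes>\<^sub>M P) (\<lambda>\<omega>. ((U \<omega>, W \<omega>), Z \<omega>)))"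
    by (subst nn_integral_distr) (auto simp: err)
  also have "\<dots> = (\<integral>\<^sup>+a. \<integral>\<^sup>+r. ennreal ((norm (e (a, r)))\<^sup>2) \<partial>P \<partial>\<mu>)"
    unfolding joint by (subst P.nn_integral_fst) auto
  also have "\<dots> \<le> (\<integral>\<^sup>+a. ennreal (s\<^sup>2) \<partial>\<mu>)"
  proof (rule nn_integral_mono)
    fix a assume "a \<in> space \<mu>"
    then have "fst a \<in> S" using spA by (simp add: \<mu>_def)
    then have "integrable P (\<lambda>r. (norm (e (a, r)))\<^sup>2)" "(\<integral>r. (norm (e (a, r)))\<^sup>2 \<partial>P) \<le> s\<^sup>2"
      using f(2) by (auto simp: variance_bounded_def dual_norm_eq_norm e_def case_prod_beta)
    then show "(\<integral>\<^sup>+r. ennreal ((norm (e (a, r)))\<^sup>2) \<partial>P) \<le> ennreal (s\<^sup>2)"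
      by (subst nn_integral_eq_integral) (auto intro: ennreal_leI)
  qed
  also have "\<dots> = ennreal (s\<^sup>2)" by (simp add: \<mu>.emeasure_space_1)
  finally have bound: "(\<integral>\<^sup>+\<omega>. ennreal ((norm (err \<omega>))\<^sup>2) \<partial>M) \<le> ennreal (s\<^sup>2)" .
  have int: "integrable M (\<lambda>\<omega>. (norm (err \<omega>))\<^sup>2)"
  proof (rule integrableI_bounded)
    show "(\<integral>\<^sup>+\<omega>. ennreal (norm ((norm (err \<omega>))\<^sup>2)) \<partial>M) < \<infinity>"
      using bound by (simp add: order_le_less_trans)
  qed measurable
  then show sq: "square_integrable M err" by (simp add: square_integrable_def)
  show "(\<integral>\<omega>. (norm (err \<omega>))\<^sup>2 \<partial>M) \<le> s\<^sup>2"
    using bound int by (subst (asm) nn_integral_eq_integral) auto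
  have m: "(\<lambda>p. e p \<bullet> snd (fst p)) \<in> borel_measurable (A \<Otimes>\<^sub>M P)"
    unfolding A_def by (intro borel_measurable_inner e[unfolded A_def]) measurable
  have "integrable M (\<lambda>\<omega>. e ((U \<omega>, W \<omega>), Z \<omega>) \<bullet> snd (fst ((U \<omega>, W \<omega>), Z \<omega>)))"
    using integrable_inner[OF sq W] by (simp add: err)
  then have ip: "integrable (\<mu> \<Otimes>\<^sub>M P) (\<lambda>p. e p \<bullet> snd (fst p))"
    unfolding joint[symmetric] by (subst integrable_distr_eq) (use m in auto)
  have "(\<integral>\<omega>. err \<omega> \<bullet> W \<omega> \<partial>M) = (\<integral>p. e p \<bullet> snd (fst p) \<partial>distr M (A \<Otimes>\<^sub>M P) (\<lambda>\<omega>. ((U \<omega>, W \<omega>), Z \<omega>)))"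
    by (subst integral_distr) (use m in \<open>auto simp: err\<close>)
  also have "\<dots> = (\<integral>a. \<integral>r. e (a, r) \<bullet> snd a \<partial>P \<partial>\<mu>)"
    unfolding joint using \<mu>P.integral_fst'[OF ip] by simp
  also have "\<dots> = (\<integral>a. 0 \<partial>\<mu>)"
  proof (rule Bochner_Integration.integral_cong[OF refl])
    fix a assume "a \<in> space \<mu>"
    then have "fst a \<in> S" using spA by (simp add: \<mu>_def)
    then have fi: "integrable P (f (fst a))" "(\<integral>r. f (fst a) r \<partial>P) = F (fst a)"
      using f(1) by (auto simp: unbiased_oracle_def)
    have "(\<integral>r. e (a, r) \<bullet> snd a \<partial>P) = (\<integral>r. f (fst a) r - F (fst a) \<partial>P) \<bullet> snd a"
      unfolding e_def case_prod_beta fst_conv snd_conv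
      by (rule integral_inner_left) (use fi in auto)
    also have "\<dots> = 0" using fi by (simp add: P.prob_space)
    finally show "(\<integral>r. e (a, r) \<bullet> snd a \<partial>P) = 0" .
  qed
  finally show "(\<integral>\<omega>. err \<omega> \<bullet> W \<omega> \<partial>M) = 0" by simp
qed

end

section \<open>Adaptedness and noise of the stochastic algorithm\<close>

text \<open>The algorithm with random samples, with the parameters already inserted and the step-size
  rule reduced to the lower bound on \<open>\<eta>\<close> that the energy estimates need.\<close>

locale stochastic_apd = prob_space M for M :: "'w measure" +
  fixes X :: "'a::euclidean_space set" and Y :: "'b::euclidean_space set"
    and G :: "'a \<Rightarrow> real" and gradG :: "'a \<Rightarrow> 'a" and K :: "'a \<Rightarrow> 'b" and J :: "'b \<Rightarrow> real"
    and LG LK \<eta> :: real and N :: nat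
    and P :: "'s measure"
    and oG :: "'a \<Rightarrow> 's \<Rightarrow> 'a" and oKx :: "'a \<Rightarrow> 's \<Rightarrow> 'b" and oKy :: "'b \<Rightarrow> 's \<Rightarrow> 'a"
    and \<sigma>xG \<sigma>y \<sigma>xK :: real
    and \<xi> :: "nat \<Rightarrow> evaluation \<Rightarrow> 'w \<Rightarrow> 's"
    and x1 :: 'a and y1 :: 'b
    and x xmd xag xbar :: "nat \<Rightarrow> 'w \<Rightarrow> 'a" and y yag :: "nat \<Rightarrow> 'w \<Rightarrow> 'b"
  assumes G_convex: "convex_on X G"
    and G_gradient: "\<And>u. u \<in> X \<Longrightarrow> (G has_derivative (\<lambda>h. gradG u \<bullet> h)) (at u within X)"
    and G_smooth: "\<And>u v. u \<in> X \<Longrightarrow> v \<in> X \<Longrightarrow>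
                     G v - G u - gradG u \<bullet> (v - u) \<le> LG / 2 * (norm (v - u))\<^sup>2"
    and LG_nonneg: "LG \<ge> 0"
    and K_linear: "linear K" and K_bound: "\<And>h. norm (K h) \<le> LK * norm h"
    and LK_nonneg: "LK \<ge> 0"
    and J_convex: "convex_on Y J"
    and N_ge_2: "N \<ge> 2" and \<eta>_pos: "\<eta> > 0" and stepsize: "2 * LG + 2 * LK * (real N - 1) \<le> \<eta>"
    and start: "x1 \<in> X" "y1 \<in> Y"
    and unbiased: "unbiased_oracle P X oG gradG" "unbiased_oracle P UNIV oKx K"
                  "unbiased_oracle P Y oKy (adjoint K)"
    and variance: "variance_bounded P X oG gradG \<sigma>xG" "variance_bounded P UNIV oKx K \<sigma>y"
                  "variance_bounded P Y oKy (adjoint K) \<sigma>xK"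
    and samples_indep: "indep_vars (\<lambda>_. P) (\<lambda>(t, e). \<xi> t e) ({1..N - 1} \<times> UNIV)"
    and samples_law: "\<And>t e. t \<in> {1..N - 1} \<Longrightarrow> distr M P (\<xi> t e) = P"
    and run: "\<And>\<omega>. \<omega> \<in> space M \<Longrightarrow>
           APD_run X Y J N (\<lambda>t. (real t + 1) / 2) (\<lambda>t. (real t - 1) / real t)
             (\<lambda>t. 3 * real t / (4 * \<eta>)) (\<lambda>t. real t / \<eta>)
             (\<lambda>t u. oG u (\<xi> t EvalG \<omega>)) (\<lambda>t u. oKx u (\<xi> t EvalKx \<omega>)) (\<lambda>t v. oKy v (\<xi> t EvalKy \<omega>))
             x1 y1 (\<lambda>t. x t \<omega>) (\<lambda>t. y t \<omega>) (\<lambda>t. xmd t \<omega>) (\<lambda>t. xag t \<omega>) (\<lambda>t. yag t \<omega>) (\<lambda>t. xbar t \<omega>)"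
begin

definition "err_G t \<omega> = oG (xmd t \<omega>) (\<xi> t EvalG \<omega>) - gradG (xmd t \<omega>)"
definition "err_K t \<omega> = oKy (y (t + 1) \<omega>) (\<xi> t EvalKy \<omega>) - adjoint K (y (t + 1) \<omega>)"
definition "err_x t \<omega> = err_G t \<omega> + err_K t \<omega>"
definition "err_y t \<omega> = oKx (xbar t \<omega>) (\<xi> t EvalKx \<omega>) - K (xbar t \<omega>)"

lemma trajectory:
  assumes "\<omega> \<in> space M"
  shows "apd_trajectory X Y G gradG K J LG LK \<eta> N
     (\<lambda>t u. oG u (\<xi> t EvalG \<omega>)) (\<lambda>t u. oKx u (\<xi> t EvalKx \<omega>)) (\<lambda>t v. oKy v (\<xi> t EvalKy \<omega>))
     x1 y1 (\<lambda>t. x t \<omega>) (\<lambda>t. xmd t \<omega>) (\<lambda>t. xag t \<omega>) (\<lambda>t. xbar t \<omega>) (\<lambda>t. y t \<omega>) (\<lambda>t. yag t \<omega>)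
     (\<lambda>t. err_x t \<omega>) (\<lambda>t. err_y t \<omega>)"
  by (rule apd_trajectory.intro; (fact G_convex G_gradient G_smooth LG_nonneg K_linear K_bound LK_nonneg J_convex
        N_ge_2 \<eta>_pos stepsize start run[OF assms])?)
     (simp_all add: err_x_def err_y_def err_G_def err_K_def)

abbreviation Hist :: "(nat \<times> evaluation) set \<Rightarrow> 'w measure" where
  "Hist A \<equiv> history P (\<lambda>(t, e). \<xi> t e) A"

text \<open>The samples drawn before iteration \<open>t\<close>. Within an iteration they are thought of
  as drawn in the order dual step, gradient, transpose, since the query to the transpose is the
  new dual iterate.\<close>

definition past :: "nat \<Rightarrow> (nat \<times> evaluation) set" where
  "past t = {1..<t} \<times> UNIV"

lemma past_mono: "s \<le> t \<Longrightarrow> past s \<subseteq> past t"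
  by (auto simp: past_def)

lemma past_Suc: "1 \<le> t \<Longrightarrow> past (t + 1) = past t \<union> {t} \<times> UNIV"
  by (auto simp: past_def)

lemma past_subset: "t \<le> N \<Longrightarrow> past t \<subseteq> {1..N - 1} \<times> UNIV"
  by (auto simp: past_def)

lemma past_subset_step: "t \<in> {1..N - 1} \<Longrightarrow> past t \<subseteq> {1..N - 1} \<times> UNIV"
  by (auto simp: past_def)

lemma sample_measurable: "i \<in> {1..N - 1} \<times> UNIV \<Longrightarrow> (\<lambda>(t, e). \<xi> t e) i \<in> measurable M P"
  using samples_indep unfolding indep_vars_def2 by blast

lemma Hist_mono:
  assumes "A \<subseteq> B" "B \<subseteq> {1..N - 1} \<times> UNIV" "f \<in> measurable (Hist A) L"
  shows "f \<in> measurable (Hist B) L"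
  using assms(2) by (intro history_mono[OF _ assms(1,3)] sample_measurable) auto

lemma Hist_measurable:
  assumes "A \<subseteq> {1..N - 1} \<times> UNIV" "f \<in> measurable (Hist A) L"
  shows "f \<in> measurable M L"
  using assms(1) by (intro history_measurable_imp[OF _ assms(2)] sample_measurable) auto

lemma Hist_sample:
  assumes "A \<subseteq> {1..N - 1} \<times> UNIV" "(t, e) \<in> A"
  shows "\<xi> t e \<in> measurable (Hist A) P"
  using sample_measurable_history[of A "\<lambda>(t, e). \<xi> t e" P "(t, e)"] sample_measurable assms by auto

lemma P_prob_space: "prob_space P"
proof -
  have "(1, EvalG) \<in> {1..N - 1} \<times> (UNIV :: evaluation set)" using N_ge_2 by auto
  from prob_space_distr[OF sample_measurable[OF this]] show ?thesis
    using samples_law[of 1 EvalG] N_ge_2 by simp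
qed

text \<open>The oracle is jointly measurable, and so is the estimated map, being an integral of the
  oracle with respect to its sample.\<close>

lemma oracle_error_measurable:
  assumes f: "unbiased_oracle P S f F"
    and A: "A \<subseteq> {1..N - 1} \<times> UNIV" "(t, e) \<in> A"
    and U: "U \<in> borel_measurable (Hist A)" "\<And>\<omega>. \<omega> \<in> space M \<Longrightarrow> U \<omega> \<in> S"
  shows "(\<lambda>\<omega>. f (U \<omega>) (\<xi> t e \<omega>)) \<in> borel_measurable (Hist A)"
    and "(\<lambda>\<omega>. f (U \<omega>) (\<xi> t e \<omega>) - F (U \<omega>)) \<in> borel_measurable (Hist A)"
proof -
  have [measurable]: "U \<in> measurable (Hist A) (restrict_space borel S)"
    using U by (intro measurable_restrict_space2) auto
  have [measurable]: "\<xi> t e \<in> measurable (Hist A) P"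
    by (rule Hist_sample[OF A])
  have [measurable]: "(\<lambda>(u, s). f u s) \<in> borel_measurable (restrict_space borel S \<Otimes>\<^sub>M P)"
    using f by (simp add: unbiased_oracle_def)
  have [measurable]: "F \<in> borel_measurable (restrict_space borel S)"
    by (rule unbiased_oracle_measurable[OF P_prob_space f])
  have "(\<lambda>\<omega>. (\<lambda>(u, s). f u s) (U \<omega>, \<xi> t e \<omega>)) \<in> borel_measurable (Hist A)"
    by measurable
  then show *[measurable]: "(\<lambda>\<omega>. f (U \<omega>) (\<xi> t e \<omega>)) \<in> borel_measurable (Hist A)" by simp
  show "(\<lambda>\<omega>. f (U \<omega>) (\<xi> t e \<omega>) - F (U \<omega>)) \<in> borel_measurable (Hist A)"
    by measurable
qed

text \<open>The source of all vanishing noise terms: query and multiplier depend only on samples in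
  \<open>A\<close>, and the sample that answers the query lies outside \<open>A\<close>.\<close>

lemma fresh_oracle_error:
  assumes f: "unbiased_oracle P S f F" "variance_bounded P S f F s"
    and A: "A \<subseteq> {1..N - 1} \<times> UNIV" "t \<in> {1..N - 1}" "(t, e) \<notin> A"
    and U: "U \<in> borel_measurable (Hist A)" "\<And>\<omega>. \<omega> \<in> space M \<Longrightarrow> U \<omega> \<in> S"
    and W: "W \<in> borel_measurable (Hist A)" "square_integrable M W"
  shows "square_integrable M (\<lambda>\<omega>. f (U \<omega>) (\<xi> t e \<omega>) - F (U \<omega>))"
    and "(\<integral>\<omega>. (norm (f (U \<omega>) (\<xi> t e \<omega>) - F (U \<omega>)))\<^sup>2 \<partial>M) \<le> s\<^sup>2"
    and "(\<integral>\<omega>. (f (U \<omega>) (\<xi> t e \<omega>) - F (U \<omega>)) \<bullet> W \<omega> \<partial>M) = 0"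
proof -
  have [measurable]: "U \<in> measurable (Hist A) (restrict_space borel S)"
    using U by (intro measurable_restrict_space2) auto
  note [measurable] = W(1)
  have UW: "(\<lambda>\<omega>. (U \<omega>, W \<omega>)) \<in> measurable (Hist A) (restrict_space borel S \<Otimes>\<^sub>M borel)"
    by measurable
  have i: "(t, e) \<in> {1..N - 1} \<times> UNIV" using A by auto
  note fresh = fresh_sample[OF Hist_measurable[OF A(1) UW] sample_measurable[OF i, simplified]
      distr_history_sample[OF samples_indep A(1) i A(3) UW, simplified] samples_law[OF A(2)] f W(2)]
  show "square_integrable M (\<lambda>\<omega>. f (U \<omega>) (\<xi> t e \<omega>) - F (U \<omega>))"
    and "(\<integral>\<omega>. (norm (f (U \<omega>) (\<xi> t e \<omega>) - F (U \<omega>)))\<^sup>2 \<partial>M) \<le> s\<^sup>2"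
    and "(\<integral>\<omega>. (f (U \<omega>) (\<xi> t e \<omega>) - F (U \<omega>)) \<bullet> W \<omega> \<partial>M) = 0"
    by (rule fresh)+
qed

lemma
  assumes "\<omega> \<in> space M"
  shows y_mem: "t \<in> {1..N} \<Longrightarrow> y t \<omega> \<in> Y"
    and xag_mem: "t \<in> {1..N} \<Longrightarrow> xag t \<omega> \<in> X" and yag_mem: "t \<in> {1..N} \<Longrightarrow> yag t \<omega> \<in> Y"
    and xmd_mem: "t \<in> {1..N - 1} \<Longrightarrow> xmd t \<omega> \<in> X"
  using apd_trajectory.y_mem[OF trajectory[OF assms]]
    apd_trajectory.xag_mem[OF trajectory[OF assms]] apd_trajectory.yag_mem[OF trajectory[OF assms]]
    apd_trajectory.xmd_mem[OF trajectory[OF assms]]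
  by blast+

text \<open>Adaptedness is passed through one iteration: each query is known before its sample is drawn,
  and each proximal step is a measurable function of the answers.\<close>

lemma
  assumes t: "t \<in> {1..N - 1}"
    and ad: "x t \<in> borel_measurable (Hist (past t))" "y t \<in> borel_measurable (Hist (past t))"
     "xag t \<in> borel_measurable (Hist (past t))" "yag t \<in> borel_measurable (Hist (past t))"
     "xbar t \<in> borel_measurable (Hist (past t))"
  shows xmd_adapted_aux: "xmd t \<in> borel_measurable (Hist (past t))"
    and y_Suc_adapted_aux: "y (t + 1) \<in> borel_measurable (Hist (past t \<union> {(t, EvalKx)}))"
    and adapted_Suc:
     "x (t + 1) \<in> borel_measurable (Hist (past (t + 1)))"
     "xag (t + 1) \<in> borel_measurable (Hist (past (t + 1)))" "yag (t + 1) \<in> borel_measurable (Hist (past (t + 1)))"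
     "xbar (t + 1) \<in> borel_measurable (Hist (past (t + 1)))"
proof -
  have t1: "1 \<le> t" using t by simp
  have sub1: "past t \<union> {(t, EvalKx)} \<subseteq> {1..N - 1} \<times> UNIV"
    using past_subset_step[OF t] t by auto
  have sub2: "past (t + 1) \<subseteq> {1..N - 1} \<times> UNIV"
    using t by (intro past_subset) auto
  have le1: "past t \<subseteq> past t \<union> {(t, EvalKx)}" by auto
  have le2: "past t \<union> {(t, EvalKx)} \<subseteq> past (t + 1)" using past_Suc[OF t1] by auto
  note [measurable] = ad
  have "(\<lambda>\<omega>. (1 - inverse ((real t + 1) / 2)) *\<^sub>R xag t \<omega> + inverse ((real t + 1) / 2) *\<^sub>R x t \<omega>)
      \<in> borel_measurable (Hist (past t))"
    by measurable
  then show xmd: "xmd t \<in> borel_measurable (Hist (past t))"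
    by (rule measurable_cong[THEN iffD1, rotated])
       (use apd_trajectory.xmd_eq[OF trajectory t] in simp)
  note lift1 = Hist_mono[OF le1 sub1]
  note lift2 = Hist_mono[OF le2 sub2]
  show y: "y (t + 1) \<in> borel_measurable (Hist (past t \<union> {(t, EvalKx)}))"
  proof (rule prox_measurable[OF J_convex])
    have "(\<lambda>\<omega>. oKx (xbar t \<omega>) (\<xi> t EvalKx \<omega>)) \<in> borel_measurable (Hist (past t \<union> {(t, EvalKx)}))"
      by (rule oracle_error_measurable(1)[OF unbiased(2) sub1]) (use lift1[OF ad(5)] in auto)
    then show "(\<lambda>\<omega>. - oKx (xbar t \<omega>) (\<xi> t EvalKx \<omega>)) \<in> borel_measurable (Hist (past t \<union> {(t, EvalKx)}))"
      by measurable
    show "y t \<in> borel_measurable (Hist (past t \<union> {(t, EvalKx)}))"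
      by (rule lift1[OF ad(2)])
    show "0 < real t / \<eta>" using t1 \<eta>_pos by simp
    show "is_arg_min (\<lambda>v. - oKx (xbar t \<omega>) (\<xi> t EvalKx \<omega>) \<bullet> v + J v + 1 / (real t / \<eta>) * ((norm (v - y t \<omega>))\<^sup>2 / 2))
         (\<lambda>v. v \<in> Y) (y (t + 1) \<omega>)" if "\<omega> \<in> space (Hist (past t \<union> {(t, EvalKx)}))" for \<omega>
      using apd_trajectory.y_argmin[OF trajectory t] that by simp
  qed
  note y' = lift2[OF y]
  note lift3 = lift2[OF lift1]
  show x': "x (t + 1) \<in> borel_measurable (Hist (past (t + 1)))"
  proof (rule prox_measurable)
    have [measurable]: "(\<lambda>\<omega>. oG (xmd t \<omega>) (\<xi> t EvalG \<omega>)) \<in> borel_measurable (Hist (past (t + 1)))"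
      by (rule oracle_error_measurable(1)[OF unbiased(1) sub2])
         (use lift3[OF xmd] past_Suc[OF t1] xmd_mem t in auto)
    have [measurable]: "(\<lambda>\<omega>. oKy (y (t + 1) \<omega>) (\<xi> t EvalKy \<omega>)) \<in> borel_measurable (Hist (past (t + 1)))"
      by (rule oracle_error_measurable(1)[OF unbiased(3) sub2])
         (use y' past_Suc[OF t1] y_mem t in auto)
    show "(\<lambda>\<omega>. oG (xmd t \<omega>) (\<xi> t EvalG \<omega>) + oKy (y (t + 1) \<omega>) (\<xi> t EvalKy \<omega>))
        \<in> borel_measurable (Hist (past (t + 1)))"
      by measurable
    show "x t \<in> borel_measurable (Hist (past (t + 1)))" by (rule lift3[OF ad(1)])
    show "0 < 3 * real t / (4 * \<eta>)" using t1 \<eta>_pos by simp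
    show "convex_on X (\<lambda>_. 0 :: real)"
      using convex_on_imp_convex[OF G_convex] by (simp add: convex_on_const)
    show "is_arg_min (\<lambda>u. (oG (xmd t \<omega>) (\<xi> t EvalG \<omega>) + oKy (y (t + 1) \<omega>) (\<xi> t EvalKy \<omega>)) \<bullet> u + 0
           + 1 / (3 * real t / (4 * \<eta>)) * ((norm (u - x t \<omega>))\<^sup>2 / 2))
         (\<lambda>v. v \<in> X) (x (t + 1) \<omega>)" if "\<omega> \<in> space (Hist (past (t + 1)))" for \<omega>
      using apd_trajectory.x_argmin[OF trajectory t] that by simp
  qed
  note [measurable] = x' y' lift3[OF ad(1)] lift3[OF ad(3)] lift3[OF ad(4)]
  have "(\<lambda>\<omega>. (1 - inverse ((real t + 1) / 2)) *\<^sub>R xag t \<omega> + inverse ((real t + 1) / 2) *\<^sub>R x (t + 1) \<omega>)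
      \<in> borel_measurable (Hist (past (t + 1)))"
    by measurable
  then show "xag (t + 1) \<in> borel_measurable (Hist (past (t + 1)))"
    by (rule measurable_cong[THEN iffD1, rotated])
       (use apd_trajectory.xag_eq[OF trajectory t] in simp)
  have "(\<lambda>\<omega>. (1 - inverse ((real t + 1) / 2)) *\<^sub>R yag t \<omega> + inverse ((real t + 1) / 2) *\<^sub>R y (t + 1) \<omega>)
      \<in> borel_measurable (Hist (past (t + 1)))"
    by measurable
  then show "yag (t + 1) \<in> borel_measurable (Hist (past (t + 1)))"
    by (rule measurable_cong[THEN iffD1, rotated])
       (use apd_trajectory.yag_eq[OF trajectory t] in simp)
  have "(\<lambda>\<omega>. ((real (t + 1) - 1) / real (t + 1)) *\<^sub>R (x (t + 1) \<omega> - x t \<omega>) + x (t + 1) \<omega>)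
      \<in> borel_measurable (Hist (past (t + 1)))"
    by measurable
  then show "xbar (t + 1) \<in> borel_measurable (Hist (past (t + 1)))"
    by (rule measurable_cong[THEN iffD1, rotated])
       (use apd_trajectory.xbar_Suc[OF trajectory t] in simp)
qed

lemma
  assumes "t \<in> {1..N}"
  shows x_adapted: "x t \<in> borel_measurable (Hist (past t))"
    and y_adapted: "y t \<in> borel_measurable (Hist (past t))"
    and xag_adapted: "xag t \<in> borel_measurable (Hist (past t))"
    and yag_adapted: "yag t \<in> borel_measurable (Hist (past t))"
    and xbar_adapted: "xbar t \<in> borel_measurable (Hist (past t))"
proof -
  have "x t \<in> borel_measurable (Hist (past t)) \<and> y t \<in> borel_measurable (Hist (past t)) \<and>
        xag t \<in> borel_measurable (Hist (past t)) \<and> yag t \<in> borel_measurable (Hist (past t)) \<and>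
        xbar t \<in> borel_measurable (Hist (past t))"
    using assms
  proof (induction t)
    case (Suc t)
    show ?case
    proof (cases "t = 0")
      case True
      note init = apd_trajectory.initial[OF trajectory]
      have "x 1 \<in> borel_measurable (Hist (past 1))"
        by (subst measurable_cong[of _ _ "\<lambda>_. x1"]) (use init in auto)
      moreover have "y 1 \<in> borel_measurable (Hist (past 1))"
        by (subst measurable_cong[of _ _ "\<lambda>_. y1"]) (use init in auto)
      moreover have "xag 1 \<in> borel_measurable (Hist (past 1))"
        by (subst measurable_cong[of _ _ "\<lambda>_. x1"]) (use init in auto)
      moreover have "yag 1 \<in> borel_measurable (Hist (past 1))"
        by (subst measurable_cong[of _ _ "\<lambda>_. y1"]) (use init in auto)
      moreover have "xbar 1 \<in> borel_measurable (Hist (past 1))"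
        by (subst measurable_cong[of _ _ "\<lambda>_. x1"]) (use init in auto)
      ultimately show ?thesis using True by simp
    next
      case False
      then have t: "t \<in> {1..N - 1}" "t \<in> {1..N}" using Suc.prems by auto
      note IH = Suc.IH[OF t(2), THEN conjunct1] Suc.IH[OF t(2), THEN conjunct2, THEN conjunct1]
        Suc.IH[OF t(2), THEN conjunct2, THEN conjunct2, THEN conjunct1]
        Suc.IH[OF t(2), THEN conjunct2, THEN conjunct2, THEN conjunct2, THEN conjunct1]
        Suc.IH[OF t(2), THEN conjunct2, THEN conjunct2, THEN conjunct2, THEN conjunct2]
      have "past t \<union> {(t, EvalKx)} \<subseteq> past (t + 1)"
        using past_Suc[of t] t by auto
      moreover have "past (t + 1) \<subseteq> {1..N - 1} \<times> UNIV"
        using t by (intro past_subset) auto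
      note Hist_mono[OF calculation this y_Suc_adapted_aux[OF t(1) IH]] adapted_Suc[OF t(1) IH]
      then show ?thesis by simp
    qed
  qed simp
  then show "x t \<in> borel_measurable (Hist (past t))" "y t \<in> borel_measurable (Hist (past t))"
    "xag t \<in> borel_measurable (Hist (past t))" "yag t \<in> borel_measurable (Hist (past t))"
    "xbar t \<in> borel_measurable (Hist (past t))" by auto
qed

lemma
  assumes t: "t \<in> {1..N - 1}"
  shows xmd_adapted: "xmd t \<in> borel_measurable (Hist (past t))"
    and y_Suc_adapted: "y (t + 1) \<in> borel_measurable (Hist (past t \<union> {(t, EvalKx)}))"
proof -
  have "t \<in> {1..N}" using t by auto
  note ad = x_adapted[OF this] y_adapted[OF this] xag_adapted[OF this] yag_adapted[OF this] xbar_adapted[OF this]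
  show "xmd t \<in> borel_measurable (Hist (past t))"
    by (rule xmd_adapted_aux[OF t ad])
  show "y (t + 1) \<in> borel_measurable (Hist (past t \<union> {(t, EvalKx)}))"
    by (rule y_Suc_adapted_aux[OF t ad])
qed

lemma
  assumes t: "t \<in> {1..N}"
  shows x_measurable: "x t \<in> borel_measurable M" and y_measurable: "y t \<in> borel_measurable M"
    and xag_measurable: "xag t \<in> borel_measurable M" and yag_measurable: "yag t \<in> borel_measurable M"
  using t by (auto intro!: Hist_measurable[OF past_subset] x_adapted y_adapted xag_adapted yag_adapted)

lemma
  assumes t: "t \<in> {1..N - 1}"
  shows err_x_adapted: "err_x t \<in> borel_measurable (Hist (past (t + 1)))"
    and err_y_adapted: "err_y t \<in> borel_measurable (Hist (past (t + 1)))"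
    and err_G_adapted: "err_G t \<in> borel_measurable (Hist (past t \<union> {(t, EvalKx), (t, EvalG)}))"
proof -
  have t': "t \<in> {1..N}" "1 \<le> t" "t + 1 \<le> N" using t by auto
  let ?B = "past t \<union> {(t, EvalKx), (t, EvalG)}"
  have sub: "past (t + 1) \<subseteq> {1..N - 1} \<times> UNIV" using past_subset[OF t'(3)] .
  have B: "?B \<subseteq> past (t + 1)" "past t \<subseteq> ?B" "past t \<union> {(t, EvalKx)} \<subseteq> past (t + 1)" "past t \<subseteq> past (t + 1)"
    using past_Suc[OF t'(2)] by auto
  have subB: "?B \<subseteq> {1..N - 1} \<times> UNIV" using B(1) sub by (rule subset_trans)
  have "(\<lambda>\<omega>. oG (xmd t \<omega>) (\<xi> t EvalG \<omega>) - gradG (xmd t \<omega>)) \<in> borel_measurable (Hist ?B)"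
    by (rule oracle_error_measurable(2)[OF unbiased(1) subB])
       (use Hist_mono[OF B(2) subB xmd_adapted[OF t]] xmd_mem t in auto)
  then show err_G: "err_G t \<in> borel_measurable (Hist ?B)" by (simp add: err_G_def[abs_def])
  have "(\<lambda>\<omega>. oKy (y (t + 1) \<omega>) (\<xi> t EvalKy \<omega>) - adjoint K (y (t + 1) \<omega>)) \<in> borel_measurable (Hist (past (t + 1)))"
    by (rule oracle_error_measurable(2)[OF unbiased(3) sub])
       (use Hist_mono[OF B(3) sub y_Suc_adapted[OF t]] y_mem t past_Suc[OF t'(2)] in auto)
  then have err_K: "err_K t \<in> borel_measurable (Hist (past (t + 1)))" by (simp add: err_K_def[abs_def])
  show "err_x t \<in> borel_measurable (Hist (past (t + 1)))"
    unfolding err_x_def[abs_def] using Hist_mono[OF B(1) sub err_G] err_K by measurable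
  have "(\<lambda>\<omega>. oKx (xbar t \<omega>) (\<xi> t EvalKx \<omega>) - K (xbar t \<omega>)) \<in> borel_measurable (Hist (past (t + 1)))"
    by (rule oracle_error_measurable(2)[OF unbiased(2) sub])
       (use Hist_mono[OF B(4) sub xbar_adapted[OF t'(1)]] t past_Suc[OF t'(2)] in auto)
  then show "err_y t \<in> borel_measurable (Hist (past (t + 1)))" by (simp add: err_y_def[abs_def])
qed

text \<open>The variances of the two primal errors add up because the errors are orthogonal: the query to
  the transpose is the dual iterate, which the gradient sample does not influence.\<close>

lemma
  assumes t: "t \<in> {1..N - 1}"
  shows err_x_square_integrable: "square_integrable M (err_x t)"
    and err_x_variance: "(\<integral>\<omega>. (norm (err_x t \<omega>))\<^sup>2 \<partial>M) \<le> \<sigma>xG\<^sup>2 + \<sigma>xK\<^sup>2"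
    and err_x_orthogonal: "\<And>W. W \<in> borel_measurable (Hist (past t)) \<Longrightarrow> square_integrable M W \<Longrightarrow>
           (\<integral>\<omega>. err_x t \<omega> \<bullet> W \<omega> \<partial>M) = 0"
proof -
  have t': "t \<in> {1..N}" "1 \<le> t" "t + 1 \<le> N" using t by auto
  let ?B = "past t \<union> {(t, EvalKx), (t, EvalG)}"
  have B: "?B \<subseteq> {1..N - 1} \<times> UNIV" "past t \<subseteq> ?B" "past t \<subseteq> {1..N - 1} \<times> UNIV"
    "past t \<union> {(t, EvalKx)} \<subseteq> ?B"
    using past_subset_step[OF t] t by auto
  have notin: "(t, EvalG) \<notin> past t" "(t, EvalKy) \<notin> ?B" by (auto simp: past_def)
  have t1: "t + 1 \<in> {1..N}" using t' by auto
  have mem: "xmd t \<omega> \<in> X" "y (t + 1) \<omega> \<in> Y" if "\<omega> \<in> space M" for \<omega>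
    using xmd_mem[OF that t] y_mem[OF that t1] by auto
  note G = fresh_oracle_error[OF unbiased(1) variance(1) B(3) t notin(1) xmd_adapted[OF t] mem(1),
      folded err_G_def]
  note K = fresh_oracle_error[OF unbiased(3) variance(3) B(1) t notin(2)
      Hist_mono[OF B(4) B(1) y_Suc_adapted[OF t]] mem(2), folded err_K_def]
  have zero: "(\<lambda>_. 0) \<in> borel_measurable (Hist A)" "square_integrable M (\<lambda>_. 0 :: 'a)" for A
    by (simp_all add: square_integrable_const)
  have sq: "square_integrable M (err_G t)" "square_integrable M (err_K t)"
    using G(1)[OF _ zero] K(1)[OF _ zero] by (simp_all add: err_G_def[abs_def] err_K_def[abs_def])
  then show err_x: "square_integrable M (err_x t)"
    unfolding err_x_def[abs_def] by (rule square_integrable_add)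
  have int: "integrable M (\<lambda>\<omega>. (norm (err_G t \<omega>))\<^sup>2)" "integrable M (\<lambda>\<omega>. (norm (err_K t \<omega>))\<^sup>2)"
    using sq by (auto simp: square_integrable_def)
  have "(\<integral>\<omega>. (norm (err_x t \<omega>))\<^sup>2 \<partial>M) =
        (\<integral>\<omega>. (norm (err_G t \<omega>))\<^sup>2 + (norm (err_K t \<omega>))\<^sup>2 + 2 * (err_K t \<omega> \<bullet> err_G t \<omega>) \<partial>M)"
    unfolding err_x_def power2_norm_eq_inner
    by (intro Bochner_Integration.integral_cong) (simp_all add: inner_simps inner_commute)
  also have "\<dots> = (\<integral>\<omega>. (norm (err_G t \<omega>))\<^sup>2 \<partial>M) + (\<integral>\<omega>. (norm (err_K t \<omega>))\<^sup>2 \<partial>M) + 2 * (\<integral>\<omega>. err_K t \<omega> \<bullet> err_G t \<omega> \<partial>M)"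
    using int integrable_inner[OF sq(2,1)] by simp
  also have "(\<integral>\<omega>. err_K t \<omega> \<bullet> err_G t \<omega> \<partial>M) = 0"
    by (rule K(3)[OF _ err_G_adapted[OF t] sq(1)])
  finally show "(\<integral>\<omega>. (norm (err_x t \<omega>))\<^sup>2 \<partial>M) \<le> \<sigma>xG\<^sup>2 + \<sigma>xK\<^sup>2"
    using G(2)[OF _ zero] K(2)[OF _ zero] by simp
  show "(\<integral>\<omega>. err_x t \<omega> \<bullet> W \<omega> \<partial>M) = 0"
    if W: "W \<in> borel_measurable (Hist (past t))" "square_integrable M W" for W
  proof -
    have "(\<integral>\<omega>. err_x t \<omega> \<bullet> W \<omega> \<partial>M) = (\<integral>\<omega>. err_G t \<omega> \<bullet> W \<omega> \<partial>M) + (\<integral>\<omega>. err_K t \<omega> \<bullet> W \<omega> \<partial>M)"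
      unfolding err_x_def inner_add_left
      by (rule Bochner_Integration.integral_add) (use integrable_inner sq W in auto)
    also have "(\<integral>\<omega>. err_G t \<omega> \<bullet> W \<omega> \<partial>M) = 0" by (rule G(3)[OF _ W])
    also have "(\<integral>\<omega>. err_K t \<omega> \<bullet> W \<omega> \<partial>M) = 0" by (rule K(3)[OF _ Hist_mono[OF B(2,1) W(1)] W(2)])
    finally show ?thesis by simp
  qed
qed

lemma
  assumes t: "t \<in> {1..N - 1}"
  shows err_y_square_integrable: "square_integrable M (err_y t)"
    and err_y_variance: "(\<integral>\<omega>. (norm (err_y t \<omega>))\<^sup>2 \<partial>M) \<le> \<sigma>y\<^sup>2"
    and err_y_orthogonal: "\<And>W. W \<in> borel_measurable (Hist (past t)) \<Longrightarrow> square_integrable M W \<Longrightarrow>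
           (\<integral>\<omega>. err_y t \<omega> \<bullet> W \<omega> \<partial>M) = 0"
proof -
  have t': "t \<in> {1..N}" using t by auto
  have sub: "past t \<subseteq> {1..N - 1} \<times> UNIV" "(t, EvalKx) \<notin> past t"
    using past_subset_step[OF t] t by (auto simp: past_def)
  note Y = fresh_oracle_error[OF unbiased(2) variance(2) sub(1) t sub(2) xbar_adapted[OF t'] UNIV_I, folded err_y_def]
  have zero: "(\<lambda>_. 0) \<in> borel_measurable (Hist A)" "square_integrable M (\<lambda>_. 0 :: 'b)" for A
    by (simp_all add: square_integrable_const)
  show "square_integrable M (err_y t)" using Y(1)[OF zero] by (simp add: err_y_def[abs_def])
  show "(\<integral>\<omega>. (norm (err_y t \<omega>))\<^sup>2 \<partial>M) \<le> \<sigma>y\<^sup>2" using Y(2)[OF zero] .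
  show "(\<integral>\<omega>. err_y t \<omega> \<bullet> W \<omega> \<partial>M) = 0"
    if "W \<in> borel_measurable (Hist (past t))" "square_integrable M W" for W
    using Y(3)[OF that] .
qed

end

section \<open>Expected distances and expected gap\<close>

text \<open>Each increment is orthogonal to the sum of its predecessors, so the mixed terms drop out of
  the second moment one increment at a time.\<close>

lemma (in prob_space) orthogonal_sum_bound:
  fixes d :: "nat \<Rightarrow> 'a \<Rightarrow> 'v::euclidean_space"
  assumes d: "\<And>t. t \<in> {1..n} \<Longrightarrow> square_integrable M (d t)"
    and c: "\<And>t. t \<in> {1..n} \<Longrightarrow> (\<integral>\<omega>. (norm (d t \<omega>))\<^sup>2 \<partial>M) \<le> c t"
    and orth: "\<And>t. t \<in> {1..n} \<Longrightarrow> (\<integral>\<omega>. d t \<omega> \<bullet> (\<Sum>s\<in>{1..<t}. d s \<omega>) \<partial>M) = 0"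
  shows "(\<integral>\<omega>. (norm (\<Sum>t=1..n. d t \<omega>))\<^sup>2 \<partial>M) \<le> (\<Sum>t=1..n. c t)"
  using assms
proof (induction n)
  case (Suc n)
  let ?S = "\<lambda>\<omega>. \<Sum>t=1..n. d t \<omega>"
  have S: "square_integrable M ?S"
    using Suc.prems(1) by (intro square_integrable_sum) auto
  have dn: "square_integrable M (d (Suc n))" using Suc.prems(1) by simp
  have "(\<integral>\<omega>. (norm (\<Sum>t=1..Suc n. d t \<omega>))\<^sup>2 \<partial>M)
      = (\<integral>\<omega>. (norm (?S \<omega>))\<^sup>2 + (norm (d (Suc n) \<omega>))\<^sup>2 + 2 * (d (Suc n) \<omega> \<bullet> ?S \<omega>) \<partial>M)"
    unfolding power2_norm_eq_inner
    by (intro Bochner_Integration.integral_cong) (simp_all add: inner_add_left inner_add_right inner_commute)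
  also have "\<dots> = (\<integral>\<omega>. (norm (?S \<omega>))\<^sup>2 \<partial>M) + (\<integral>\<omega>. (norm (d (Suc n) \<omega>))\<^sup>2 \<partial>M)
      + 2 * (\<integral>\<omega>. d (Suc n) \<omega> \<bullet> ?S \<omega> \<partial>M)"
    using S dn integrable_inner[OF dn S] by (simp add: square_integrable_def)
  also have "(\<integral>\<omega>. d (Suc n) \<omega> \<bullet> ?S \<omega> \<partial>M) = 0"
    using Suc.prems(3)[of "Suc n"] by (simp add: atLeastLessThanSuc_atLeastAtMost)
  finally have "(\<integral>\<omega>. (norm (\<Sum>t=1..Suc n. d t \<omega>))\<^sup>2 \<partial>M)
      = (\<integral>\<omega>. (norm (?S \<omega>))\<^sup>2 \<partial>M) + (\<integral>\<omega>. (norm (d (Suc n) \<omega>))\<^sup>2 \<partial>M)" by simp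
  also have "\<dots> \<le> (\<Sum>t=1..n. c t) + c (Suc n)"
    using Suc.prems by (intro add_mono Suc.IH) auto
  finally show ?case by simp
qed simp

context stochastic_apd
begin

definition "sum_sq_weights = (\<Sum>t=1..N - 1. (real t)\<^sup>2)"
text \<open>This is \<open>\<sigma>\<^sup>2\<close>.\<close>

definition "weighted_variance = 9 / 4 * (\<sigma>xG\<^sup>2 + \<sigma>xK\<^sup>2) + \<sigma>y\<^sup>2"

lemma noise_energy:
  assumes k: "k \<le> N - 1"
  shows "integrable M (\<lambda>\<omega>. \<Sum>t=1..k. (real t)\<^sup>2 * (9 / 4 * (norm (err_x t \<omega>))\<^sup>2 + (norm (err_y t \<omega>))\<^sup>2))"
    and "(\<integral>\<omega>. (\<Sum>t=1..k. (real t)\<^sup>2 * (9 / 4 * (norm (err_x t \<omega>))\<^sup>2 + (norm (err_y t \<omega>))\<^sup>2)) \<partial>M) \<le> sum_sq_weights * weighted_variance"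
proof -
  have t: "t \<in> {1..N - 1}" if "t \<in> {1..k}" for t using that k by auto
  have int: "integrable M (\<lambda>\<omega>. (norm (err_x t \<omega>))\<^sup>2)" "integrable M (\<lambda>\<omega>. (norm (err_y t \<omega>))\<^sup>2)"
    if "t \<in> {1..k}" for t
    using err_x_square_integrable[OF t[OF that]] err_y_square_integrable[OF t[OF that]]
    by (auto simp: square_integrable_def)
  then show "integrable M (\<lambda>\<omega>. \<Sum>t=1..k. (real t)\<^sup>2 * (9 / 4 * (norm (err_x t \<omega>))\<^sup>2 + (norm (err_y t \<omega>))\<^sup>2))"
    by auto
  have "(\<integral>\<omega>. (\<Sum>t=1..k. (real t)\<^sup>2 * (9 / 4 * (norm (err_x t \<omega>))\<^sup>2 + (norm (err_y t \<omega>))\<^sup>2)) \<partial>M)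
      = (\<Sum>t=1..k. (real t)\<^sup>2 * (9 / 4 * (\<integral>\<omega>. (norm (err_x t \<omega>))\<^sup>2 \<partial>M) + (\<integral>\<omega>. (norm (err_y t \<omega>))\<^sup>2 \<partial>M)))"
    using int by (subst Bochner_Integration.integral_sum) auto
  also have "\<dots> \<le> (\<Sum>t=1..k. (real t)\<^sup>2 * weighted_variance)"
    unfolding weighted_variance_def
    by (intro sum_mono mult_left_mono add_mono err_x_variance err_y_variance t) auto
  also have "\<dots> \<le> (\<Sum>t=1..N - 1. (real t)\<^sup>2 * weighted_variance)"
    by (intro sum_mono2) (use k in \<open>auto simp: weighted_variance_def\<close>)
  finally show "(\<integral>\<omega>. (\<Sum>t=1..k. (real t)\<^sup>2 * (9 / 4 * (norm (err_x t \<omega>))\<^sup>2 + (norm (err_y t \<omega>))\<^sup>2)) \<partial>M) \<le> sum_sq_weights * weighted_variance"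
    by (simp add: sum_sq_weights_def sum_distrib_right)
qed

text \<open>The iterates \<open>x t\<close> and \<open>y t\<close> are determined by the samples of
  earlier iterations, to which the errors of iteration \<open>t\<close> are orthogonal.\<close>

lemma noise_linear_mean_zero:
  assumes k: "k \<le> N - 1"
    and sq: "\<And>t. t \<in> {1..k} \<Longrightarrow> square_integrable M (x t)" "\<And>t. t \<in> {1..k} \<Longrightarrow> square_integrable M (y t)"
  shows "integrable M (\<lambda>\<omega>. \<Sum>t=1..k. real t * (err_y t \<omega> \<bullet> (y t \<omega> - v) - err_x t \<omega> \<bullet> (x t \<omega> - u)))"
    and "(\<integral>\<omega>. (\<Sum>t=1..k. real t * (err_y t \<omega> \<bullet> (y t \<omega> - v) - err_x t \<omega> \<bullet> (x t \<omega> - u))) \<partial>M) = 0"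
proof -
  have main: "integrable M (\<lambda>\<omega>. err_y t \<omega> \<bullet> (y t \<omega> - v)) \<and> integrable M (\<lambda>\<omega>. err_x t \<omega> \<bullet> (x t \<omega> - u)) \<and>
      (\<integral>\<omega>. err_y t \<omega> \<bullet> (y t \<omega> - v) \<partial>M) = 0 \<and> (\<integral>\<omega>. err_x t \<omega> \<bullet> (x t \<omega> - u) \<partial>M) = 0"
    if tk: "t \<in> {1..k}" for t
  proof -
    have t: "t \<in> {1..N - 1}" "t \<in> {1..N}" using tk k by auto
    have sqd: "square_integrable M (\<lambda>\<omega>. x t \<omega> - u)" "square_integrable M (\<lambda>\<omega>. y t \<omega> - v)"
      by (intro square_integrable_diff square_integrable_const sq tk)+
    have meas: "(\<lambda>\<omega>. x t \<omega> - u) \<in> borel_measurable (Hist (past t))"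
        "(\<lambda>\<omega>. y t \<omega> - v) \<in> borel_measurable (Hist (past t))"
      using x_adapted[OF t(2)] y_adapted[OF t(2)] by measurable
    show ?thesis
      using integrable_inner[OF err_x_square_integrable[OF t(1)] sqd(1)]
        integrable_inner[OF err_y_square_integrable[OF t(1)] sqd(2)]
        err_x_orthogonal[OF t(1) meas(1) sqd(1)] err_y_orthogonal[OF t(1) meas(2) sqd(2)]
      by simp
  qed
  then show "integrable M (\<lambda>\<omega>. \<Sum>t=1..k. real t * (err_y t \<omega> \<bullet> (y t \<omega> - v) - err_x t \<omega> \<bullet> (x t \<omega> - u)))"
    by (intro Bochner_Integration.integrable_sum integrable_mult_right Bochner_Integration.integrable_diff) auto
  have "(\<integral>\<omega>. (\<Sum>t=1..k. real t * (err_y t \<omega> \<bullet> (y t \<omega> - v) - err_x t \<omega> \<bullet> (x t \<omega> - u))) \<partial>M)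
     = (\<Sum>t=1..k. real t * ((\<integral>\<omega>. err_y t \<omega> \<bullet> (y t \<omega> - v) \<partial>M) - (\<integral>\<omega>. err_x t \<omega> \<bullet> (x t \<omega> - u) \<partial>M)))"
    using main by (subst Bochner_Integration.integral_sum) auto
  also have "\<dots> = 0" using main by simp
  finally show "(\<integral>\<omega>. (\<Sum>t=1..k. real t * (err_y t \<omega> \<bullet> (y t \<omega> - v) - err_x t \<omega> \<bullet> (x t \<omega> - u))) \<partial>M) = 0" .
qed

text \<open>The bound \<open>D\<^sup>2 + (\<Sum>t\<^sup>2) \<sigma>\<^sup>2 / \<eta>\<^sup>2\<close> on
  the mean squared distance from the saddle point.\<close>

definition "sq_radius xh yh = (norm (xh - x1))\<^sup>2 + 3 / 4 * (norm (yh - y1))\<^sup>2 + sum_sq_weights * weighted_variance / \<eta>\<^sup>2"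

lemma start_distance_le:
  "(norm (x1 - xh))\<^sup>2 + 9 / 16 * (norm (y1 - yh))\<^sup>2 \<le> sq_radius xh yh"
  by (auto simp: sq_radius_def norm_minus_commute weighted_variance_def sum_sq_weights_def intro!: add_increasing2 add_nonneg_nonneg
      divide_nonneg_nonneg mult_nonneg_nonneg sum_nonneg add_mono mult_right_mono)

text \<open>The pathwise bound on the new distance involves only earlier iterates. Hence their square
  integrability makes the bound integrable, and the new iterate inherits square integrability.\<close>

lemma distance_step:
  assumes solution: "saddle_point X Y G K J (xh, yh)" and k: "k \<le> N - 1"
    and sq: "\<And>t. t \<in> {1..k} \<Longrightarrow> square_integrable M (x t)" "\<And>t. t \<in> {1..k} \<Longrightarrow> square_integrable M (y t)"
  shows "square_integrable M (\<lambda>\<omega>. x (k + 1) \<omega> - xh)" "square_integrable M (\<lambda>\<omega>. y (k + 1) \<omega> - yh)"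
    and "(\<integral>\<omega>. (norm (x (k + 1) \<omega> - xh))\<^sup>2 + 9 / 16 * (norm (y (k + 1) \<omega> - yh))\<^sup>2 \<partial>M) \<le> sq_radius xh yh"
proof -
  have k1: "k + 1 \<in> {1..N}" using k N_ge_2 by auto
  note [measurable] = x_measurable[OF k1] y_measurable[OF k1]
  define B where "B \<omega> = (norm (xh - x1))\<^sup>2 + 3 / 4 * (norm (yh - y1))\<^sup>2
     + (\<Sum>t=1..k. (real t)\<^sup>2 * (9 / 4 * (norm (err_x t \<omega>))\<^sup>2 + (norm (err_y t \<omega>))\<^sup>2)) / \<eta>\<^sup>2
     + 3 / (2 * \<eta>) * (\<Sum>t=1..k. real t * (err_y t \<omega> \<bullet> (y t \<omega> - yh) - err_x t \<omega> \<bullet> (x t \<omega> - xh)))" for \<omega>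
  have le: "(norm (x (k + 1) \<omega> - xh))\<^sup>2 + 9 / 16 * (norm (y (k + 1) \<omega> - yh))\<^sup>2 \<le> B \<omega>" if "\<omega> \<in> space M" for \<omega>
    unfolding B_def by (rule apd_trajectory.distance_energy[OF trajectory[OF that] k solution])
  note E = noise_energy[OF k]
  note L = noise_linear_mean_zero[OF k sq, of yh xh]
  have B: "integrable M B"
    unfolding B_def[abs_def] using E(1) L(1) by simp
  have "(\<integral>\<omega>. B \<omega> \<partial>M) = (norm (xh - x1))\<^sup>2 + 3 / 4 * (norm (yh - y1))\<^sup>2
     + (\<integral>\<omega>. (\<Sum>t=1..k. (real t)\<^sup>2 * (9 / 4 * (norm (err_x t \<omega>))\<^sup>2 + (norm (err_y t \<omega>))\<^sup>2)) \<partial>M) / \<eta>\<^sup>2"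
    unfolding B_def[abs_def] using E(1) L by (simp add: prob_space)
  also have "\<dots> \<le> sq_radius xh yh"
    unfolding sq_radius_def using E(2) by (intro add_left_mono divide_right_mono) auto
  finally have EB: "(\<integral>\<omega>. B \<omega> \<partial>M) \<le> sq_radius xh yh" .
  show sx: "square_integrable M (\<lambda>\<omega>. x (k + 1) \<omega> - xh)"
  proof (rule square_integrable_bound[OF _ B])
    show "(norm (x (k + 1) \<omega> - xh))\<^sup>2 \<le> B \<omega>" if "\<omega> \<in> space M" for \<omega>
      by (rule order_trans[OF _ le[OF that]]) simp
  qed measurable
  show sy: "square_integrable M (\<lambda>\<omega>. y (k + 1) \<omega> - yh)"
  proof (rule square_integrable_bound)
    show "integrable M (\<lambda>\<omega>. 16 / 9 * B \<omega>)" using B by simp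
    show "(norm (y (k + 1) \<omega> - yh))\<^sup>2 \<le> 16 / 9 * B \<omega>" if "\<omega> \<in> space M" for \<omega>
    proof -
      have "9 / 16 * (norm (y (k + 1) \<omega> - yh))\<^sup>2 \<le> B \<omega>"
        by (rule order_trans[OF _ le[OF that]]) simp
      then show ?thesis by simp
    qed
  qed measurable
  have "(\<integral>\<omega>. (norm (x (k + 1) \<omega> - xh))\<^sup>2 + 9 / 16 * (norm (y (k + 1) \<omega> - yh))\<^sup>2 \<partial>M) \<le> (\<integral>\<omega>. B \<omega> \<partial>M)"
    by (rule integral_mono[OF _ B le]) (use sx sy in \<open>auto simp: square_integrable_def\<close>)
  with EB show "(\<integral>\<omega>. (norm (x (k + 1) \<omega> - xh))\<^sup>2 + 9 / 16 * (norm (y (k + 1) \<omega> - yh))\<^sup>2 \<partial>M) \<le> sq_radius xh yh"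
    by simp
qed

lemma
  assumes solution: "saddle_point X Y G K J (xh, yh)" and t: "t \<in> {1..N}"
  shows x_square_integrable: "square_integrable M (x t)"
    and y_square_integrable: "square_integrable M (y t)"
proof -
  have "square_integrable M (x t) \<and> square_integrable M (y t)"
    using t
  proof (induction t rule: less_induct)
    case (less t)
    define k where "k = t - 1"
    have tk: "t = k + 1" "k \<le> N - 1" using less.prems by (auto simp: k_def)
    have sq: "square_integrable M (x s)" "square_integrable M (y s)" if "s \<in> {1..k}" for s
      using less.IH[of s] that tk less.prems by auto
    note d = distance_step(1,2)[OF solution tk(2) sq]
    show ?case
      using square_integrable_add[OF d(1) square_integrable_const[of xh]]
        square_integrable_add[OF d(2) square_integrable_const[of yh]]
      unfolding tk(1) by simp
  qed
  then show "square_integrable M (x t)" "square_integrable M (y t)" by auto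
qed

lemma expected_distance:
  assumes solution: "saddle_point X Y G K J (xh, yh)" and t: "t \<in> {1..N}"
  shows "(\<integral>\<omega>. (norm (x t \<omega> - xh))\<^sup>2 + 9 / 16 * (norm (y t \<omega> - yh))\<^sup>2 \<partial>M) \<le> sq_radius xh yh"
proof -
  define k where "k = t - 1"
  have tk: "t = k + 1" "k \<le> N - 1" using t by (auto simp: k_def)
  have s: "s \<in> {1..N}" if "s \<in> {1..k}" for s using that tk t by auto
  show ?thesis
    unfolding tk(1)
    by (rule distance_step(3)[OF solution tk(2)])
       (intro x_square_integrable[OF solution] y_square_integrable[OF solution] s; assumption)+
qed

text \<open>The averages are convex combinations of the iterates, and the squared norm is convex.\<close>

lemma
  assumes solution: "saddle_point X Y G K J (xh, yh)" and t: "t \<in> {1..N}"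
  shows xag_square_integrable: "square_integrable M (xag t)"
    and yag_square_integrable: "square_integrable M (yag t)"
    and expected_average_distance:
      "(\<integral>\<omega>. (norm (xag t \<omega> - xh))\<^sup>2 + 9 / 16 * (norm (yag t \<omega> - yh))\<^sup>2 \<partial>M) \<le> sq_radius xh yh"
proof -
  have "square_integrable M (xag t) \<and> square_integrable M (yag t) \<and>
    (\<integral>\<omega>. (norm (xag t \<omega> - xh))\<^sup>2 + 9 / 16 * (norm (yag t \<omega> - yh))\<^sup>2 \<partial>M) \<le> sq_radius xh yh"
    using t
  proof (induction t)
    case (Suc t)
    show ?case
    proof (cases "t = 0")
      case True
      have init: "xag 1 \<omega> = x1" "yag 1 \<omega> = y1" if "\<omega> \<in> space M" for \<omega>
        using apd_trajectory.initial[OF trajectory[OF that]] by auto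
      have "square_integrable M (xag 1)"
        using xag_measurable[of 1] N_ge_2
        by (intro square_integrable_bound[where B = "\<lambda>_. (norm x1)\<^sup>2"]) (auto simp: init[simplified])
      moreover have "square_integrable M (yag 1)"
        using yag_measurable[of 1] N_ge_2
        by (intro square_integrable_bound[where B = "\<lambda>_. (norm y1)\<^sup>2"]) (auto simp: init[simplified])
      moreover have "(\<integral>\<omega>. (norm (xag 1 \<omega> - xh))\<^sup>2 + 9 / 16 * (norm (yag 1 \<omega> - yh))\<^sup>2 \<partial>M)
          = (\<integral>\<omega>. (norm (x1 - xh))\<^sup>2 + 9 / 16 * (norm (y1 - yh))\<^sup>2 \<partial>M)"
        by (rule Bochner_Integration.integral_cong) (auto simp: init[simplified])
      ultimately show ?thesis
        using True start_distance_le by (simp add: prob_space)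
    next
      case False
      then have t: "t \<in> {1..N - 1}" "t \<in> {1..N}" "t + 1 \<in> {1..N}" using Suc.prems by auto
      define l where "l = inverse ((real t + 1) / 2)"
      have l: "0 \<le> l" "0 \<le> 1 - l"
        unfolding l_def using averaging_weight[of t] t by auto
      have IH: "square_integrable M (xag t)" "square_integrable M (yag t)"
        "(\<integral>\<omega>. (norm (xag t \<omega> - xh))\<^sup>2 + 9 / 16 * (norm (yag t \<omega> - yh))\<^sup>2 \<partial>M) \<le> sq_radius xh yh"
        using Suc.IH[OF t(2)] by auto
      note sqx = x_square_integrable[OF solution t(3)] and sqy = y_square_integrable[OF solution t(3)]
      have eq: "xag (t + 1) \<omega> = (1 - l) *\<^sub>R xag t \<omega> + l *\<^sub>R x (t + 1) \<omega>"
               "yag (t + 1) \<omega> = (1 - l) *\<^sub>R yag t \<omega> + l *\<^sub>R y (t + 1) \<omega>" if "\<omega> \<in> space M" for \<omega>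
        using apd_trajectory.xag_eq[OF trajectory[OF that] t(1)] apd_trajectory.yag_eq[OF trajectory[OF that] t(1)]
        by (simp_all add: l_def)
      have sq': "square_integrable M (\<lambda>\<omega>. (1 - l) *\<^sub>R xag t \<omega> + l *\<^sub>R x (t + 1) \<omega>)"
                "square_integrable M (\<lambda>\<omega>. (1 - l) *\<^sub>R yag t \<omega> + l *\<^sub>R y (t + 1) \<omega>)"
        by (intro square_integrable_add square_integrable_scaleR IH sqx sqy)+
      have sq: "square_integrable M (xag (t + 1))" "square_integrable M (yag (t + 1))"
        using sq' xag_measurable[OF t(3)] yag_measurable[OF t(3)]
        unfolding square_integrable_def
        by (auto simp: eq[simplified] cong: Bochner_Integration.integrable_cong)
      define f where "f u v = (norm (u - xh))\<^sup>2 + 9 / 16 * (norm (v - yh))\<^sup>2" for u :: 'a and v :: 'b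
      have fint: "integrable M (\<lambda>\<omega>. f (p \<omega>) (q \<omega>))" if "square_integrable M p" "square_integrable M q" for p q
        using square_integrable_diff[OF that(1) square_integrable_const[of xh]]
          square_integrable_diff[OF that(2) square_integrable_const[of yh]]
        by (auto simp: f_def square_integrable_def)
      have conv: "(norm ((1 - l) *\<^sub>R a + l *\<^sub>R b - c))\<^sup>2 \<le> (1 - l) * (norm (a - c))\<^sup>2 + l * (norm (b - c))\<^sup>2"
        for a b c :: "'e::real_inner"
      proof -
        have "(1 - l) *\<^sub>R a + l *\<^sub>R b - c = (1 - l) *\<^sub>R (a - c) + l *\<^sub>R (b - c)"
          by (simp add: algebra_simps)
        then show ?thesis using l by (simp add: norm_convex_comb_sq)
      qed
      have "(\<integral>\<omega>. f (xag (t + 1) \<omega>) (yag (t + 1) \<omega>) \<partial>M)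
          \<le> (\<integral>\<omega>. (1 - l) * f (xag t \<omega>) (yag t \<omega>) + l * f (x (t + 1) \<omega>) (y (t + 1) \<omega>) \<partial>M)"
      proof (rule integral_mono)
        fix \<omega> assume w: "\<omega> \<in> space M"
        show "f (xag (t + 1) \<omega>) (yag (t + 1) \<omega>) \<le> (1 - l) * f (xag t \<omega>) (yag t \<omega>) + l * f (x (t + 1) \<omega>) (y (t + 1) \<omega>)"
          using conv[of "xag t \<omega>" "x (t + 1) \<omega>" xh] conv[of "yag t \<omega>" "y (t + 1) \<omega>" yh]
          unfolding f_def eq[OF w] distrib_left mult.left_commute[of _ "9 / 16"] by linarith
      qed (use fint sq IH sqx sqy in auto)
      also have "\<dots> = (1 - l) * (\<integral>\<omega>. f (xag t \<omega>) (yag t \<omega>) \<partial>M) + l * (\<integral>\<omega>. f (x (t + 1) \<omega>) (y (t + 1) \<omega>) \<partial>M)"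
        using fint[OF IH(1,2)] fint[OF sqx sqy] by simp
      also have "\<dots> \<le> (1 - l) * sq_radius xh yh + l * sq_radius xh yh"
        using IH(3) expected_distance[OF solution t(3)] l
        by (intro add_mono mult_left_mono) (simp_all add: f_def)
      finally have "(\<integral>\<omega>. f (xag (t + 1) \<omega>) (yag (t + 1) \<omega>) \<partial>M) \<le> sq_radius xh yh"
        by (simp add: algebra_simps)
      with sq show ?thesis by (simp add: f_def)
    qed
  qed simp
  then show "square_integrable M (xag t)" "square_integrable M (yag t)"
    "(\<integral>\<omega>. (norm (xag t \<omega> - xh))\<^sup>2 + 9 / 16 * (norm (yag t \<omega> - yh))\<^sup>2 \<partial>M) \<le> sq_radius xh yh" by auto
qed

abbreviation "noise_x \<omega> \<equiv> weighted_noise (N - 1) (\<lambda>t. err_x t \<omega>)"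
abbreviation "noise_y \<omega> \<equiv> weighted_noise (N - 1) (\<lambda>t. err_y t \<omega>)"

text \<open>Weighted oracle errors form a martingale difference sequence, so their second moments add up.\<close>

lemma martingale_noise_bound:
  fixes e :: "nat \<Rightarrow> 'w \<Rightarrow> 'v::euclidean_space"
  assumes sq: "\<And>t. t \<in> {1..N - 1} \<Longrightarrow> square_integrable M (e t)"
    and v: "\<And>t. t \<in> {1..N - 1} \<Longrightarrow> (\<integral>\<omega>. (norm (e t \<omega>))\<^sup>2 \<partial>M) \<le> v"
    and ad: "\<And>t. t \<in> {1..N - 1} \<Longrightarrow> e t \<in> borel_measurable (Hist (past (t + 1)))"
    and orth: "\<And>t W. t \<in> {1..N - 1} \<Longrightarrow> W \<in> borel_measurable (Hist (past t)) \<Longrightarrow> square_integrable M W \<Longrightarrow>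
           (\<integral>\<omega>. e t \<omega> \<bullet> W \<omega> \<partial>M) = 0"
  shows "square_integrable M (\<lambda>\<omega>. weighted_noise (N - 1) (\<lambda>t. e t \<omega>))"
    and "(\<integral>\<omega>. (norm (weighted_noise (N - 1) (\<lambda>t. e t \<omega>)))\<^sup>2 \<partial>M) \<le> sum_sq_weights * v"
proof -
  define d where "d t \<omega> = real t *\<^sub>R e t \<omega>" for t \<omega>
  have d: "square_integrable M (d t)" if "t \<in> {1..N - 1}" for t
    unfolding d_def[abs_def] by (intro square_integrable_scaleR sq that)
  show "square_integrable M (\<lambda>\<omega>. weighted_noise (N - 1) (\<lambda>t. e t \<omega>))"
    unfolding weighted_noise_def by (intro square_integrable_sum square_integrable_scaleR sq)
  have "(\<integral>\<omega>. (norm (\<Sum>t=1..N - 1. d t \<omega>))\<^sup>2 \<partial>M) \<le> (\<Sum>t=1..N - 1. (real t)\<^sup>2 * v)"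
  proof (rule orthogonal_sum_bound[OF d])
    fix t assume t: "t \<in> {1..N - 1}"
    show "(\<integral>\<omega>. (norm (d t \<omega>))\<^sup>2 \<partial>M) \<le> (real t)\<^sup>2 * v"
      using mult_left_mono[OF v[OF t], of "(real t)\<^sup>2"] by (simp add: d_def power_mult_distrib)
    \<comment> \<open>The partial sum up to \<open>t - 1\<close> is determined by the samples drawn before
      iteration \<open>t\<close>.\<close>
    let ?W = "\<lambda>\<omega>. \<Sum>s\<in>{1..<t}. d s \<omega>"
    have s: "s \<in> {1..N - 1}" if "s \<in> {1..<t}" for s using that t by auto
    have "d s \<in> borel_measurable (Hist (past t))" if "s \<in> {1..<t}" for s
    proof -
      have "past (s + 1) \<subseteq> past t" using that by (intro past_mono) auto
      from Hist_mono[OF this past_subset_step[OF t] ad[OF s[OF that]]]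
      show ?thesis unfolding d_def[abs_def] by measurable
    qed
    then have "?W \<in> borel_measurable (Hist (past t))" by (rule borel_measurable_sum)
    moreover have "square_integrable M ?W" by (intro square_integrable_sum d s)
    ultimately have "(\<integral>\<omega>. e t \<omega> \<bullet> ?W \<omega> \<partial>M) = 0" by (rule orth[OF t])
    then show "(\<integral>\<omega>. d t \<omega> \<bullet> ?W \<omega> \<partial>M) = 0" by (simp add: d_def[of t])
  qed
  then show "(\<integral>\<omega>. (norm (weighted_noise (N - 1) (\<lambda>t. e t \<omega>)))\<^sup>2 \<partial>M) \<le> sum_sq_weights * v"
    by (simp add: weighted_noise_def d_def sum_sq_weights_def sum_distrib_right)
qed

lemma noise_x_bound:
  shows "square_integrable M noise_x"
    and "(\<integral>\<omega>. (norm (noise_x \<omega>))\<^sup>2 \<partial>M) \<le> sum_sq_weights * (\<sigma>xG\<^sup>2 + \<sigma>xK\<^sup>2)"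
  by (rule martingale_noise_bound[OF err_x_square_integrable err_x_variance err_x_adapted err_x_orthogonal]; assumption)+

lemma noise_y_bound:
  shows "square_integrable M noise_y"
    and "(\<integral>\<omega>. (norm (noise_y \<omega>))\<^sup>2 \<partial>M) \<le> sum_sq_weights * \<sigma>y\<^sup>2"
  by (rule martingale_noise_bound[OF err_y_square_integrable err_y_variance err_y_adapted err_y_orthogonal]; assumption)+

definition gap_bound :: "'w \<Rightarrow> real" where
  "gap_bound \<omega> = 2 / (real N * (real N - 1)) *
     (\<eta> * ((norm (xag N \<omega> - x1))\<^sup>2 + 3 / 4 * (norm (yag N \<omega> - y1))\<^sup>2)
      + 2 / (3 * \<eta>) * (\<Sum>t=1..N - 1. (real t)\<^sup>2 * (9 / 4 * (norm (err_x t \<omega>))\<^sup>2 + (norm (err_y t \<omega>))\<^sup>2))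
      + (3 / 4 * (norm (noise_x \<omega>))\<^sup>2 + (norm (noise_y \<omega>))\<^sup>2) / \<eta>
      + (\<Sum>t=1..N - 1. real t * (err_y t \<omega> \<bullet> (y t \<omega> - y1) - err_x t \<omega> \<bullet> (x t \<omega> - x1))))"

definition "perturbation \<omega> = apd_perturbation K \<eta> N (\<lambda>t. x t \<omega>) (\<lambda>t. y t \<omega>) (\<lambda>t. err_x t \<omega>) (\<lambda>t. err_y t \<omega>)"

lemma perturbed_gap_le_gap_bound:
  assumes "\<omega> \<in> space M"
  shows "perturbed_gap X Y G K J (xag N \<omega>, yag N \<omega>) (perturbation \<omega>) \<le> ereal (gap_bound \<omega>)"
  unfolding gap_bound_def perturbation_def
  by (rule apd_trajectory.perturbed_gap_le[OF trajectory[OF assms]])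

text \<open>The squared distance of the output from the starting point is at most twice its squared
  distance from the saddle point plus \<open>2 D\<^sup>2\<close>. As \<open>3/4 = 4/3 *
  9/16\<close>, the former costs \<open>8/3\<close> times the distance bound, which explains
  \<open>14/3 = 2 + 8/3\<close>. The noise contributes \<open>8/3\<close> through that
  distance, \<open>2/3\<close> through the squared errors and at most 1 through their
  accumulated sums.\<close>

lemma expected_gap_bound:
  assumes solution: "saddle_point X Y G K J (xh, yh)"
  defines "d2 \<equiv> (norm (xh - x1))\<^sup>2 + 3 / 4 * (norm (yh - y1))\<^sup>2"
  shows "integrable M gap_bound"
    and "(\<integral>\<omega>. gap_bound \<omega> \<partial>M) \<le> 2 / (real N * (real N - 1)) * (14 / 3 * \<eta> * d2 + 13 / 3 * (sum_sq_weights * weighted_variance / \<eta>))"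
proof -
  define c where "c = 2 / (real N * (real N - 1))"
  have c: "c > 0" using N_ge_2 by (simp add: c_def)
  have N: "N \<in> {1..N}" using N_ge_2 by auto
  have s: "t \<in> {1..N}" if "t \<in> {1..N - 1}" for t using that by auto
  note xs = x_square_integrable[OF solution s] and ys = y_square_integrable[OF solution s]
  define A where "A \<omega> = (norm (xag N \<omega> - x1))\<^sup>2 + 3 / 4 * (norm (yag N \<omega> - y1))\<^sup>2" for \<omega>
  define E where "E \<omega> = (\<Sum>t=1..N - 1. (real t)\<^sup>2 * (9 / 4 * (norm (err_x t \<omega>))\<^sup>2 + (norm (err_y t \<omega>))\<^sup>2))" for \<omega>
  define L where "L \<omega> = (\<Sum>t=1..N - 1. real t * (err_y t \<omega> \<bullet> (y t \<omega> - y1) - err_x t \<omega> \<bullet> (x t \<omega> - x1)))" for \<omega>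
  note xag = xag_square_integrable[OF solution N] and yag = yag_square_integrable[OF solution N]
  have A: "integrable M A"
    using square_integrable_diff[OF xag square_integrable_const[of x1]]
      square_integrable_diff[OF yag square_integrable_const[of y1]]
    by (auto simp: A_def[abs_def] square_integrable_def)
  have E: "integrable M E" "(\<integral>\<omega>. E \<omega> \<partial>M) \<le> sum_sq_weights * weighted_variance"
    using noise_energy[OF order_refl] by (simp_all add: E_def[abs_def])
  have L: "integrable M L" "(\<integral>\<omega>. L \<omega> \<partial>M) = 0"
    unfolding L_def[abs_def] by (intro noise_linear_mean_zero[OF order_refl] xs ys; assumption)+
  have nx: "integrable M (\<lambda>\<omega>. (norm (noise_x \<omega>))\<^sup>2)" and ny: "integrable M (\<lambda>\<omega>. (norm (noise_y \<omega>))\<^sup>2)"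
    using noise_x_bound(1) noise_y_bound(1) by (auto simp: square_integrable_def)
  define B where "B \<omega> = (norm (xag N \<omega> - xh))\<^sup>2 + 9 / 16 * (norm (yag N \<omega> - yh))\<^sup>2" for \<omega>
  have B: "integrable M B"
    using square_integrable_diff[OF xag square_integrable_const[of xh]]
      square_integrable_diff[OF yag square_integrable_const[of yh]]
    by (auto simp: B_def[abs_def] square_integrable_def)
  have "(\<integral>\<omega>. A \<omega> \<partial>M) \<le> (\<integral>\<omega>. 8 / 3 * B \<omega> + 2 * d2 \<partial>M)"
  proof (rule integral_mono[OF A])
    fix \<omega>
    have "(norm (xag N \<omega> - x1))\<^sup>2 \<le> 2 * (norm (xag N \<omega> - xh))\<^sup>2 + 2 * (norm (xh - x1))\<^sup>2"
         "(norm (yag N \<omega> - y1))\<^sup>2 \<le> 2 * (norm (yag N \<omega> - yh))\<^sup>2 + 2 * (norm (yh - y1))\<^sup>2"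
      using norm_add_sq_le[of "xag N \<omega> - xh" "xh - x1"] norm_add_sq_le[of "yag N \<omega> - yh" "yh - y1"] by auto
    moreover have "0 \<le> (norm (xag N \<omega> - xh))\<^sup>2" by simp
    ultimately show "A \<omega> \<le> 8 / 3 * B \<omega> + 2 * d2"
      unfolding A_def B_def d2_def distrib_left by linarith
  qed (use B in simp)
  also have "\<dots> = 8 / 3 * (\<integral>\<omega>. B \<omega> \<partial>M) + 2 * d2"
    using B by (simp add: prob_space)
  also have "\<dots> \<le> 8 / 3 * sq_radius xh yh + 2 * d2"
    using expected_average_distance[OF solution N] by (simp add: B_def)
  also have "\<dots> = 14 / 3 * d2 + 8 / 3 * (sum_sq_weights * weighted_variance / \<eta>\<^sup>2)"
  proof -
    have "8 / 3 * (a + b) + 2 * a = 14 / 3 * a + 8 / 3 * b" for a b :: real by (simp add: field_simps)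
    then show ?thesis unfolding sq_radius_def d2_def[symmetric] .
  qed
  finally have EA: "(\<integral>\<omega>. A \<omega> \<partial>M) \<le> 14 / 3 * d2 + 8 / 3 * (sum_sq_weights * weighted_variance / \<eta>\<^sup>2)" .
  have gb: "gap_bound = (\<lambda>\<omega>. c * (\<eta> * A \<omega> + 2 / (3 * \<eta>) * E \<omega>
      + (3 / 4 * (norm (noise_x \<omega>))\<^sup>2 + (norm (noise_y \<omega>))\<^sup>2) / \<eta> + L \<omega>))"
    by (simp add: fun_eq_iff gap_bound_def A_def E_def L_def c_def)
  show "integrable M gap_bound"
    unfolding gb using A E(1) L(1) nx ny by simp
  have "(\<integral>\<omega>. gap_bound \<omega> \<partial>M) = c * (\<eta> * (\<integral>\<omega>. A \<omega> \<partial>M) + 2 / (3 * \<eta>) * (\<integral>\<omega>. E \<omega> \<partial>M)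
      + (3 / 4 * (\<integral>\<omega>. (norm (noise_x \<omega>))\<^sup>2 \<partial>M) + (\<integral>\<omega>. (norm (noise_y \<omega>))\<^sup>2 \<partial>M)) / \<eta>)"
    unfolding gb using A E(1) L nx ny by simp
  also have "\<dots> \<le> c * (\<eta> * (14 / 3 * d2 + 8 / 3 * (sum_sq_weights * weighted_variance / \<eta>\<^sup>2)) + 2 / (3 * \<eta>) * (sum_sq_weights * weighted_variance)
      + sum_sq_weights * weighted_variance / \<eta>)"
  proof (intro mult_left_mono add_mono divide_right_mono)
    have w: "0 \<le> sum_sq_weights" by (simp add: sum_sq_weights_def sum_nonneg)
    have "3 / 4 * (\<integral>\<omega>. (norm (noise_x \<omega>))\<^sup>2 \<partial>M) + (\<integral>\<omega>. (norm (noise_y \<omega>))\<^sup>2 \<partial>M)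
        \<le> 3 / 4 * (sum_sq_weights * (\<sigma>xG\<^sup>2 + \<sigma>xK\<^sup>2)) + sum_sq_weights * \<sigma>y\<^sup>2"
      using noise_x_bound(2) noise_y_bound(2) by (intro add_mono mult_left_mono) auto
    also have "\<dots> = sum_sq_weights * (3 / 4 * (\<sigma>xG\<^sup>2 + \<sigma>xK\<^sup>2) + \<sigma>y\<^sup>2)" by (simp add: algebra_simps)
    also have "\<dots> \<le> sum_sq_weights * weighted_variance"
      using w by (intro mult_left_mono) (auto simp: weighted_variance_def)
    finally show "3 / 4 * (\<integral>\<omega>. (norm (noise_x \<omega>))\<^sup>2 \<partial>M) + (\<integral>\<omega>. (norm (noise_y \<omega>))\<^sup>2 \<partial>M) \<le> sum_sq_weights * weighted_variance" .
  qed (use c \<eta>_pos E(2) EA in auto)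
  also have "\<dots> = c * (14 / 3 * \<eta> * d2 + 13 / 3 * (sum_sq_weights * weighted_variance / \<eta>))"
    using \<eta>_pos by (simp add: field_simps power2_eq_square)
  finally show "(\<integral>\<omega>. gap_bound \<omega> \<partial>M) \<le> 2 / (real N * (real N - 1)) * (14 / 3 * \<eta> * d2 + 13 / 3 * (sum_sq_weights * weighted_variance / \<eta>))"
    by (simp add: c_def)
qed

text \<open>All distances between iterates are routed through the saddle point, from which each iterate
  has mean distance at most \<open>sqrt (sq_radius xh yh)\<close>.\<close>

lemma
  assumes solution: "saddle_point X Y G K J (xh, yh)"
  shows perturbation_measurable: "perturbation \<in> borel_measurable M"
    and perturbation_integrable: "integrable M (\<lambda>\<omega>. norm (perturbation \<omega>))"
    and expected_perturbation: "(\<integral>\<omega>. norm (perturbation \<omega>) \<partial>M) \<le> 2 / (real N * (real N - 1)) *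
       (4 * \<eta> / 3 * (sqrt (sq_radius xh yh) + sqrt ((norm (xh - x1))\<^sup>2 + 3 / 4 * (norm (yh - y1))\<^sup>2))
        + sqrt (sum_sq_weights * weighted_variance) + 2 * (real N - 1) * LK * sqrt (sq_radius xh yh))"
proof -
  define c where "c = 2 / (real N * (real N - 1))"
  have c: "c > 0" using N_ge_2 by (simp add: c_def)
  have N: "N \<in> {1..N}" "N - 1 \<in> {1..N}" "1 \<in> {1..N}" using N_ge_2 by auto
  note sqN = x_square_integrable[OF solution N(1)] y_square_integrable[OF solution N(1)]
  \<comment> \<open>The factor \<open>3 / 4\<close> turns the weighted distance \<open>9 / 16\<close> of the dual
    component into a product norm.\<close>
  define \<Psi> where "\<Psi> t \<omega> = (x t \<omega> - xh, (3 / 4) *\<^sub>R (y t \<omega> - yh))" for t \<omega>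
  have \<Psi>2: "(norm (\<Psi> t \<omega>))\<^sup>2 = (norm (x t \<omega> - xh))\<^sup>2 + 9 / 16 * (norm (y t \<omega> - yh))\<^sup>2" for t \<omega>
    by (simp add: \<Psi>_def norm_Pair power_mult_distrib power2_eq_square)
  have pair: "square_integrable M (\<lambda>\<omega>. (f \<omega>, g \<omega>))" if "square_integrable M f" "square_integrable M g"
    for f :: "'w \<Rightarrow> 'c::euclidean_space" and g :: "'w \<Rightarrow> 'd::euclidean_space"
    using that by (auto simp: square_integrable_def norm_Pair)
  have \<Psi>: "square_integrable M (\<Psi> t)" "(\<integral>\<omega>. norm (\<Psi> t \<omega>) \<partial>M) \<le> sqrt (sq_radius xh yh)" if t: "t \<in> {1..N}" for t
  proof -
    show sq: "square_integrable M (\<Psi> t)"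
      unfolding \<Psi>_def[abs_def]
      by (intro pair square_integrable_scaleR square_integrable_diff square_integrable_const
          x_square_integrable[OF solution t] y_square_integrable[OF solution t])
    have "(\<integral>\<omega>. norm (\<Psi> t \<omega>) \<partial>M) \<le> sqrt (\<integral>\<omega>. (norm (\<Psi> t \<omega>))\<^sup>2 \<partial>M)"
      by (rule square_integrable_norm_integrable(2)[OF sq])
    also have "\<dots> \<le> sqrt (sq_radius xh yh)"
      using expected_distance[OF solution t] by (simp add: \<Psi>2)
    finally show "(\<integral>\<omega>. norm (\<Psi> t \<omega>) \<partial>M) \<le> sqrt (sq_radius xh yh)" .
  qed
  define s where "s = sqrt ((norm (xh - x1))\<^sup>2 + 3 / 4 * (norm (yh - y1))\<^sup>2)"
  have noise_sq: "square_integrable M (\<lambda>\<omega>. (noise_x \<omega>, noise_y \<omega>))"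
    by (intro pair noise_x_bound(1) noise_y_bound(1))
  have noise: "(\<integral>\<omega>. norm (noise_x \<omega>, noise_y \<omega>) \<partial>M) \<le> sqrt (sum_sq_weights * weighted_variance)"
  proof -
    have w: "0 \<le> sum_sq_weights" by (simp add: sum_sq_weights_def sum_nonneg)
    have "(\<integral>\<omega>. (norm (noise_x \<omega>, noise_y \<omega>))\<^sup>2 \<partial>M) = (\<integral>\<omega>. (norm (noise_x \<omega>))\<^sup>2 \<partial>M) + (\<integral>\<omega>. (norm (noise_y \<omega>))\<^sup>2 \<partial>M)"
      using noise_x_bound(1) noise_y_bound(1) by (simp add: square_integrable_def norm_Pair)
    also have "\<dots> \<le> sum_sq_weights * (\<sigma>xG\<^sup>2 + \<sigma>xK\<^sup>2) + sum_sq_weights * \<sigma>y\<^sup>2"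
      by (intro add_mono noise_x_bound(2) noise_y_bound(2))
    also have "\<dots> = sum_sq_weights * (\<sigma>xG\<^sup>2 + \<sigma>xK\<^sup>2 + \<sigma>y\<^sup>2)" by (simp add: algebra_simps)
    also have "\<dots> \<le> sum_sq_weights * weighted_variance" using w by (intro mult_left_mono) (auto simp: weighted_variance_def)
    finally have "sqrt (\<integral>\<omega>. (norm (noise_x \<omega>, noise_y \<omega>))\<^sup>2 \<partial>M) \<le> sqrt (sum_sq_weights * weighted_variance)" by simp
    with square_integrable_norm_integrable(2)[OF noise_sq] show ?thesis by (rule order_trans)
  qed
  define B where "B \<omega> = c * (4 * \<eta> / 3 * (norm (\<Psi> N \<omega>) + s) + norm (noise_x \<omega>, noise_y \<omega>)
      + (real N - 1) * LK * (norm (\<Psi> N \<omega>) + norm (\<Psi> (N - 1) \<omega>)))" for \<omega>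
  note int = square_integrable_norm_integrable(1)[OF \<Psi>(1)[OF N(1)]]
    square_integrable_norm_integrable(1)[OF \<Psi>(1)[OF N(2)]]
    square_integrable_norm_integrable(1)[OF noise_sq]
  have B: "integrable M B"
    unfolding B_def[abs_def] using int by simp
  have le: "norm (perturbation \<omega>) \<le> B \<omega>" if w: "\<omega> \<in> space M" for \<omega>
  proof -
    have 1: "norm (x N \<omega> - x1, (3 / 4) *\<^sub>R (y N \<omega> - y1)) \<le> norm (\<Psi> N \<omega>) + s"
    proof -
      have "(x N \<omega> - x1, (3 / 4) *\<^sub>R (y N \<omega> - y1)) = \<Psi> N \<omega> + (xh - x1, (3 / 4) *\<^sub>R (yh - y1))"
        by (simp add: \<Psi>_def algebra_simps)
      moreover have "norm (xh - x1, (3 / 4) *\<^sub>R (yh - y1)) \<le> s"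
        by (simp add: s_def norm_Pair power_mult_distrib power2_eq_square)
      ultimately show ?thesis using norm_triangle_ineq[of "\<Psi> N \<omega>" "(xh - x1, (3 / 4) *\<^sub>R (yh - y1))"] by simp
    qed
    have f: "norm (x t \<omega> - xh) \<le> norm (\<Psi> t \<omega>)" for t
      by (simp add: \<Psi>_def norm_Pair)
    have 2: "norm (x N \<omega> - x (N - 1) \<omega>) \<le> norm (\<Psi> N \<omega>) + norm (\<Psi> (N - 1) \<omega>)"
      using norm_triangle_ineq4[of "x N \<omega> - xh" "x (N - 1) \<omega> - xh"] f[of N] f[of "N - 1"] by simp
    have "norm (perturbation \<omega>) \<le> c * (4 * \<eta> / 3 * norm (x N \<omega> - x1, (3 / 4) *\<^sub>R (y N \<omega> - y1))
        + norm (noise_x \<omega>, noise_y \<omega>) + (real N - 1) * LK * norm (x N \<omega> - x (N - 1) \<omega>))"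
      unfolding perturbation_def c_def by (rule apd_trajectory.norm_perturbation_le[OF trajectory[OF w]])
    also have "\<dots> \<le> B \<omega>"
      unfolding B_def using c \<eta>_pos LK_nonneg N_ge_2
      by (intro mult_left_mono add_mono 1 2) auto
    finally show ?thesis .
  qed
  note [measurable] = x_measurable[OF N(1)] x_measurable[OF N(2)] x_measurable[OF N(3)]
    y_measurable[OF N(1)] y_measurable[OF N(3)]
  have [measurable]: "noise_x \<in> borel_measurable M" "noise_y \<in> borel_measurable M"
    using noise_x_bound(1) noise_y_bound(1) by (auto simp: square_integrable_def)
  have [measurable]: "K \<in> borel_measurable borel"
    using K_linear by (intro borel_measurable_continuous_onI linear_continuous_on linear_conv_bounded_linear[THEN iffD1])
  show meas[measurable]: "perturbation \<in> borel_measurable M"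
    unfolding perturbation_def[abs_def] apd_perturbation_def by measurable
  show I: "integrable M (\<lambda>\<omega>. norm (perturbation \<omega>))"
  proof (rule Bochner_Integration.integrable_bound[OF B])
    show "AE \<omega> in M. norm (norm (perturbation \<omega>)) \<le> norm (B \<omega>)"
      using le by (intro AE_I2) (auto intro: order_trans[OF _ abs_ge_self])
  qed measurable
  have "(\<integral>\<omega>. norm (perturbation \<omega>) \<partial>M) \<le> (\<integral>\<omega>. B \<omega> \<partial>M)"
    by (rule integral_mono[OF I B le])
  also have "\<dots> = c * (4 * \<eta> / 3 * ((\<integral>\<omega>. norm (\<Psi> N \<omega>) \<partial>M) + s) + (\<integral>\<omega>. norm (noise_x \<omega>, noise_y \<omega>) \<partial>M)
      + (real N - 1) * LK * ((\<integral>\<omega>. norm (\<Psi> N \<omega>) \<partial>M) + (\<integral>\<omega>. norm (\<Psi> (N - 1) \<omega>) \<partial>M)))"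
    unfolding B_def[abs_def] using int by (simp add: prob_space)
  also have "\<dots> \<le> c * (4 * \<eta> / 3 * (sqrt (sq_radius xh yh) + s) + sqrt (sum_sq_weights * weighted_variance)
      + (real N - 1) * LK * (sqrt (sq_radius xh yh) + sqrt (sq_radius xh yh)))"
    using c \<eta>_pos LK_nonneg N_ge_2
    by (intro mult_left_mono add_mono \<Psi>(2) N noise) auto
  finally show "(\<integral>\<omega>. norm (perturbation \<omega>) \<partial>M) \<le> 2 / (real N * (real N - 1)) *
       (4 * \<eta> / 3 * (sqrt (sq_radius xh yh) + sqrt ((norm (xh - x1))\<^sup>2 + 3 / 4 * (norm (yh - y1))\<^sup>2))
        + sqrt (sum_sq_weights * weighted_variance) + 2 * (real N - 1) * LK * sqrt (sq_radius xh yh))"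
    by (simp add: c_def s_def algebra_simps)
qed

end

section \<open>Measurability of the perturbed gap\<close>

text \<open>Strict superlevel sets are relatively open in \<open>S\<close>.\<close>

lemma lsc_on_borel_measurable:
  fixes f :: "'v::topological_space \<Rightarrow> real"
  assumes f: "lsc_on S f"
  shows "f \<in> borel_measurable (restrict_space borel S)"
proof (rule borel_measurableI_greater)
  fix c :: real
  define U where "U = \<Union>{T. open T \<and> (\<forall>y\<in>T \<inter> S. c < f y)}"
  have "open U" unfolding U_def by (rule open_Union) auto
  have "x \<in> U" if x: "x \<in> S" "c < f x" for x
  proof -
    have "\<forall>\<^sub>F y in at x within S. c < f y"
      using f x by (auto simp: lsc_on_def)
    then obtain T where T: "open T" "x \<in> T" "\<forall>y\<in>T. y \<noteq> x \<longrightarrow> y \<in> S \<longrightarrow> c < f y"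
      unfolding eventually_at_topological by blast
    have "\<forall>y\<in>T \<inter> S. c < f y"
    proof
      fix y assume "y \<in> T \<inter> S"
      then show "c < f y" using T(3) x(2) by (cases "y = x") auto
    qed
    with T(1,2) show ?thesis unfolding U_def by (intro UnionI[of T]) auto
  qed
  moreover have "c < f x" if "x \<in> U" "x \<in> S" for x
    using that by (auto simp: U_def)
  ultimately have eq: "{x \<in> space (restrict_space borel S). c < f x} = S \<inter> U"
    by (intro set_eqI) (simp add: space_restrict_space, blast)
  show "{x \<in> space (restrict_space borel S). c < f x} \<in> sets (restrict_space borel S)"
    unfolding eq sets_restrict_space using \<open>open U\<close> by (intro imageI) simp
qed

text \<open>The index set may be uncountable: strict superlevel sets of the supremum are unions of open
  sets.\<close>

lemma borel_measurable_SUP_continuous: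
  fixes h :: "'i \<Rightarrow> 'v::topological_space \<Rightarrow> real"
  assumes h: "\<And>i. i \<in> I \<Longrightarrow> continuous_on UNIV (h i)"
  shows "(\<lambda>p. SUP i\<in>I. ereal (h i p)) \<in> borel_measurable borel"
proof (rule borel_measurableI_greater)
  fix c :: ereal
  have "open {p. c < ereal (h i p)}" if "i \<in> I" for i
    by (intro open_Collect_less continuous_on_const continuous_on_ereal h that)
  then have "open (\<Union>i\<in>I. {p. c < ereal (h i p)})" by (rule open_UN[rule_format])
  also have "(\<Union>i\<in>I. {p. c < ereal (h i p)}) = {p \<in> space borel. c < (SUP i\<in>I. ereal (h i p))}"
    by (auto simp: less_SUP_iff)
  finally show "{p \<in> space borel. c < (SUP i\<in>I. ereal (h i p))} \<in> sets borel" by simp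
qed

text \<open>Only \<open>G\<close> and \<open>J\<close> at the point itself are not continuous on the
  whole space, and they do not depend on the comparison point. Taken out of the supremum, they
  leave a supremum of continuous functions of the point and the perturbation.\<close>

lemma perturbed_gap_measurable:
  fixes X :: "'a::euclidean_space set" and Y :: "'b::euclidean_space set"
  assumes G: "continuous_on X G" and J: "lsc_on Y J" and K: "linear K"
    and ne: "X \<noteq> {}" "Y \<noteq> {}"
    and a: "a \<in> borel_measurable M" "\<And>\<omega>. \<omega> \<in> space M \<Longrightarrow> a \<omega> \<in> X"
    and b: "b \<in> borel_measurable M" "\<And>\<omega>. \<omega> \<in> space M \<Longrightarrow> b \<omega> \<in> Y"
    and v[measurable]: "v \<in> borel_measurable M"
  shows "(\<lambda>\<omega>. perturbed_gap X Y G K J (a \<omega>, b \<omega>) (v \<omega>)) \<in> borel_measurable M"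
proof -
  note [measurable] = a(1) b(1)
  have [measurable]: "a \<in> measurable M (restrict_space borel X)" "b \<in> measurable M (restrict_space borel Y)"
    using a b by (auto intro!: measurable_restrict_space2)
  have [measurable]: "G \<in> borel_measurable (restrict_space borel X)"
    by (rule borel_measurable_continuous_on_restrict[OF G])
  have [measurable]: "J \<in> borel_measurable (restrict_space borel Y)"
    by (rule lsc_on_borel_measurable[OF J])
  define h where "h z p = K (fst (fst p)) \<bullet> snd z - J (snd z) - G (fst z) - K (fst z) \<bullet> snd (fst p)
      - snd p \<bullet> (fst p - z)" for z :: "'a \<times> 'b" and p :: "('a \<times> 'b) \<times> ('a \<times> 'b)"
  have Kc: "continuous_on UNIV K"
    using K by (intro linear_continuous_on linear_conv_bounded_linear[THEN iffD1])
  have "continuous_on UNIV (h z)" for z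
    unfolding h_def by (intro continuous_intros continuous_on_compose2[OF Kc]) auto
  then have [measurable]: "(\<lambda>p. SUP z\<in>X \<times> Y. ereal (h z p)) \<in> borel_measurable borel"
    by (intro borel_measurable_SUP_continuous)
  have eq: "perturbed_gap X Y G K J (a \<omega>, b \<omega>) (v \<omega>)
      = ereal (G (a \<omega>) + J (b \<omega>)) + (SUP z\<in>X \<times> Y. ereal (h z ((a \<omega>, b \<omega>), v \<omega>)))" for \<omega>
  proof -
    have "perturbed_gap X Y G K J (a \<omega>, b \<omega>) (v \<omega>)
        = (SUP z\<in>X \<times> Y. ereal (G (a \<omega>) + J (b \<omega>)) + ereal (h z ((a \<omega>, b \<omega>), v \<omega>)))"
      unfolding perturbed_gap_def by (rule SUP_cong) (auto simp: h_def)
    also have "\<dots> = ereal (G (a \<omega>) + J (b \<omega>)) + (SUP z\<in>X \<times> Y. ereal (h z ((a \<omega>, b \<omega>), v \<omega>)))"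
      using ne by (intro SUP_ereal_add_right) auto
    finally show ?thesis .
  qed
  show ?thesis unfolding eq by measurable
qed

section \<open>The convergence rate\<close>

lemma sum_squares_le: "(\<Sum>t=1..n. (real t)\<^sup>2) \<le> (real n + 1)\<^sup>2 * real n / 3"
proof (induction n)
  case (Suc n)
  have "(\<Sum>t=1..Suc n. (real t)\<^sup>2) \<le> (real n + 1)\<^sup>2 * real n / 3 + (real n + 1)\<^sup>2"
    using Suc.IH by (simp add: add.commute)
  also have "\<dots> \<le> (real (Suc n) + 1)\<^sup>2 * real (Suc n) / 3"
    by (simp add: power2_eq_square algebra_simps)
  finally show ?case .
qed simp

text \<open>Write \<open>\<rho> = n sqrt (n - 1) \<sigma>\<close>. From \<open>\<rho> \<le> \<eta>
  Dt\<close> and \<open>w \<sigma>\<^sup>2 \<le> \<rho>\<^sup>2 / 3\<close>, every noise term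
  becomes a multiple of \<open>Dt \<rho>\<close>, \<open>\<rho>\<close> or \<open>Dt\<close>.
  After inserting the definition of \<open>\<eta>\<close>, both bounds are compared
  coefficientwise in \<open>LG\<close>, \<open>LK\<close> and \<open>\<rho>\<close>.\<close>

lemma rate_arithmetic:
  fixes \<eta> LG LK \<sigma> Dt D w n :: real
  assumes n: "n \<ge> 2" and nonneg: "LG \<ge> 0" "LK \<ge> 0" "\<sigma> \<ge> 0" and pos: "Dt > 0" "D > 0" "\<eta> > 0"
    and \<eta>: "\<eta> = 2 * LG + 2 * LK * (n - 1) + n * sqrt (n - 1) * \<sigma> / Dt"
    and w: "0 \<le> w" "w \<le> n\<^sup>2 * (n - 1) / 3"
  shows "2 / (n * (n - 1)) * (14 / 3 * \<eta> * D\<^sup>2 + 13 / 3 * (w * \<sigma>\<^sup>2 / \<eta>))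
         \<le> 36 * LG * D\<^sup>2 / (n * (n - 1)) + 36 * LK * D\<^sup>2 / n + \<sigma> * D * (18 * D / Dt + 3 * Dt / D) / sqrt (n - 1)"
    and "2 / (n * (n - 1)) * (4 * \<eta> / 3 * (sqrt (D\<^sup>2 + w * \<sigma>\<^sup>2 / \<eta>\<^sup>2) + D) + sqrt (w * \<sigma>\<^sup>2)
            + 2 * (n - 1) * LK * sqrt (D\<^sup>2 + w * \<sigma>\<^sup>2 / \<eta>\<^sup>2))
         \<le> 50 * LG * D / (n * (n - 1)) + LK * D * (55 + 3 * Dt / D) / n + \<sigma> * (6 + 25 * D / Dt) / sqrt (n - 1)"
proof -
  define r where "r = sqrt (n - 1)"
  have r: "r > 0" "n - 1 = r\<^sup>2" using n by (auto simp: r_def)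
  have n0: "n > 0" using n by simp
  define \<rho> where "\<rho> = n * r * \<sigma>"
  have \<rho>: "\<rho> \<ge> 0" using n0 r nonneg by (simp add: \<rho>_def)
  define c where "c = 2 / (n * (n - 1))"
  have c: "c > 0" using n by (simp add: c_def)
  have \<eta>': "\<eta> = 2 * LG + 2 * LK * r\<^sup>2 + \<rho> / Dt"
    unfolding \<eta> \<rho>_def r(2) using r(1) by simp
  have "\<rho> / Dt \<le> \<eta>" unfolding \<eta>' using nonneg by simp
  then have \<rho>\<eta>: "\<rho> \<le> \<eta> * Dt" using pos by (simp add: field_simps)
  have noise: "w * \<sigma>\<^sup>2 \<le> \<rho>\<^sup>2 / 3"
    using mult_right_mono[OF w(2), of "\<sigma>\<^sup>2"] by (simp add: \<rho>_def power_mult_distrib r(2))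
  have c_LG: "c * LG = 2 * LG / (n * (n - 1))" by (simp add: c_def)
  have c_LK: "c * (LK * r\<^sup>2) = 2 * LK / n"
    using n0 r by (simp add: c_def r(2))
  have c_\<rho>: "c * \<rho> = 2 * \<sigma> / r"
    using n0 r by (simp add: c_def \<rho>_def r(2) power2_eq_square)
  have "w * \<sigma>\<^sup>2 / \<eta> \<le> (\<rho>\<^sup>2 / 3) / \<eta>"
    using noise pos by (intro divide_right_mono) auto
  also have "\<dots> \<le> Dt * \<rho> / 3"
    using mult_right_mono[OF \<rho>\<eta> \<rho>] pos by (simp add: field_simps power2_eq_square)
  finally have s: "w * \<sigma>\<^sup>2 / \<eta> \<le> Dt * \<rho> / 3" .
  have "14 / 3 * \<eta> * D\<^sup>2 + 13 / 3 * (w * \<sigma>\<^sup>2 / \<eta>) \<le> 9 * \<eta> * D\<^sup>2 + 3 / 2 * (Dt * \<rho>)"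
  proof (rule add_mono)
    show "14 / 3 * \<eta> * D\<^sup>2 \<le> 9 * \<eta> * D\<^sup>2" using pos by (intro mult_right_mono) auto
    have "0 \<le> Dt * \<rho>" using pos \<rho> by simp
    then have "13 / 3 * (Dt * \<rho> / 3) \<le> 3 / 2 * (Dt * \<rho>)" by simp
    moreover have "13 / 3 * (w * \<sigma>\<^sup>2 / \<eta>) \<le> 13 / 3 * (Dt * \<rho> / 3)"
      using s by (rule mult_left_mono) simp
    ultimately show "13 / 3 * (w * \<sigma>\<^sup>2 / \<eta>) \<le> 3 / 2 * (Dt * \<rho>)"
      by (rule order_trans[rotated])
  qed
  then have "c * (14 / 3 * \<eta> * D\<^sup>2 + 13 / 3 * (w * \<sigma>\<^sup>2 / \<eta>)) \<le> c * (9 * \<eta> * D\<^sup>2 + 3 / 2 * (Dt * \<rho>))"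
    using c by (intro mult_left_mono) auto
  also have "\<dots> = 18 * (c * LG) * D\<^sup>2 + 18 * (c * (LK * r\<^sup>2)) * D\<^sup>2 + (c * \<rho>) * (9 * D\<^sup>2 / Dt + 3 / 2 * Dt)"
    unfolding \<eta>' using pos by (simp add: field_simps)
  also have "\<dots> = 36 * LG * D\<^sup>2 / (n * (n - 1)) + 36 * LK * D\<^sup>2 / n + \<sigma> * D * (18 * D / Dt + 3 * Dt / D) / r"
    unfolding c_LG c_LK c_\<rho> using pos r by (simp add: field_simps power2_eq_square)
  finally show "2 / (n * (n - 1)) * (14 / 3 * \<eta> * D\<^sup>2 + 13 / 3 * (w * \<sigma>\<^sup>2 / \<eta>))
         \<le> 36 * LG * D\<^sup>2 / (n * (n - 1)) + 36 * LK * D\<^sup>2 / n + \<sigma> * D * (18 * D / Dt + 3 * Dt / D) / sqrt (n - 1)"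
    by (simp add: c_def r_def)
  define q where "q = sqrt (w * \<sigma>\<^sup>2)"
  have q0: "0 \<le> q" using w by (simp add: q_def)
  have "\<rho>\<^sup>2 / 3 \<le> (3 / 5 * \<rho>)\<^sup>2"
    using zero_le_square[of \<rho>] by (simp add: power2_eq_square)
  with noise have "q \<le> sqrt ((3 / 5 * \<rho>)\<^sup>2)"
    unfolding q_def by (intro real_sqrt_le_mono) (rule order_trans)
  also have "\<dots> = 3 / 5 * \<rho>" using \<rho> by (subst real_sqrt_abs) simp
  finally have q: "q \<le> 3 / 5 * \<rho>" .
  have R: "sqrt (D\<^sup>2 + w * \<sigma>\<^sup>2 / \<eta>\<^sup>2) \<le> D + q / \<eta>"
  proof -
    have "sqrt (D\<^sup>2 + w * \<sigma>\<^sup>2 / \<eta>\<^sup>2) \<le> sqrt (D\<^sup>2) + sqrt (w * \<sigma>\<^sup>2 / \<eta>\<^sup>2)"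
      using w by (intro sqrt_add_le_add_sqrt) auto
    also have "\<dots> = D + q / \<eta>" using pos by (simp add: q_def real_sqrt_divide)
    finally show ?thesis .
  qed
  have "q / \<eta> \<le> 3 / 5 * (\<eta> * Dt) / \<eta>"
    using q \<rho>\<eta> pos by (intro divide_right_mono) auto
  then have q\<eta>: "q / \<eta> \<le> 3 / 5 * Dt" using pos by simp
  have "4 * \<eta> / 3 * (sqrt (D\<^sup>2 + w * \<sigma>\<^sup>2 / \<eta>\<^sup>2) + D) + q + 2 * r\<^sup>2 * LK * sqrt (D\<^sup>2 + w * \<sigma>\<^sup>2 / \<eta>\<^sup>2)
      \<le> 4 * \<eta> / 3 * (D + q / \<eta> + D) + q + 2 * r\<^sup>2 * LK * (D + 3 / 5 * Dt)"
    using pos nonneg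
    by (intro add_mono mult_left_mono order_refl R order_trans[OF R add_left_mono[OF q\<eta>]]) auto
  also have "\<dots> = 8 / 3 * \<eta> * D + 7 / 3 * q + (LK * r\<^sup>2) * (2 * D + 6 / 5 * Dt)"
    using pos by (simp add: field_simps)
  also have "\<dots> \<le> 8 / 3 * \<eta> * D + 3 * \<rho> + (LK * r\<^sup>2) * (22 * D + 3 / 2 * Dt)"
    using q \<rho> pos nonneg by (intro add_mono mult_left_mono) auto
  also have "\<dots> \<le> 8 / 3 * \<eta> * D + 3 * \<rho> + (LK * r\<^sup>2) * (22 * D + 3 / 2 * Dt) + 59 / 3 * LG * D
      + 1 / 6 * (LK * r\<^sup>2) * D + 59 / 6 * (\<rho> / Dt * D)"
    using \<rho> pos nonneg by simp
  also have "\<dots> = 25 * LG * D + (LK * r\<^sup>2) * (55 / 2 * D + 3 / 2 * Dt) + \<rho> * (3 + 25 / 2 * D / Dt)"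
    unfolding \<eta>' using pos by (simp add: field_simps)
  finally have "c * (4 * \<eta> / 3 * (sqrt (D\<^sup>2 + w * \<sigma>\<^sup>2 / \<eta>\<^sup>2) + D) + q + 2 * r\<^sup>2 * LK * sqrt (D\<^sup>2 + w * \<sigma>\<^sup>2 / \<eta>\<^sup>2))
      \<le> c * (25 * LG * D + (LK * r\<^sup>2) * (55 / 2 * D + 3 / 2 * Dt) + \<rho> * (3 + 25 / 2 * D / Dt))"
    using c by (intro mult_left_mono) auto
  also have "\<dots> = 25 * (c * LG) * D + (c * (LK * r\<^sup>2)) * (55 / 2 * D + 3 / 2 * Dt) + (c * \<rho>) * (3 + 25 / 2 * D / Dt)"
    by (simp add: algebra_simps)
  also have "\<dots> = 50 * LG * D / (n * (n - 1)) + LK * D * (55 + 3 * Dt / D) / n + \<sigma> * (6 + 25 * D / Dt) / r"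
    unfolding c_LG c_LK c_\<rho>
  proof (intro arg_cong2[where f = "(+)"])
    show "25 * (2 * LG / (n * (n - 1))) * D = 50 * LG * D / (n * (n - 1))" by simp
    show "2 * LK / n * (55 / 2 * D + 3 / 2 * Dt) = LK * D * (55 + 3 * Dt / D) / n"
      using pos n0 by (simp add: field_simps)
    show "2 * \<sigma> / r * (3 + 25 / 2 * D / Dt) = \<sigma> * (6 + 25 * D / Dt) / r"
      using pos r(1) by (simp add: field_simps)
  qed
  finally show "2 / (n * (n - 1)) * (4 * \<eta> / 3 * (sqrt (D\<^sup>2 + w * \<sigma>\<^sup>2 / \<eta>\<^sup>2) + D) + sqrt (w * \<sigma>\<^sup>2)
            + 2 * (n - 1) * LK * sqrt (D\<^sup>2 + w * \<sigma>\<^sup>2 / \<eta>\<^sup>2))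
         \<le> 50 * LG * D / (n * (n - 1)) + LK * D * (55 + 3 * Dt / D) / n + \<sigma> * (6 + 25 * D / Dt) / sqrt (n - 1)"
    unfolding c_def[symmetric] r_def[symmetric] q_def[symmetric] r(2)[symmetric] .
qed

theorem corollary3p4:
  fixes X :: "'a::euclidean_space set" and Y :: "'b::euclidean_space set"
    and G :: "'a \<Rightarrow> real" and gradG :: "'a \<Rightarrow> 'a" and K :: "'a \<Rightarrow> 'b" and J :: "'b \<Rightarrow> real"
    and LG LK :: real
    and M :: "'w measure" and P :: "'s measure"
    and oG :: "'a \<Rightarrow> 's \<Rightarrow> 'a" and oKx :: "'a \<Rightarrow> 's \<Rightarrow> 'b" and oKy :: "'b \<Rightarrow> 's \<Rightarrow> 'a"
    and \<sigma>xG \<sigma>y \<sigma>xK \<sigma>x \<sigma> :: real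
    and \<xi> :: "nat \<Rightarrow> evaluation \<Rightarrow> 'w \<Rightarrow> 's"
    and N :: nat and \<beta> \<theta> \<eta>s \<tau>s :: "nat \<Rightarrow> real" and \<eta> Dt D :: real
    and x1 xh :: 'a and y1 yh :: 'b
    and x xmd xag xbar :: "nat \<Rightarrow> 'w \<Rightarrow> 'a" and y yag :: "nat \<Rightarrow> 'w \<Rightarrow> 'b"
  assumes X: "closed X" "convex X" and Y: "closed Y" "convex Y"
    and G_convex: "convex_on X G"
    and G_gradient: "\<And>u. u \<in> X \<Longrightarrow> (G has_derivative (\<lambda>h. gradG u \<bullet> h)) (at u within X)"
    and LG: "LG \<ge> 0"
    and G_smooth: "\<And>u v. u \<in> X \<Longrightarrow> v \<in> X \<Longrightarrow>
                     G v - G u - gradG u \<bullet> (v - u) \<le> LG / 2 * (norm (v - u))\<^sup>2"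
    and K: "linear K" and LK: "LK = onorm K"
    and J: "convex_on Y J" "lsc_on Y J"
    and M: "prob_space M"
    and unbiased: "unbiased_oracle P X oG gradG" "unbiased_oracle P UNIV oKx K"
                  "unbiased_oracle P Y oKy (adjoint K)"
    and sigmas: "\<sigma>xG \<ge> 0" "\<sigma>y \<ge> 0" "\<sigma>xK \<ge> 0"
    and A1: "variance_bounded P X oG gradG \<sigma>xG" "variance_bounded P UNIV oKx K \<sigma>y"
            "variance_bounded P Y oKy (adjoint K) \<sigma>xK"
    and samples_indep: "prob_space.indep_vars M (\<lambda>_. P) (\<lambda>(t, e). \<xi> t e) ({1..N - 1} \<times> UNIV)"
    and samples_law: "\<And>t e. t \<in> {1..N - 1} \<Longrightarrow> distr M P (\<xi> t e) = P"
    and N: "N \<ge> 2"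
    and \<sigma>x: "\<sigma>x = sqrt (\<sigma>xG\<^sup>2 + \<sigma>xK\<^sup>2)"
    and \<sigma>: "\<sigma> = sqrt (9 / 4 * \<sigma>x\<^sup>2 + \<sigma>y\<^sup>2)"
    and Dt: "Dt > 0"
    and \<eta>: "\<eta> = 2 * LG + 2 * LK * (real N - 1) + real N * sqrt (real N - 1) * \<sigma> / Dt" "\<eta> > 0"
    and \<beta>: "\<And>t. \<beta> t = (real t + 1) / 2"
    and \<theta>: "\<And>t. \<theta> t = (real t - 1) / real t"
    and \<eta>s: "\<And>t. \<eta>s t = 3 * real t / (4 * \<eta>)"
    and \<tau>s: "\<And>t. \<tau>s t = real t / \<eta>"
    and start: "x1 \<in> X" "y1 \<in> Y"
    and run: "\<And>\<omega>. \<omega> \<in> space M \<Longrightarrow>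
           APD_run X Y J N \<beta> \<theta> \<eta>s \<tau>s
             (\<lambda>t u. oG u (\<xi> t EvalG \<omega>)) (\<lambda>t u. oKx u (\<xi> t EvalKx \<omega>)) (\<lambda>t v. oKy v (\<xi> t EvalKy \<omega>))
             x1 y1 (\<lambda>t. x t \<omega>) (\<lambda>t. y t \<omega>) (\<lambda>t. xmd t \<omega>) (\<lambda>t. xag t \<omega>) (\<lambda>t. yag t \<omega>) (\<lambda>t. xbar t \<omega>)"
    and solution: "saddle_point X Y G K J (xh, yh)"
    and D: "D = sqrt ((norm (xh - x1))\<^sup>2 + \<eta>s 1 / \<tau>s 1 * (norm (yh - y1))\<^sup>2)" "D > 0"
  shows "\<exists>(vN :: 'w \<Rightarrow> 'a \<times> 'b) (\<epsilon>N :: real).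
           vN \<in> borel_measurable M \<and>
           (\<lambda>\<omega>. perturbed_gap X Y G K J (xag N \<omega>, yag N \<omega>) (vN \<omega>)) \<in> borel_measurable M \<and>
           enn2ereal (\<integral>\<^sup>+\<omega>. e2ennreal (perturbed_gap X Y G K J (xag N \<omega>, yag N \<omega>) (vN \<omega>)) \<partial>M) \<le> ereal \<epsilon>N \<and>
           \<epsilon>N \<le> 36 * LG * D\<^sup>2 / (real N * (real N - 1)) + 36 * LK * D\<^sup>2 / real N
                 + \<sigma> * D * (18 * D / Dt + 3 * Dt / D) / sqrt (real N - 1) \<and>
           integrable M (\<lambda>\<omega>. norm (vN \<omega>)) \<and>
           (\<integral>\<omega>. norm (vN \<omega>) \<partial>M) \<le> 50 * LG * D / (real N * (real N - 1))
                 + LK * D * (55 + 3 * Dt / D) / real N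
                 + \<sigma> * (6 + 25 * D / Dt) / sqrt (real N - 1)"
proof -
  have KL: "bounded_linear K" using K by (rule linear_conv_bounded_linear[THEN iffD1])
  have K_bound: "norm (K h) \<le> LK * norm h" for h
    unfolding LK by (rule onorm[OF KL])
  have LK_nonneg: "LK \<ge> 0" unfolding LK by (rule onorm_pos_le[OF KL])
  have \<sigma>_nonneg: "\<sigma> \<ge> 0" and \<sigma>2: "\<sigma>\<^sup>2 = 9 / 4 * (\<sigma>xG\<^sup>2 + \<sigma>xK\<^sup>2) + \<sigma>y\<^sup>2"
    unfolding \<sigma> \<sigma>x by auto
  have "0 \<le> real N * sqrt (real N - 1) * \<sigma> / Dt"
    using N Dt \<sigma>_nonneg by simp
  then have stepsize: "2 * LG + 2 * LK * (real N - 1) \<le> \<eta>"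
    unfolding \<eta>(1) by simp
  have params: "\<beta> = (\<lambda>t. (real t + 1) / 2)" "\<theta> = (\<lambda>t. (real t - 1) / real t)"
     "\<eta>s = (\<lambda>t. 3 * real t / (4 * \<eta>))" "\<tau>s = (\<lambda>t. real t / \<eta>)"
    using \<beta> \<theta> \<eta>s \<tau>s by auto
  interpret stochastic_apd M X Y G gradG K J LG LK \<eta> N P oG oKx oKy \<sigma>xG \<sigma>y \<sigma>xK \<xi> x1 y1 x xmd xag xbar y yag
    by (rule stochastic_apd.intro[OF M], rule stochastic_apd_axioms.intro;
        (fact G_convex G_gradient G_smooth LG K K_bound LK_nonneg J N \<eta>(2) stepsize start unbiased A1
          samples_indep samples_law run[unfolded params])?)
  have ratio: "\<eta>s 1 / \<tau>s 1 = 3 / 4" using \<eta>(2) by (simp add: \<eta>s \<tau>s)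
  have D2: "(norm (xh - x1))\<^sup>2 + 3 / 4 * (norm (yh - y1))\<^sup>2 = D\<^sup>2"
    unfolding D(1) ratio by simp
  have weighted_variance: "weighted_variance = \<sigma>\<^sup>2" unfolding weighted_variance_def \<sigma>2 ..
  have w: "0 \<le> sum_sq_weights" "sum_sq_weights \<le> (real N)\<^sup>2 * (real N - 1) / 3"
    using sum_squares_le[of "N - 1"] N by (auto simp: sum_sq_weights_def of_nat_diff intro: sum_nonneg)
  have n: "real N \<ge> 2" using N by simp
  note arith = rate_arithmetic[OF n LG LK_nonneg \<sigma>_nonneg Dt D(2) \<eta>(2,1) w]
  define \<epsilon>N where "\<epsilon>N = 36 * LG * D\<^sup>2 / (real N * (real N - 1)) + 36 * LK * D\<^sup>2 / real N
                 + \<sigma> * D * (18 * D / Dt + 3 * Dt / D) / sqrt (real N - 1)"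
  have NN: "N \<in> {1..N}" using N by auto
  have sq_radius: "sq_radius xh yh = D\<^sup>2 + sum_sq_weights * \<sigma>\<^sup>2 / \<eta>\<^sup>2"
    unfolding sq_radius_def D2 weighted_variance ..
  show ?thesis
  proof (intro exI conjI)
    show "perturbation \<in> borel_measurable M"
      by (rule perturbation_measurable[OF solution])
    have "continuous_on X G"
      using G_gradient by (auto simp: continuous_on_eq_continuous_within intro: has_derivative_continuous)
    then show "(\<lambda>\<omega>. perturbed_gap X Y G K J (xag N \<omega>, yag N \<omega>) (perturbation \<omega>)) \<in> borel_measurable M"
      by (rule perturbed_gap_measurable[OF _ J(2) K _ _ xag_measurable[OF NN] xag_mem[OF _ NN]
            yag_measurable[OF NN] yag_mem[OF _ NN] perturbation_measurable[OF solution]])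
         (use start in auto)
    \<comment> \<open>The perturbed gap is nonnegative since the point itself is an admissible comparison point;
      hence the extended integral of the bound is an ordinary one.\<close>
    have gap_bound_nonneg: "0 \<le> gap_bound \<omega>" if "\<omega> \<in> space M" for \<omega>
    proof -
      have "ereal 0 \<le> perturbed_gap X Y G K J (xag N \<omega>, yag N \<omega>) (perturbation \<omega>)"
        unfolding perturbed_gap_def
        by (rule SUP_upper2[of "(xag N \<omega>, yag N \<omega>)"]) (use xag_mem[OF that NN] yag_mem[OF that NN] in auto)
      also have "\<dots> \<le> ereal (gap_bound \<omega>)" by (rule perturbed_gap_le_gap_bound[OF that])
      finally show ?thesis by simp
    qed
    have "(\<integral>\<^sup>+\<omega>. e2ennreal (perturbed_gap X Y G K J (xag N \<omega>, yag N \<omega>) (perturbation \<omega>)) \<partial>M)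
        \<le> (\<integral>\<^sup>+\<omega>. ennreal (gap_bound \<omega>) \<partial>M)"
    proof (rule nn_integral_mono)
      fix \<omega> assume "\<omega> \<in> space M"
      from e2ennreal_mono[OF perturbed_gap_le_gap_bound[OF this]]
      show "e2ennreal (perturbed_gap X Y G K J (xag N \<omega>, yag N \<omega>) (perturbation \<omega>)) \<le> ennreal (gap_bound \<omega>)"
        by (simp add: ennreal.rep_eq e2ennreal_ereal)
    qed
    also have "\<dots> = ennreal (\<integral>\<omega>. gap_bound \<omega> \<partial>M)"
      by (rule nn_integral_eq_integral[OF expected_gap_bound(1)[OF solution]])
         (use gap_bound_nonneg in \<open>auto intro: AE_I2\<close>)
    also have "\<dots> \<le> ennreal \<epsilon>N"
      using expected_gap_bound(2)[OF solution] arith(1) unfolding D2 weighted_variance \<epsilon>N_def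
      by (intro ennreal_leI) linarith
    finally have "enn2ereal (\<integral>\<^sup>+\<omega>. e2ennreal (perturbed_gap X Y G K J (xag N \<omega>, yag N \<omega>) (perturbation \<omega>)) \<partial>M)
        \<le> enn2ereal (ennreal \<epsilon>N)"
      by (simp add: less_eq_ennreal.rep_eq)
    moreover have "0 \<le> \<epsilon>N"
      unfolding \<epsilon>N_def using LG LK_nonneg \<sigma>_nonneg Dt D(2) n by simp
    ultimately show "enn2ereal (\<integral>\<^sup>+\<omega>. e2ennreal (perturbed_gap X Y G K J (xag N \<omega>, yag N \<omega>) (perturbation \<omega>)) \<partial>M)
        \<le> ereal \<epsilon>N"
      by (simp add: enn2ereal_ennreal)
    show "\<epsilon>N \<le> 36 * LG * D\<^sup>2 / (real N * (real N - 1)) + 36 * LK * D\<^sup>2 / real N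
                 + \<sigma> * D * (18 * D / Dt + 3 * Dt / D) / sqrt (real N - 1)"
      by (simp add: \<epsilon>N_def)
    show "integrable M (\<lambda>\<omega>. norm (perturbation \<omega>))"
      by (rule perturbation_integrable[OF solution])
    have sqrt_D2: "sqrt (D\<^sup>2) = D" using D(2) by simp
    show "(\<integral>\<omega>. norm (perturbation \<omega>) \<partial>M) \<le> 50 * LG * D / (real N * (real N - 1))
                 + LK * D * (55 + 3 * Dt / D) / real N
                 + \<sigma> * (6 + 25 * D / Dt) / sqrt (real N - 1)"
      by (rule order_trans[OF expected_perturbation[OF solution, unfolded sq_radius D2 weighted_variance sqrt_D2] arith(2)])
  qed
qed

end
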